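(* Consider the downlink virtual-cell mmWave network model without small-scale fading described in the context. For $s>0$ put $$W_{\rm L}(s)=2\pi\lambda\sum_{n=1}^{2}b_n\int_{r_K}^{\infty}\left(1-e^{-s a_n C_{\rm L}x^{-\alpha_{\rm L}}}\right)p(x)\,x\,dx,$$ $$W_{\rm N}(s)=2\pi\lambda\sum_{n=1}^{2}b_n\int_{r_K}^{\infty}\left(1-e^{-s a_n C_{\rm N}x^{-\alpha_{\rm N}}}\right)(1-p(x))\,x\,dx.$$ Then for $\bm r=(r_1,\dots,r_K)$ with $0<r_1\le\cdots\le r_K$ the conditional ergodic capacity is $$C_{\rm cond}(\bm r)=\frac{1}{\ln 2}\int_0^\infty\frac{e^{-s\sigma^2}}{s}\,e^{-(W_{\rm L}(s)+W_{\rm N}(s))}\left(1-\prod_{k=1}^{K}e^{-sMC_{\rm L}r_k^{-\alpha_{\rm L}}}\right)ds,$$ and the downlink ergodic capacity is $$C=\frac{1}{\ln 2}\int\cdots\int_{\mathcal D}(2\pi\lambda)^K r_1\cdots r_K\,e^{-\pi\lambda r_K^2}\int_0^\infty\frac{e^{-s\sigma^2}}{s}\,e^{-(W_{\rm L}(s)+W_{\rm N}(s))}\left(1-\prod_{k=1}^{K}e^{-sMC_{\rm L}r_k^{-\alpha_{\rm L}}}\right)ds\,d\bm r,$$ where $\mathcal D=\{0<r_1\le\cdots\le r_K\}$ and $d\bm r=dr_1\cdots dr_K$.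
   Context: Parameters: density $\lambda>0$; integer $K\ge 1$; blockage parameter $\beta>0$ and LOS probability function $p(r)=e^{-\beta r}$; path loss exponents $\alpha_{\rm L},\alpha_{\rm N}>0$ and intercepts $C_{\rm L},C_{\rm N}>0$; main lobe gain $M>0$, sidelobe gain $m>0$, beamwidth $\theta_b\in(0,2\pi]$; noise power $\sigma^2>0$ (normalized by transmit power). Set $a_1=M$, $b_1=\theta_b/(2\pi)$, $a_2=m$, $b_2=1-\theta_b/(2\pi)$. Model. Access points (APs) form a homogeneous Poisson point process (PPP) of density $\lambda$ on $\mathbb R^2$; the typical user is at the origin. Order the APs by increasing distance $r_1\le r_2\le\cdots$ to the origin. The $K$ closest APs serve the user; all others interfere. The joint density of $(r_1,\dots,r_K)$ on $\mathcal D=\{0<r_1\le\cdots\le r_K\}$ is $f(\bm r)=(2\pi\lambda)^K r_1\cdots r_K e^{-\pi\lambda r_K^2}$. All serving APs are assumed to be line-of-sight (LOS), each with antenna gain $M$. Conditionally on $(r_1,\dots,r_K)$, the interfering APs are the points, outside the disc $\mathcal B(r_K)$ of radius $r_K$ centered at the origin, of two independent non-homogeneous PPPs: the LOS process $\Phi_{\rm L}$ with intensity $\lambda p(|x|)$ and the non-line-of-sight (NLOS) process $\Phi_{\rm N}$ with intensity $\lambda(1-p(|x|))$. The antenna gains $G_l$ of interfering APs are i.i.d. (and independent of everything else) with $\mathbb P(G_l=a_n)=b_n$, $n=1,2$. There is no small-scale fading (all fading powers equal $1$). The SINR is $$\gamma'=\frac{\sum_{k=1}^K MC_{\rm L}r_k^{-\alpha_{\rm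 L}}}{I'_{\rm L}+I'_{\rm N}+\sigma^2},\quad I'_{\rm L}=\sum_{l\in\Phi_{\rm L},\,r_l>r_K}G_lC_{\rm L}r_l^{-\alpha_{\rm L}},\quad I'_{\rm N}=\sum_{l\in\Phi_{\rm N},\,r_l>r_K}G_lC_{\rm N}r_l^{-\alpha_{\rm N}}.$$ The conditional ergodic capacity $C_{\rm cond}(\bm r)$ is the conditional expectation of $\log_2(1+\gamma')$ given that the serving APs are at distances $\bm r=(r_1,\dots,r_K)$ (averaging over interfering AP locations and gains). The ergodic capacity is $C=\mathbb E[\log_2(1+\gamma')]=\int\cdots\int_{\mathcal D}C_{\rm cond}(\bm r)f(\bm r)\,d\bm r$. Conventions: if $I'_{\rm L}+I'_{\rm N}=\infty$ then $\gamma'=0$, and $e^{-\infty}=0$. *)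

theory Defs
  imports "HOL-Probability.Probability"
begin

record network =
  ap_density :: real
  num_serving :: nat
  blockage :: real
  ple_los :: real
  ple_nlos :: real
  intercept_los :: real
  intercept_nlos :: real
  main_gain :: real
  side_gain :: real
  beamwidth :: real
  noise_power :: real

definition valid_network :: "network \<Rightarrow> bool" where
  "valid_network \<N> \<longleftrightarrow>
     ap_density \<N> > 0 \<and> num_serving \<N> \<ge> 1 \<and> blockage \<N> > 0 \<and>
     ple_los \<N> > 0 \<and> ple_nlos \<N> > 0 \<and> intercept_los \<N> > 0 \<and> intercept_nlos \<N> > 0 \<and>
     main_gain \<N> > 0 \<and> side_gain \<N> > 0 \<and> 0 < beamwidth \<N> \<and> beamwidth \<N> \<le> 2 * pi \<and>
     noise_power \<N> > 0"

definition los_prob :: "network \<Rightarrow> real \<Rightarrow> real" where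
  "los_prob \<N> x = exp (- blockage \<N> * x)"

definition gain_value :: "network \<Rightarrow> nat \<Rightarrow> real" where
  "gain_value \<N> n = (if n = 1 then main_gain \<N> else side_gain \<N>)"

definition gain_weight :: "network \<Rightarrow> nat \<Rightarrow> real" where
  "gain_weight \<N> n = (if n = 1 then beamwidth \<N> / (2 * pi) else 1 - beamwidth \<N> / (2 * pi))"


text \<open>A point process is represented by its counting functions: \<open>N B \<omega>\<close> is the number of points in
  the measurable set \<open>B\<close>. The measure \<open>\<Lambda>\<close> is the intensity measure. The Poisson law of parameter
  \<open>c\<close> is written out because \<open>poisson_pmf\<close> excludes \<open>c = 0\<close>.\<close>

definition poisson_point_process ::
    "'w measure \<Rightarrow> 'a measure \<Rightarrow> ('a set \<Rightarrow> 'w \<Rightarrow> ennreal) \<Rightarrow> bool" where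
  "poisson_point_process P \<Lambda> N \<longleftrightarrow>
     (\<forall>B\<in>sets \<Lambda>. N B \<in> borel_measurable P) \<and>
     (\<forall>B\<in>sets \<Lambda>. emeasure \<Lambda> B < \<infinity> \<longrightarrow>
        (\<forall>k::nat. measure P {\<omega>\<in>space P. N B \<omega> = of_nat k} =
           measure \<Lambda> B ^ k / fact k * exp (- measure \<Lambda> B))) \<and>
     (\<forall>B\<in>sets \<Lambda>. emeasure \<Lambda> B = \<infinity> \<longrightarrow> (AE \<omega> in P. N B \<omega> = \<infinity>)) \<and>
     (\<forall>(I::nat set) B. finite I \<longrightarrow> (\<forall>i\<in>I. B i \<in> sets \<Lambda>) \<longrightarrow> disjoint_family_on B I \<longrightarrow>
        prob_space.indep_vars P (\<lambda>_. borel) (\<lambda>i. N (B i)) I)"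

definition indep_point_processes ::
    "'w measure \<Rightarrow> 'a set set \<Rightarrow> ('a set \<Rightarrow> 'w \<Rightarrow> ennreal) \<Rightarrow> ('a set \<Rightarrow> 'w \<Rightarrow> ennreal) \<Rightarrow> bool" where
  "indep_point_processes P \<B> N N' \<longleftrightarrow>
     prob_space.indep_var P
       (\<Pi>\<^sub>M B\<in>\<B>. borel) (\<lambda>\<omega>. \<lambda>B\<in>\<B>. N B \<omega>)
       (\<Pi>\<^sub>M B\<in>\<B>. borel) (\<lambda>\<omega>. \<lambda>B\<in>\<B>. N' B \<omega>)"

definition point_count :: "(nat \<Rightarrow> 'w \<Rightarrow> 'a) \<Rightarrow> (nat \<Rightarrow> 'w \<Rightarrow> bool) \<Rightarrow> 'a set \<Rightarrow> 'w \<Rightarrow> ennreal" where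
  "point_count X sel B \<omega> = emeasure (count_space UNIV) {i. sel i \<omega> \<and> X i \<omega> \<in> B}"


text \<open>\<open>X i\<close> is the location of the \<open>(i+1)\<close>-st closest AP, \<open>los i\<close> its line-of-sight
  indicator and \<open>G i\<close> its antenna gain as an interferer. The law of the gains is stated as
  a weighted sum of point masses so that equal main and side lobe gains are covered.\<close>

definition network_model ::
    "network \<Rightarrow> 'w measure \<Rightarrow> (nat \<Rightarrow> 'w \<Rightarrow> real^2) \<Rightarrow> (nat \<Rightarrow> 'w \<Rightarrow> bool) \<Rightarrow> (nat \<Rightarrow> 'w \<Rightarrow> real) \<Rightarrow> bool"
  where
  "network_model \<N> P X los G \<longleftrightarrow>
     prob_space P \<and>
     (\<forall>i. X i \<in> borel_measurable P) \<and>
     (\<forall>i. los i \<in> measurable P (count_space UNIV)) \<and>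
     (\<forall>i. G i \<in> borel_measurable P) \<and>
     (\<forall>\<omega>\<in>space P. \<forall>i. norm (X i \<omega>) \<le> norm (X (Suc i) \<omega>)) \<and>
     poisson_point_process P
       (density lborel (\<lambda>_. ennreal (ap_density \<N>)))
       (point_count X (\<lambda>_ _. True)) \<and>
     poisson_point_process P
       (density lborel (\<lambda>x. ennreal (ap_density \<N> * los_prob \<N> (norm x))))
       (point_count X los) \<and>
     poisson_point_process P
       (density lborel (\<lambda>x. ennreal (ap_density \<N> * (1 - los_prob \<N> (norm x)))))
       (point_count X (\<lambda>i \<omega>. \<not> los i \<omega>)) \<and>
     indep_point_processes P (sets borel)
       (point_count X los) (point_count X (\<lambda>i \<omega>. \<not> los i \<omega>)) \<and>
     prob_space.indep_vars P (\<lambda>_. borel) G UNIV \<and>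
     (\<forall>i. \<forall>A\<in>sets borel. measure P {\<omega>\<in>space P. G i \<omega> \<in> A} =
        (\<Sum>n=1..2. gain_weight \<N> n * indicator A (gain_value \<N> n))) \<and>
     prob_space.indep_set P
       (sets (vimage_algebra (space P) (\<lambda>\<omega> i. (X i \<omega>, los i \<omega>))
          (\<Pi>\<^sub>M i\<in>UNIV. borel \<Otimes>\<^sub>M count_space UNIV)))
       (sets (vimage_algebra (space P) (\<lambda>\<omega> i. G i \<omega>) (\<Pi>\<^sub>M i\<in>UNIV. borel)))"


text \<open>Vectors \<open>(r\<^sub>1, \<dots>, r\<^sub>K)\<close> are functions on \<open>{..<K}\<close>, so \<open>r k\<close> is the \<open>(k+1)\<close>-st distance.\<close>

definition last_dist :: "network \<Rightarrow> (nat \<Rightarrow> real) \<Rightarrow> real" where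
  "last_dist \<N> r = r (num_serving \<N> - 1)"

definition dist_domain :: "network \<Rightarrow> (nat \<Rightarrow> real) set" where
  "dist_domain \<N> = {r \<in> extensional {..<num_serving \<N>}.
     (\<forall>k<num_serving \<N>. 0 < r k) \<and> (\<forall>j k. j \<le> k \<longrightarrow> k < num_serving \<N> \<longrightarrow> r j \<le> r k)}"

definition serving_dists :: "network \<Rightarrow> (nat \<Rightarrow> 'w \<Rightarrow> real^2) \<Rightarrow> 'w \<Rightarrow> nat \<Rightarrow> real" where
  "serving_dists \<N> X \<omega> = (\<lambda>k\<in>{..<num_serving \<N>}. norm (X k \<omega>))"

text \<open>Sum over the selected points at distance greater than \<open>d\<close>; it may be infinite.\<close>

definition interference ::
    "real \<Rightarrow> real \<Rightarrow> (nat \<Rightarrow> 'w \<Rightarrow> real^2) \<Rightarrow> (nat \<Rightarrow> 'w \<Rightarrow> bool) \<Rightarrow> (nat \<Rightarrow> 'w \<Rightarrow> real) \<Rightarrow> real \<Rightarrow> 'w \<Rightarrow> ennreal"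
  where
  "interference C \<alpha> X sel G d \<omega> =
     (\<Sum>i. if sel i \<omega> \<and> norm (X i \<omega>) > d then ennreal (G i \<omega> * C * norm (X i \<omega>) powr (-\<alpha>)) else 0)"

definition total_interference ::
    "network \<Rightarrow> (nat \<Rightarrow> 'w \<Rightarrow> real^2) \<Rightarrow> (nat \<Rightarrow> 'w \<Rightarrow> bool) \<Rightarrow> (nat \<Rightarrow> 'w \<Rightarrow> real) \<Rightarrow> real \<Rightarrow> 'w \<Rightarrow> ennreal"
  where
  "total_interference \<N> X los G d \<omega> =
     interference (intercept_los \<N>) (ple_los \<N>) X los G d \<omega> +
     interference (intercept_nlos \<N>) (ple_nlos \<N>) X (\<lambda>i \<omega>. \<not> los i \<omega>) G d \<omega>"

text \<open>SINR for serving distances \<open>r\<close>, the interferers being the points farther than \<open>r\<^sub>K\<close>.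
  The serving APs are line-of-sight, whatever their indicators \<open>los\<close>.\<close>

definition sinr ::
    "network \<Rightarrow> (nat \<Rightarrow> 'w \<Rightarrow> real^2) \<Rightarrow> (nat \<Rightarrow> 'w \<Rightarrow> bool) \<Rightarrow> (nat \<Rightarrow> 'w \<Rightarrow> real) \<Rightarrow> (nat \<Rightarrow> real) \<Rightarrow> 'w \<Rightarrow> real"
  where
  "sinr \<N> X los G r \<omega> =
     (let I = total_interference \<N> X los G (last_dist \<N> r) \<omega> in
      if I = \<infinity> then 0
      else (\<Sum>k<num_serving \<N>. main_gain \<N> * intercept_los \<N> * r k powr (- ple_los \<N>)) /
           (enn2real I + noise_power \<N>))"

definition rate ::
    "network \<Rightarrow> (nat \<Rightarrow> 'w \<Rightarrow> real^2) \<Rightarrow> (nat \<Rightarrow> 'w \<Rightarrow> bool) \<Rightarrow> (nat \<Rightarrow> 'w \<Rightarrow> real) \<Rightarrow> 'w \<Rightarrow> ennreal"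
  where
  "rate \<N> X los G \<omega> = ennreal (log 2 (1 + sinr \<N> X los G (serving_dists \<N> X \<omega>) \<omega>))"

text \<open>In the conditional model the serving distances are fixed to \<open>r\<close> and the interferers are
  the points outside the disc of radius \<open>r\<^sub>K\<close> of the two independent (unconditioned)
  Poisson processes. Capacities are integrals of nonnegative functions, with values
  in \<open>[0, \<infinity>]\<close>.\<close>

definition cond_capacity ::
    "network \<Rightarrow> 'w measure \<Rightarrow> (nat \<Rightarrow> 'w \<Rightarrow> real^2) \<Rightarrow> (nat \<Rightarrow> 'w \<Rightarrow> bool) \<Rightarrow> (nat \<Rightarrow> 'w \<Rightarrow> real) \<Rightarrow> (nat \<Rightarrow> real) \<Rightarrow> ennreal"
  where
  "cond_capacity \<N> P X los G r = (\<integral>\<^sup>+ \<omega>. ennreal (log 2 (1 + sinr \<N> X los G r \<omega>)) \<partial>P)"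

definition ergodic_capacity ::
    "network \<Rightarrow> 'w measure \<Rightarrow> (nat \<Rightarrow> 'w \<Rightarrow> real^2) \<Rightarrow> (nat \<Rightarrow> 'w \<Rightarrow> bool) \<Rightarrow> (nat \<Rightarrow> 'w \<Rightarrow> real) \<Rightarrow> ennreal"
  where
  "ergodic_capacity \<N> P X los G = (\<integral>\<^sup>+ \<omega>. rate \<N> X los G \<omega> \<partial>P)"

definition serving_dists_algebra :: "network \<Rightarrow> 'w measure \<Rightarrow> (nat \<Rightarrow> 'w \<Rightarrow> real^2) \<Rightarrow> 'w measure" where
  "serving_dists_algebra \<N> P X =
     vimage_algebra (space P) (serving_dists \<N> X) (\<Pi>\<^sub>M k\<in>{..<num_serving \<N>}. borel)"


text \<open>\<open>W_los\<close> and \<open>W_nlos\<close> take the value \<open>\<infinity>\<close> when the integral diverges (which happens for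
  \<open>W_nlos\<close> when the path loss exponent is at most \<open>2\<close>), and \<open>exp_minus\<close> implements
  the convention \<open>e\<^sup>-\<^sup>\<infinity> = 0\<close>.\<close>

definition exp_minus :: "ennreal \<Rightarrow> real" where
  "exp_minus w = (if w = \<infinity> then 0 else exp (- enn2real w))"

definition W_los :: "network \<Rightarrow> real \<Rightarrow> real \<Rightarrow> ennreal" where
  "W_los \<N> d s = ennreal (2 * pi * ap_density \<N>) *
     (\<Sum>n=1..2. ennreal (gain_weight \<N> n) *
        (\<integral>\<^sup>+ x\<in>{d<..}. ennreal ((1 - exp (- s * gain_value \<N> n * intercept_los \<N> * x powr (- ple_los \<N>)))
           * los_prob \<N> x * x) \<partial>lborel))"

definition W_nlos :: "network \<Rightarrow> real \<Rightarrow> real \<Rightarrow> ennreal" where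
  "W_nlos \<N> d s = ennreal (2 * pi * ap_density \<N>) *
     (\<Sum>n=1..2. ennreal (gain_weight \<N> n) *
        (\<integral>\<^sup>+ x\<in>{d<..}. ennreal ((1 - exp (- s * gain_value \<N> n * intercept_nlos \<N> * x powr (- ple_nlos \<N>)))
           * (1 - los_prob \<N> x) * x) \<partial>lborel))"

definition capacity_integral :: "network \<Rightarrow> (nat \<Rightarrow> real) \<Rightarrow> ennreal" where
  "capacity_integral \<N> r =
     (\<integral>\<^sup>+ s\<in>{0<..}. ennreal (exp (- s * noise_power \<N>) / s
        * exp_minus (W_los \<N> (last_dist \<N> r) s + W_nlos \<N> (last_dist \<N> r) s)
        * (1 - (\<Prod>k<num_serving \<N>.
                 exp (- s * main_gain \<N> * intercept_los \<N> * r k powr (- ple_los \<N>))))) \<partial>lborel)"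

end

theory Submission
  imports Defs
begin

text \<open>For \<open>a > 0\<close> and \<open>S \<ge> 0\<close>, \<open>ln (1 + S / a)\<close> is the integral over \<open>s > 0\<close> of
  \<open>exp (- s a) (1 - exp (- s S)) / s\<close>. With \<open>a\<close> the interference plus noise and \<open>S\<close> the signal, taking
  expectations reduces the capacity to the Laplace transform of the interference. Averaging first
  over the gains turns this transform into the Laplace functional of the two Poisson processes,
  which is explicit. For fixed serving distances nothing more is needed. For random serving distances
  the points beyond the last serving one must be shown to form a fresh Poisson process outside the
  random disc; the same property applied to the probability that an annulus is void yields the joint
  density of the serving distances by induction on their number.\<close>

section \<open>The Laplace weight and two integrals\<close>

text \<open>The Poisson hypotheses speak only of counts in fixed sets, while the serving distances
  are order statistics of the same points and the interferers are cut off at one of them. Since the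
  points are sorted by norm, \<open>norm (X j \<omega>) < t\<close> says that the open ball of
  radius \<open>t\<close> holds at least \<open>j + 1\<close> points. Events about the first
  distances thus become statements about counts inside a ball, and independence over disjoint cells
  separates them from everything outside.

  The NLOS interference may be infinite, and so may the intensity of a cell. All quantities
  therefore live in \<open>ennreal\<close>, where sums and exchanges of integrals require no
  integrability, and the value 0 of the exponential at infinite exponents is built into the weight.

  Void probabilities are a special case of the Laplace functional: infinite weight on a set turns
  the weight of the configuration into the indicator that the set is empty. Emptiness of an annulus
  beyond the K-th point identifies the next distance only if no two points share a norm, so ties
  must be excluded almost surely.\<close>

definition nexp :: "ennreal \<Rightarrow> ennreal" where
  "nexp w = ennreal (exp_minus w)"

lemma nexp_top [simp]: "nexp \<infinity> = 0" "nexp top = 0"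
  by (simp_all add: nexp_def exp_minus_def)

lemma nexp_ennreal: "0 \<le> x \<Longrightarrow> nexp (ennreal x) = ennreal (exp (- x))"
  by (simp add: nexp_def exp_minus_def)

lemma nexp_0 [simp]: "nexp 0 = 1"
  by (simp add: nexp_def exp_minus_def)

lemma nexp_eq_1D: "nexp a = 1 \<Longrightarrow> a = 0"
  by (cases a) (auto simp: nexp_ennreal)

lemma nexp_add: "nexp (a + b) = nexp a * nexp b"
  by (cases a; cases b)
    (simp_all add: nexp_ennreal mult_exp_exp flip: ennreal_plus ennreal_mult'')

lemma nexp_antimono: "a \<le> b \<Longrightarrow> nexp b \<le> nexp a"
  by (cases a; cases b) (auto simp: nexp_ennreal top_unique)

lemma nexp_le_1 [simp]: "nexp a \<le> 1"
  using nexp_antimono[of 0 a] by simp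

lemma nexp_sum: "nexp (\<Sum>i\<in>I. f i) = (\<Prod>i\<in>I. nexp (f i))"
  by (induction I rule: infinite_finite_induct) (simp_all add: nexp_add)

lemma nexp_of_nat_mult: "nexp (of_nat n * a) = nexp a ^ n"
  by (induction n) (simp_all add: nexp_add distrib_right)

lemma nexp_neq_top [simp]: "nexp a \<noteq> top"
  by (simp add: nexp_def)

lemma measurable_nexp [measurable]: "nexp \<in> borel_measurable borel"
  unfolding nexp_def exp_minus_def by measurable

text \<open>The value 0 at infinity is the continuous extension of the exponential, so limits pass
  through the weight even where the interference diverges.\<close>

lemma tendsto_nexp:
  assumes "(f \<longlongrightarrow> l) F"
  shows "((\<lambda>x. nexp (f x)) \<longlongrightarrow> nexp l) F"
proof (cases "l = top")
  case True
  show ?thesis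
  proof (rule order_tendstoI)
    fix a assume a: "nexp l < a"
    have "\<exists>B\<ge>0. ennreal (exp (- B)) < a"
    proof (cases a)
      case (real r)
      then have r: "r > 0" using a True by simp
      \<comment> \<open>This gives \<open>exp (- B) \<le> r / exp 1 < r\<close>; the maximum keeps
        \<open>B\<close> nonnegative, so that \<open>nexp_ennreal\<close> applies.\<close>
      define B where "B = max 0 (1 - ln r)"
      have "exp (- B) \<le> exp (ln r - 1)" by (simp add: B_def)
      also have "\<dots> < r" using r by (simp add: exp_diff divide_less_eq)
      finally show ?thesis using real by (intro exI[of _ B]) (auto simp: B_def ennreal_less_iff)
    qed auto
    then obtain B where B: "B \<ge> 0" "ennreal (exp (- B)) < a" by blast
    have "eventually (\<lambda>x. f x > ennreal B) F"
      using order_tendstoD(1)[OF assms, of "ennreal B"] True by simp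
    then show "eventually (\<lambda>x. nexp (f x) < a) F"
    proof eventually_elim
      case (elim x)
      then have "nexp (f x) \<le> nexp (ennreal B)" by (intro nexp_antimono) simp
      with B show ?case by (simp add: nexp_ennreal)
    qed
  qed (use True in simp)
next
  case False
  then have l: "l < top" by (simp add: top.not_eq_extremum)
  have ev: "eventually (\<lambda>x. f x < top) F" using order_tendstoD(2)[OF assms l] .
  have "((\<lambda>x. enn2real (f x)) \<longlongrightarrow> enn2real l) F"
    using assms False l by (intro tendsto_enn2real) auto
  then have "((\<lambda>x. ennreal (exp (- enn2real (f x)))) \<longlongrightarrow> ennreal (exp (- enn2real l))) F"
    by (intro tendsto_ennrealI tendsto_exp tendsto_minus)
  moreover have "eventually (\<lambda>x. ennreal (exp (- enn2real (f x))) = nexp (f x)) F"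
    using ev by eventually_elim (simp add: nexp_def exp_minus_def)
  ultimately show ?thesis
    using False by (simp add: nexp_def[of l] exp_minus_def tendsto_cong)
qed

text \<open>Independence of the gains factors finite products only; this limit carries the
  factorisation over to infinitely many interferers.\<close>

lemma tendsto_prod_nexp: "(\<lambda>n. \<Prod>i<n. nexp (f i)) \<longlonglongrightarrow> nexp (\<Sum>i. f i)"
proof -
  have "(\<lambda>n. \<Sum>i<n. f i) \<longlonglongrightarrow> (\<Sum>i. f i)"
    using summable_sums[OF summableI] unfolding sums_def .
  from tendsto_nexp[OF this] show ?thesis by (simp add: nexp_sum)
qed

lemma nn_integral_exp_scaled:
  assumes "0 < b"
  shows "(\<integral>\<^sup>+ s\<in>{0<..}. ennreal (exp (- s * b)) \<partial>lborel) = ennreal (1 / b)"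
proof -
  have "(\<integral>\<^sup>+ s\<in>{0<..}. ennreal (exp (- s * b)) \<partial>lborel) =
      (\<integral>\<^sup>+ s. ennreal (exp (- s * b)) * indicator {0..} s \<partial>lborel)"
    by (intro nn_integral_cong_AE AE_I[of _ _ "{0}"]) (auto split: split_indicator)
  also have "\<dots> = ennreal (0 - (- exp (- 0 * b) / b))"
  proof (rule nn_integral_FTC_atLeast)
    show "((\<lambda>x. - exp (- x * b) / b) \<longlongrightarrow> 0) at_top"
      using assms by real_asymp
  qed (use assms in \<open>auto intro!: derivative_eq_intros\<close>)
  finally show ?thesis by simp
qed

text \<open>Writing (1 - exp (-s S)) / s as the integral of exp (-s u) over u in [0, S] turns this
  Frullani-type integral into the integral of 1 / (a + u).\<close>

lemma nn_integral_frullani_ln: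
  assumes a: "0 < a" and S: "0 \<le> S"
  shows "(\<integral>\<^sup>+ s\<in>{0<..}. ennreal (exp (- s * a) / s * (1 - exp (- s * S))) \<partial>lborel) =
    ennreal (ln (1 + S / a))"
proof -
  have inner: "(\<integral>\<^sup>+ u. ennreal (exp (- s * (a + u))) * indicator {0..S} u \<partial>lborel) =
      ennreal (exp (- s * a) / s * (1 - exp (- s * S)))" if "s > 0" for s
  proof -
    have "(\<integral>\<^sup>+ u. ennreal (exp (- s * (a + u))) * indicator {0..S} u \<partial>lborel) =
        ennreal (- exp (- s * (a + S)) / s - (- exp (- s * (a + 0)) / s))"
      using that S by (intro nn_integral_FTC_Icc) (auto intro!: derivative_eq_intros)
    also have "- exp (- s * (a + S)) / s - (- exp (- s * (a + 0)) / s) =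
        exp (- s * a) / s * (1 - exp (- s * S))"
      using that by (simp add: field_simps flip: exp_add)
    finally show ?thesis .
  qed
  have "(\<integral>\<^sup>+ s\<in>{0<..}. ennreal (exp (- s * a) / s * (1 - exp (- s * S))) \<partial>lborel) =
      (\<integral>\<^sup>+ s. (\<integral>\<^sup>+ u. ennreal (exp (- s * (a + u))) * indicator {0..S} u * indicator {0<..} s \<partial>lborel) \<partial>lborel)"
    by (intro nn_integral_cong) (auto simp: inner[simplified] split: split_indicator)
  also have "\<dots> = (\<integral>\<^sup>+ u. (\<integral>\<^sup>+ s. ennreal (exp (- s * (a + u))) * indicator {0..S} u * indicator {0<..} s \<partial>lborel) \<partial>lborel)"
    by (intro lborel_pair.Fubini') measurable
  also have "\<dots> = (\<integral>\<^sup>+ u. ennreal (1 / (a + u)) * indicator {0..S} u \<partial>lborel)"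
  proof (intro nn_integral_cong)
    fix u :: real
    show "(\<integral>\<^sup>+ s. ennreal (exp (- s * (a + u))) * indicator {0..S} u * indicator {0<..} s \<partial>lborel) =
        ennreal (1 / (a + u)) * indicator {0..S} u"
      using nn_integral_exp_scaled[of "a + u"] a
      by (auto split: split_indicator)
  qed
  also have "\<dots> = ennreal (ln (a + S) - ln (a + 0))"
    using a S by (intro nn_integral_FTC_Icc) (auto intro!: derivative_eq_intros simp: field_simps)
  also have "ln (a + S) - ln (a + 0) = ln (1 + S / a)"
  proof -
    have "1 + S / a = (a + S) / a" using a by (simp add: field_simps)
    with a S show ?thesis by (simp add: ln_div)
  qed
  finally show ?thesis .
qed

section \<open>Polar coordinates in the plane\<close>

lemma emeasure_norm_less_plane:
  assumes "0 \<le> t"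
  shows "emeasure lborel {x :: real^2. norm x < t} = ennreal (pi * t\<^sup>2)"
proof -
  have "{x :: real^2. norm x < t} = ball 0 t" by auto
  then show ?thesis using emeasure_ball[OF assms, of "0 :: real^2"] by (simp add: unit_ball_vol_2)
qed

lemma nn_integral_linear:
  assumes "0 \<le> a" "a \<le> t"
  shows "(\<integral>\<^sup>+ x. ennreal (2 * pi * x) * indicator {a..t} x \<partial>lborel) = ennreal (pi * t\<^sup>2 - pi * a\<^sup>2)"
  using assms by (intro nn_integral_FTC_Icc) (auto intro!: derivative_eq_intros)

text \<open>Open half-lines generate the Borel sets and are stable under intersection, so it
  suffices to compare the area of a disc with the integral of \<open>2 * pi * x\<close>. Writing the
  common value with \<open>max 0 t\<close> covers the empty disc.\<close>

lemma distr_norm_plane: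
  "distr (lborel :: (real^2) measure) borel norm = density lborel (\<lambda>x. ennreal (2 * pi * x) * indicator {0<..} x)"
    (is "?M = ?N")
proof (rule measure_eqI_generator_eq[where E = "range (\<lambda>t. {..<t})" and A = "\<lambda>n. {..<real n}" and \<Omega> = UNIV])
  have key: "emeasure ?M {..<t} = ennreal (pi * (max 0 t)\<^sup>2)" "emeasure ?N {..<t} = ennreal (pi * (max 0 t)\<^sup>2)" for t
  proof -
    have "emeasure ?M {..<t} = emeasure lborel {x :: real^2. norm x < t}"
      by (subst emeasure_distr) (auto simp: vimage_def)
    also have "\<dots> = ennreal (pi * (max 0 t)\<^sup>2)"
    proof (cases "t \<ge> 0")
      case False
      then have *: "{x :: real^2. norm x < t} = {}"
        by (auto simp: not_less intro: order_trans[of t 0])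
      show ?thesis unfolding * using False by simp
    qed (simp add: emeasure_norm_less_plane)
    finally show "emeasure ?M {..<t} = ennreal (pi * (max 0 t)\<^sup>2)" .
    have "emeasure ?N {..<t} = (\<integral>\<^sup>+ x. ennreal (2 * pi * x) * indicator {0<..} x * indicator {..<t} x \<partial>lborel)"
      by (subst emeasure_density) auto
    also have "\<dots> = (\<integral>\<^sup>+ x. ennreal (2 * pi * x) * indicator {0..max 0 t} x \<partial>lborel)"
      by (intro nn_integral_cong_AE AE_I[of _ _ "{0, t}"])
        (auto split: split_indicator simp: emeasure_lborel_countable)
    also have "\<dots> = ennreal (pi * (max 0 t)\<^sup>2)"
      by (subst nn_integral_linear) auto
    finally show "emeasure ?N {..<t} = ennreal (pi * (max 0 t)\<^sup>2)" .
  qed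
  show "emeasure ?M X = emeasure ?N X" if "X \<in> range (\<lambda>t. {..<t})" for X
    using that key by auto
  show "emeasure ?M {..<real n} \<noteq> \<infinity>" for n
    by (simp add: key)
  show "Int_stable (range (\<lambda>t::real. {..<t}))"
  proof (rule Int_stableI)
    fix a b :: "real set"
    assume "a \<in> range (\<lambda>t. {..<t})" "b \<in> range (\<lambda>t. {..<t})"
    then obtain s t where "a = {..<s}" "b = {..<t}" by auto
    then have "a \<inter> b = {..<min s t}" by auto
    then show "a \<inter> b \<in> range (\<lambda>t. {..<t})" by blast
  qed
  show "(\<Union>i. {..<real i}) = UNIV"
    using reals_Archimedean2 by auto
qed (auto simp: borel_Iio)

lemma nn_integral_norm_plane:
  assumes [measurable]: "f \<in> borel_measurable borel"
  shows "(\<integral>\<^sup>+ (x :: real^2). f (norm x) \<partial>lborel) =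
    (\<integral>\<^sup>+ x\<in>{0<..}. ennreal (2 * pi * x) * f x \<partial>lborel)"
proof -
  have "(\<integral>\<^sup>+ (x :: real^2). f (norm x) \<partial>lborel) = (\<integral>\<^sup>+ x. f x \<partial>distr (lborel :: (real^2) measure) borel norm)"
    by (simp add: nn_integral_distr)
  also have "\<dots> = (\<integral>\<^sup>+ x\<in>{0<..}. ennreal (2 * pi * x) * f x \<partial>lborel)"
    unfolding distr_norm_plane by (subst nn_integral_density) (auto simp: ac_simps)
  finally show ?thesis .
qed

section \<open>Laplace transform of Poisson counts and independence\<close>

lemma ennreal_cases_nexp:
  obtains q where "nexp c = ennreal q" "0 \<le> q" "q \<le> 1"
proof (cases "nexp c")
  case (real r)
  moreover have "r \<le> 1" using nexp_le_1[of c] real by (simp add: real)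
  ultimately show ?thesis using that by blast
qed simp

text \<open>With \<open>q = nexp c\<close> the integrand is \<open>q\<close> to the power of the
  count, so for finite mean \<mu> the expectation is the generating function
  \<open>exp (- \<mu> * (1 - q))\<close> of the Poisson law.\<close>

lemma poisson_laplace_transform:
  assumes "prob_space P" and ppp: "poisson_point_process P \<Lambda> N" and B: "B \<in> sets \<Lambda>"
  shows "(\<integral>\<^sup>+ \<omega>. nexp (c * N B \<omega>) \<partial>P) = nexp (emeasure \<Lambda> B * (1 - nexp c))"
proof -
  interpret prob_space P by fact
  have [measurable]: "N B \<in> borel_measurable P"
    using ppp B by (auto simp: poisson_point_process_def)
  obtain q where q: "nexp c = ennreal q" "0 \<le> q" "q \<le> 1" by (rule ennreal_cases_nexp)
  show ?thesis
  proof (cases "emeasure \<Lambda> B = \<infinity>")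
    case True
    then have AE: "AE \<omega> in P. N B \<omega> = \<infinity>"
      using ppp B by (auto simp: poisson_point_process_def)
    show ?thesis
    \<comment> \<open>The count is almost surely infinite here. Because
      \<open>0 * \<infinity> = 0\<close>, both sides equal 1 for \<open>c = 0\<close> and vanish
      otherwise.\<close>
    proof (cases "c = 0")
      case True
      then show ?thesis by (simp add: emeasure_space_1)
    next
      case False
      then have "nexp c \<noteq> 1" using nexp_eq_1D by blast
      then have "1 - nexp c \<noteq> 0"
        using q by (auto simp: ennreal_minus_if simp flip: ennreal_1)
      moreover have "(\<integral>\<^sup>+ \<omega>. nexp (c * N B \<omega>) \<partial>P) = (\<integral>\<^sup>+ \<omega>. 0 \<partial>P)"
        using AE False by (intro nn_integral_cong_AE) (auto simp: ennreal_mult_top)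
      ultimately show ?thesis using True by (simp add: ennreal_top_mult)
    qed
  next
    case False
    define \<mu> where "\<mu> = measure \<Lambda> B"
    have \<mu>: "emeasure \<Lambda> B = ennreal \<mu>" "0 \<le> \<mu>"
      using False by (auto simp: \<mu>_def emeasure_eq_ennreal_measure)
    define S where "S k = {\<omega> \<in> space P. N B \<omega> = of_nat k}" for k
    have [measurable]: "S k \<in> sets P" for k unfolding S_def by measurable
    have prob_S: "emeasure P (S k) = ennreal (\<mu> ^ k / fact k * exp (- \<mu>))" for k
      using ppp B False
      by (auto simp: S_def \<mu>_def emeasure_eq_measure poisson_point_process_def top.not_eq_extremum)
    have sums: "(\<Sum>k. ennreal ((r * \<mu>) ^ k / fact k * exp (- \<mu>))) = ennreal (exp (r * \<mu>) * exp (- \<mu>))"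
      if "0 \<le> r" for r
    proof (intro suminf_ennreal_eq)
      show "(\<lambda>k. (r * \<mu>) ^ k / fact k * exp (- \<mu>)) sums (exp (r * \<mu>) * exp (- \<mu>))"
        using exp_converges[of "r * \<mu>"] by (intro sums_mult2) (simp add: field_simps scaleR_conv_of_real)
    qed (use that \<mu> in auto)
    \<comment> \<open>Counts take values in \<open>ennreal\<close>. That they are almost surely
      natural numbers follows from the Poisson weights adding up to 1.\<close>
    have disj: "disjoint_family S"
      by (auto simp: disjoint_family_on_def S_def)
    have "emeasure P (\<Union>k. S k) = (\<Sum>k. emeasure P (S k))"
      using disj by (intro suminf_emeasure[symmetric]) auto
    also have "\<dots> = 1"
      using sums[of 1] by (simp add: prob_S flip: exp_add)
    finally have "AE \<omega> in P. \<omega> \<in> (\<Union>k. S k)"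
      by (intro AE_prob_1) (simp add: measure_def)
    then have "(\<integral>\<^sup>+ \<omega>. nexp (c * N B \<omega>) \<partial>P) =
        (\<integral>\<^sup>+ \<omega>. (\<Sum>k. nexp c ^ k * indicator (S k) \<omega>) \<partial>P)"
    proof (intro nn_integral_cong_AE, eventually_elim)
      case (elim \<omega>)
      then obtain k where k: "\<omega> \<in> S k" by blast
      then have "indicator (S j) \<omega> = (if j = k then 1 else 0 :: ennreal)" for j
        by (auto simp: S_def)
      then have "(\<Sum>j. nexp c ^ j * indicator (S j) \<omega>) = (\<Sum>j. if j = k then nexp c ^ j else 0)"
        by (intro suminf_cong) simp
      also have "\<dots> = nexp c ^ k"
        by (rule sums_unique[symmetric]) (rule sums_single)
      also have "\<dots> = nexp (c * N B \<omega>)"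
        using k by (simp add: S_def mult.commute[of c] nexp_of_nat_mult)
      finally show ?case by simp
    qed
    also have "\<dots> = (\<Sum>k. nexp c ^ k * emeasure P (S k))"
      by (subst nn_integral_suminf) (auto simp: nn_integral_cmult_indicator)
    also have "\<dots> = (\<Sum>k. ennreal ((q * \<mu>) ^ k / fact k * exp (- \<mu>)))"
      using q \<mu> by (intro suminf_cong)
        (simp add: prob_S ennreal_power power_mult_distrib flip: ennreal_mult)
    also have "\<dots> = ennreal (exp (- (\<mu> * (1 - q))))"
      using q by (subst sums) (simp_all add: algebra_simps flip: exp_add)
    also have "\<dots> = nexp (emeasure \<Lambda> B * (1 - nexp c))"
      using q \<mu> by (simp add: nexp_ennreal ennreal_minus flip: ennreal_1 ennreal_mult)
    finally show ?thesis .
  qed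
qed

section \<open>Independence of families of random variables\<close>

context prob_space begin

lemma indep_var_nn_integral:
  assumes "indep_var borel X borel Y"
  shows "(\<integral>\<^sup>+ \<omega>. X \<omega> * Y \<omega> \<partial>M) = (\<integral>\<^sup>+ \<omega>. X \<omega> \<partial>M) * (\<integral>\<^sup>+ \<omega>. Y \<omega> \<partial>M)"
proof -
  have "indep_vars (\<lambda>_. borel) (case_bool X Y) UNIV"
    using assms unfolding indep_var_def
    by (rule indep_vars_cong[THEN iffD1, rotated -1]) (auto split: bool.split)
  from indep_vars_nn_integral[OF _ this] show ?thesis
    by (simp add: UNIV_bool mult.commute)
qed

text \<open>Independence of Poisson counts is postulated for cells indexed by natural numbers; this
  transports it to the index types by which cells are labelled later.\<close>

lemma indep_vars_reindex:
  assumes h: "inj_on h I" and ind: "indep_vars M' X (h ` I)"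
  shows "indep_vars (\<lambda>i. M' (h i)) (\<lambda>i. X (h i)) I"
  unfolding indep_vars_def2 indep_sets_def
proof (intro conjI ballI allI impI)
  fix J A
  assume J: "J \<subseteq> I" "J \<noteq> {}" "finite J"
    and A: "A \<in> (\<Pi> j\<in>J. {X (h j) -` A \<inter> space M |A. A \<in> sets (M' (h j))})"
  have "\<forall>j\<in>J. \<exists>B. B \<in> sets (M' (h j)) \<and> A j = X (h j) -` B \<inter> space M"
    using A by (auto simp: Pi_iff)
  then obtain B where B: "\<And>j. j \<in> J \<Longrightarrow> B j \<in> sets (M' (h j))" "\<And>j. j \<in> J \<Longrightarrow> A j = X (h j) -` B j \<inter> space M"
    by metis
  have inj: "inj_on h J" using h J(1) by (rule inj_on_subset)
  define C where "C k = B (the_inv_into J h k)" for k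
  have C: "C (h j) = B j" if "j \<in> J" for j
    using that inj by (simp add: C_def the_inv_into_f_f)
  have "prob (\<Inter>k\<in>h ` J. X k -` C k \<inter> space M) = (\<Prod>k\<in>h ` J. prob (X k -` C k \<inter> space M))"
    using J B C by (intro indep_varsD[OF ind]) auto
  then show "prob (\<Inter>j\<in>J. A j) = (\<Prod>j\<in>J. prob (A j))"
    using inj B C J(2) by (simp add: prod.reindex)
qed (use ind in \<open>auto simp: indep_vars_def2 indep_sets_def\<close>)

text \<open>Independence within each mark and independence between the two marks combine: the
  product formula is split first by mark and then by cell. Only the intersection over the full index
  set has to be treated, because subfamilies arise by choosing the whole space for the remaining
  indices.\<close>

lemma indep_vars_Times_bool:
  assumes I: "finite I" and ind: "\<And>b. indep_vars (\<lambda>_. N) (Y b) I"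
    and TF: "indep_var (PiM I (\<lambda>_. N)) (\<lambda>\<omega>. \<lambda>i\<in>I. Y True i \<omega>) (PiM I (\<lambda>_. N)) (\<lambda>\<omega>. \<lambda>i\<in>I. Y False i \<omega>)"
  shows "indep_vars (\<lambda>_. N) (\<lambda>(b, i). Y b i) (UNIV \<times> I)"
proof (cases "I = {}")
  case True
  then show ?thesis by (simp add: indep_vars_def2 indep_sets_def)
next
  case False
  have rv: "random_variable N (Y b i)" if "i \<in> I" for b i
    using ind that by (auto simp: indep_vars_def2)
  have "prob (\<Inter>j\<in>UNIV \<times> I. (case j of (b, i) \<Rightarrow> Y b i) -` A j \<inter> space M) =
      (\<Prod>j\<in>UNIV \<times> I. prob ((case j of (b, i) \<Rightarrow> Y b i) -` A j \<inter> space M))"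
    if A: "A \<in> (\<Pi> j\<in>UNIV \<times> I. sets N)" for A
  proof -
    define S where "S b = (\<Inter>i\<in>I. Y b i -` A (b, i) \<inter> space M)" for b
    have prob_S: "prob (S b) = (\<Prod>i\<in>I. prob (Y b i -` A (b, i) \<inter> space M))" for b
      unfolding S_def using A False I by (intro indep_varsD[OF ind]) auto
    have S: "(\<lambda>\<omega>. \<lambda>i\<in>I. Y b i \<omega>) -` (\<Pi>\<^sub>E i\<in>I. A (b, i)) \<inter> space M = S b" for b
      using False by (auto simp: S_def)
    have PiE: "(\<Pi>\<^sub>E i\<in>I. A (b, i)) \<in> sets (PiM I (\<lambda>_. N))" for b
      using A I by (intro sets_PiM_I_finite) auto
    have "(\<Inter>j\<in>UNIV \<times> I. (case j of (b, i) \<Rightarrow> Y b i) -` A j \<inter> space M) = S True \<inter> S False"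
      using False by (auto simp: S_def UNIV_bool)
    also have "\<dots> = (\<lambda>x. (\<lambda>i\<in>I. Y True i x, \<lambda>i\<in>I. Y False i x)) -`
        ((\<Pi>\<^sub>E i\<in>I. A (True, i)) \<times> (\<Pi>\<^sub>E i\<in>I. A (False, i))) \<inter> space M"
      unfolding S[symmetric] by auto
    also have "prob \<dots> = prob (S True) * prob (S False)"
      unfolding S[symmetric] by (rule indep_varD[OF TF PiE PiE])
    also have "\<dots> =
        (\<Prod>b\<in>UNIV. \<Prod>i\<in>I. prob (Y b i -` A (b, i) \<inter> space M))"
      by (simp add: prob_S UNIV_bool mult.commute)
    also have "\<dots> = (\<Prod>j\<in>UNIV \<times> I. prob ((case j of (b, i) \<Rightarrow> Y b i) -` A j \<inter> space M))"
      by (subst prod.cartesian_product) (auto intro!: prod.cong)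
    finally show ?thesis .
  qed
  then show ?thesis
    using False I rv
    by (subst indep_vars_finite[where E = "\<lambda>_. sets N"])
      (auto simp: sets.sigma_sets_eq sets.Int_stable dest: sets.sets_into_space)
qed

end

section \<open>Marked Poisson processes ordered by norm\<close>

text \<open>\<open>L b\<close> is the intensity measure of the points with mark \<open>b\<close>.\<close>

locale marked_poisson = prob_space P
  for P :: "'w measure" +
  fixes X :: "nat \<Rightarrow> 'w \<Rightarrow> 'a::euclidean_space"
    and los :: "nat \<Rightarrow> 'w \<Rightarrow> bool"
    and L :: "bool \<Rightarrow> 'a measure"
  assumes X_measurable [measurable]: "X i \<in> borel_measurable P"
    and los_measurable [measurable]: "los i \<in> measurable P (count_space UNIV)"
    and norm_X_le_Suc: "\<omega> \<in> space P \<Longrightarrow> norm (X i \<omega>) \<le> norm (X (Suc i) \<omega>)"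
    and sets_L [measurable_cong, simp]: "sets (L b) = sets borel"
    and sigma_finite_L: "sigma_finite_measure (L b)"
    and poisson_mark: "poisson_point_process P (L b) (point_count X (\<lambda>i \<omega>. los i \<omega> = b))"
    and indep_marks: "indep_point_processes P (sets borel)
      (point_count X (\<lambda>i \<omega>. los i \<omega> = True)) (point_count X (\<lambda>i \<omega>. los i \<omega> = False))"
begin

abbreviation cnt :: "bool \<Rightarrow> 'a set \<Rightarrow> 'w \<Rightarrow> ennreal" where
  "cnt b \<equiv> point_count X (\<lambda>i \<omega>. los i \<omega> = b)"

definition total :: "('a \<Rightarrow> bool \<Rightarrow> ennreal) \<Rightarrow> 'w \<Rightarrow> ennreal" where
  "total \<phi> \<omega> = (\<Sum>i. \<phi> (X i \<omega>) (los i \<omega>))"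

text \<open>The exponent of the Laplace functional of a Poisson process, the integral of
  \<open>1 - exp (- \<phi>)\<close> against the intensity, added over the two independent
  marks.\<close>

definition laplace_exponent :: "('a \<Rightarrow> bool \<Rightarrow> ennreal) \<Rightarrow> ennreal" where
  "laplace_exponent \<phi> = (\<Sum>b\<in>UNIV. \<integral>\<^sup>+ x. 1 - nexp (\<phi> x b) \<partial>L b)"

definition dists :: "nat \<Rightarrow> 'w \<Rightarrow> nat \<Rightarrow> real" where
  "dists K \<omega> = (\<lambda>k\<in>{..<K}. norm (X k \<omega>))"

lemma space_L [simp]: "space (L b) = UNIV"
  using sets_eq_imp_space_eq[OF sets_L] by simp

lemma norm_X_mono:
  assumes "\<omega> \<in> space P" "i \<le> j"
  shows "norm (X i \<omega>) \<le> norm (X j \<omega>)"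
  using lift_Suc_mono_le[of "\<lambda>i. norm (X i \<omega>)"] norm_X_le_Suc assms by blast

lemma cnt_measurable [measurable]:
  assumes "B \<in> sets borel"
  shows "cnt b B \<in> borel_measurable P"
  using poisson_mark[of b] assms by (auto simp: poisson_point_process_def)

lemma dists_measurable [measurable]: "dists K \<in> measurable P (\<Pi>\<^sub>M k\<in>{..<K}. borel)"
  unfolding dists_def by measurable

lemma total_measurable [measurable]:
  assumes [measurable]: "\<And>b. (\<lambda>x. \<phi> x b) \<in> borel_measurable borel"
  shows "total \<phi> \<in> borel_measurable P"
proof -
  have "(\<lambda>\<omega>. \<phi> (X i \<omega>) (los i \<omega>)) =
      (\<lambda>\<omega>. if los i \<omega> then \<phi> (X i \<omega>) True else \<phi> (X i \<omega>) False)" for i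
    by auto
  then show ?thesis unfolding total_def[abs_def] by measurable
qed

text \<open>As an integral over the counting measure, \<open>total\<close> inherits monotone
  convergence and additivity.\<close>

lemma total_eq_nn_integral: "total \<phi> \<omega> = (\<integral>\<^sup>+ i. \<phi> (X i \<omega>) (los i \<omega>) \<partial>count_space UNIV)"
  by (simp add: total_def nn_integral_count_space_nat)

text \<open>The bridge between the two descriptions of the process: the axioms are about counts of
  cells, the interference is a sum over points. A linear combination of counts is the total of a
  simple function.\<close>

lemma sum_cnt_eq_total:
  assumes "finite J"
  shows "(\<Sum>(b, j)\<in>UNIV \<times> J. c b j * cnt b (C b j) \<omega>) = total (\<lambda>x b. \<Sum>j\<in>J. c b j * indicator (C b j) x) \<omega>"
proof -
  have "(\<Sum>(b, j)\<in>UNIV \<times> J. c b j * cnt b (C b j) \<omega>) =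
      (\<integral>\<^sup>+ i. (\<Sum>(b, j)\<in>UNIV \<times> J. c b j * indicator {i. los i \<omega> = b \<and> X i \<omega> \<in> C b j} i) \<partial>count_space UNIV)"
    by (subst nn_integral_sum)
      (auto simp: point_count_def split_beta nn_integral_cmult_indicator intro!: sum.cong)
  also have "\<dots> = total (\<lambda>x b. \<Sum>j\<in>J. c b j * indicator (C b j) x) \<omega>"
    unfolding total_eq_nn_integral
  proof (rule nn_integral_cong)
    fix i
    have "(\<Sum>(b, j)\<in>UNIV \<times> J. c b j * indicator {i. los i \<omega> = b \<and> X i \<omega> \<in> C b j} i) =
        (\<Sum>b\<in>UNIV. \<Sum>j\<in>J. c b j * indicator {i. los i \<omega> = b \<and> X i \<omega> \<in> C b j} i)"
      by (simp add: sum.cartesian_product)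
    also have "\<dots> = (\<Sum>j\<in>J. c (los i \<omega>) j * indicator (C (los i \<omega>) j) (X i \<omega>))"
      by (cases "los i \<omega>") (auto simp: UNIV_bool indicator_def intro!: sum.cong)
    finally show "(\<Sum>(b, j)\<in>UNIV \<times> J. c b j * indicator {i. los i \<omega> = b \<and> X i \<omega> \<in> C b j} i) =
      (\<Sum>j\<in>J. c (los i \<omega>) j * indicator (C (los i \<omega>) j) (X i \<omega>))" .
  qed
  finally show ?thesis .
qed

text \<open>An injection of \<open>J\<close> into the natural numbers reduces each mark to the
  Poisson axiom. Between the marks, the finitely many counts are coordinates of the two full
  families of counts, whose independence is assumed.\<close>

lemma indep_cnt:
  fixes C :: "bool \<Rightarrow> 'j \<Rightarrow> 'a set"
  assumes J: "finite J" and C: "\<And>b j. j \<in> J \<Longrightarrow> C b j \<in> sets borel"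
    and disj: "\<And>b. disjoint_family_on (C b) J"
  shows "indep_vars (\<lambda>_. borel) (\<lambda>(b, j). cnt b (C b j)) (UNIV \<times> J)"
proof (rule indep_vars_Times_bool[OF J])
  obtain h :: "'j \<Rightarrow> nat" where h: "inj_on h J"
    using J finite_imp_inj_to_nat_seg by blast
  show "indep_vars (\<lambda>_. borel) (\<lambda>j. cnt b (C b j)) J" for b
  proof -
    define D where "D k = C b (the_inv_into J h k)" for k
    have D: "D (h j) = C b j" if "j \<in> J" for j
      using that h by (simp add: D_def the_inv_into_f_f)
    have "indep_vars (\<lambda>_. borel) (\<lambda>k. cnt b (D k)) (h ` J)"
      using poisson_mark[of b, unfolded poisson_point_process_def] J C D disj[of b] h
      by (auto simp: disjoint_family_on_def inj_on_eq_iff)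
    from indep_vars_reindex[OF h this] show ?thesis
      by (rule indep_vars_cong[THEN iffD1, rotated -1]) (auto simp: D)
  qed
  have "(\<lambda>m. \<lambda>j\<in>J. m (C b j)) \<in> measurable (\<Pi>\<^sub>M B\<in>sets borel. borel) (\<Pi>\<^sub>M j\<in>J. borel :: ennreal measure)" for b
    using C by (intro measurable_restrict measurable_component_singleton) auto
  note m = this
  have eq: "(\<lambda>m. \<lambda>j\<in>J. m (C b j)) \<circ> (\<lambda>\<omega>. \<lambda>B\<in>sets borel. cnt b B \<omega>) = (\<lambda>\<omega>. \<lambda>j\<in>J. cnt b (C b j) \<omega>)" for b
    using C by (auto simp: fun_eq_iff restrict_def)
  show "indep_var (\<Pi>\<^sub>M j\<in>J. borel) (\<lambda>\<omega>. \<lambda>j\<in>J. cnt True (C True j) \<omega>)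
      (\<Pi>\<^sub>M j\<in>J. borel) (\<lambda>\<omega>. \<lambda>j\<in>J. cnt False (C False j) \<omega>)"
    using indep_var_compose[OF indep_marks[unfolded indep_point_processes_def] m[of True] m[of False]]
    unfolding eq .
qed

text \<open>The form in which independence is used: an arbitrary functional of one group of cells
  against an exponential functional of another, the latter factoring into Poisson Laplace
  transforms.\<close>

lemma nn_integral_cnt_factor:
  fixes C :: "bool \<Rightarrow> 'j \<Rightarrow> 'a set"
  assumes J: "finite J1" "finite J2" "J1 \<inter> J2 = {}"
    and C: "\<And>b j. j \<in> J1 \<union> J2 \<Longrightarrow> C b j \<in> sets borel"
    and disj: "\<And>b. disjoint_family_on (C b) (J1 \<union> J2)"
    and h [measurable]: "h \<in> borel_measurable (\<Pi>\<^sub>M i\<in>UNIV \<times> J1. borel)"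
  shows "(\<integral>\<^sup>+ \<omega>. h (\<lambda>(b, j)\<in>UNIV \<times> J1. cnt b (C b j) \<omega>) *
        nexp (\<Sum>(b, j)\<in>UNIV \<times> J2. c b j * cnt b (C b j) \<omega>) \<partial>P) =
      (\<integral>\<^sup>+ \<omega>. h (\<lambda>(b, j)\<in>UNIV \<times> J1. cnt b (C b j) \<omega>) \<partial>P) *
      nexp (\<Sum>(b, j)\<in>UNIV \<times> J2. emeasure (L b) (C b j) * (1 - nexp (c b j)))"
proof -
  define Z where "Z = (\<lambda>(b, j). cnt b (C b j))"
  have ind: "indep_vars (\<lambda>_. borel) Z (UNIV \<times> (J1 \<union> J2))"
    unfolding Z_def using J C disj by (intro indep_cnt) auto
  have "indep_var (\<Pi>\<^sub>M i\<in>UNIV \<times> J1. borel) (\<lambda>\<omega>. \<lambda>i\<in>UNIV \<times> J1. Z i \<omega>)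
      (\<Pi>\<^sub>M i\<in>UNIV \<times> J2. borel) (\<lambda>\<omega>. \<lambda>i\<in>UNIV \<times> J2. Z i \<omega>)"
    using J by (intro indep_var_restrict[OF ind]) auto
  from indep_var_compose[OF this h, where ?Y2.0 = "\<lambda>m. nexp (\<Sum>i\<in>UNIV \<times> J2. case_prod c i * m i)" and ?N2.0 = borel]
  have "indep_var borel (\<lambda>\<omega>. h (\<lambda>i\<in>UNIV \<times> J1. Z i \<omega>)) borel (\<lambda>\<omega>. nexp (\<Sum>i\<in>UNIV \<times> J2. case_prod c i * Z i \<omega>))"
    by (simp add: comp_def cong: sum.cong)
  then have "(\<integral>\<^sup>+ \<omega>. h (\<lambda>i\<in>UNIV \<times> J1. Z i \<omega>) * nexp (\<Sum>i\<in>UNIV \<times> J2. case_prod c i * Z i \<omega>) \<partial>P) =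
      (\<integral>\<^sup>+ \<omega>. h (\<lambda>i\<in>UNIV \<times> J1. Z i \<omega>) \<partial>P) * (\<integral>\<^sup>+ \<omega>. nexp (\<Sum>i\<in>UNIV \<times> J2. case_prod c i * Z i \<omega>) \<partial>P)"
    by (rule indep_var_nn_integral)
  moreover have "(\<integral>\<^sup>+ \<omega>. nexp (\<Sum>i\<in>UNIV \<times> J2. case_prod c i * Z i \<omega>) \<partial>P) =
      nexp (\<Sum>(b, j)\<in>UNIV \<times> J2. emeasure (L b) (C b j) * (1 - nexp (c b j)))"
  proof -
    have "indep_vars (\<lambda>_. borel) Z (UNIV \<times> J2)"
      using ind by (rule indep_vars_subset) auto
    then have *: "indep_vars (\<lambda>_. borel) (\<lambda>i \<omega>. nexp (case_prod c i * Z i \<omega>)) (UNIV \<times> J2)"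
      by (rule indep_vars_compose2) measurable
    have "(\<integral>\<^sup>+ \<omega>. nexp (\<Sum>i\<in>UNIV \<times> J2. case_prod c i * Z i \<omega>) \<partial>P) =
        (\<Prod>i\<in>UNIV \<times> J2. \<integral>\<^sup>+ \<omega>. nexp (case_prod c i * Z i \<omega>) \<partial>P)"
      unfolding nexp_sum using J by (intro indep_vars_nn_integral[OF _ *]) auto
    also have "\<dots> = (\<Prod>(b, j)\<in>UNIV \<times> J2. nexp (emeasure (L b) (C b j) * (1 - nexp (c b j))))"
      using C by (intro prod.cong)
        (auto simp: Z_def intro!: poisson_laplace_transform[OF prob_space_axioms poisson_mark])
    finally show ?thesis by (simp add: nexp_sum split_beta)
  qed
  ultimately show ?thesis by (simp add: Z_def case_prod_unfold)
qed

text \<open>By the ordering, the indices of the points in an open ball form an initial segment.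
  Indices start at 0, hence \<open>Suc j\<close>.\<close>

lemma norm_X_less_iff:
  assumes "\<omega> \<in> space P"
  shows "norm (X j \<omega>) < t \<longleftrightarrow> of_nat (Suc j) \<le> total (\<lambda>x b. indicator {x. norm x < t} x) \<omega>"
proof
  assume *: "norm (X j \<omega>) < t"
  have "of_nat (Suc j) = (\<Sum>i<Suc j. 1 :: ennreal)" by simp
  also have "\<dots> = (\<Sum>i<Suc j. indicator {x. norm x < t} (X i \<omega>))"
    using le_less_trans[OF norm_X_mono[OF assms] *]
    by (intro sum.cong) (auto simp: less_Suc_eq_le)
  also have "\<dots> \<le> total (\<lambda>x b. indicator {x. norm x < t} x) \<omega>"
    unfolding total_def by (intro sum_le_suminf) auto
  finally show "of_nat (Suc j) \<le> total (\<lambda>x b. indicator {x. norm x < t} x) \<omega>" .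
next
  assume *: "of_nat (Suc j) \<le> total (\<lambda>x b. indicator {x. norm x < t} x) \<omega>"
  show "norm (X j \<omega>) < t"
  \<comment> \<open>If \<open>X j\<close> lies outside the ball, then so do all later points, and
    the count is at most \<open>j\<close>.\<close>
  proof (rule ccontr)
    assume "\<not> norm (X j \<omega>) < t"
    then have "\<not> norm (X i \<omega>) < t" if "i \<ge> j" for i
      using norm_X_mono[OF assms that] by simp
    then have "total (\<lambda>x b. indicator {x. norm x < t} x) \<omega> = (\<Sum>i<j. indicator {x. norm x < t} (X i \<omega>))"
      unfolding total_def by (intro suminf_finite) (auto simp: not_less)
    also have "\<dots> \<le> (\<Sum>i<j. 1)" by (intro sum_mono) (simp add: indicator_def)
    finally have "of_nat (Suc j) \<le> (of_nat j :: ennreal)" using * by (simp only: sum_constant card_lessThan mult_1_right order_trans)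
    then show False by (simp only: of_nat_le_iff)
  qed
qed

end

text \<open>Boxes of open lower half-lines are the events that \<open>norm_X_less_iff\<close> can
  express by counts, so they are the generator on which laws of distance vectors are
  compared.\<close>

lemma sets_PiM_borel_lessThan:
  assumes "finite I"
  shows "sets (\<Pi>\<^sub>M i\<in>I. borel :: real measure) =
    sigma_sets (\<Pi>\<^sub>E i\<in>I. UNIV) (range (\<lambda>t. \<Pi>\<^sub>E i\<in>I. {..<t i}))"
proof -
  have "sets (\<Pi>\<^sub>M i\<in>I. borel :: real measure) = sets (\<Pi>\<^sub>M i\<in>I. sigma UNIV (range lessThan) :: real measure)"
    by (simp add: borel_Iio)
  also have "\<dots> = sets (sigma (\<Pi>\<^sub>E i\<in>I. UNIV)
      {{f \<in> (\<Pi>\<^sub>E i\<in>I. UNIV). \<forall>i\<in>j. f i \<in> A i} | A j. j \<in> {I} \<and> A \<in> Pi j (\<lambda>_. range (lessThan :: real \<Rightarrow> _))})"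
  proof (rule sets_PiM_sigma)
    show "\<exists>S\<subseteq>range (lessThan :: real \<Rightarrow> _). countable S \<and> UNIV = \<Union>S"
      using reals_Archimedean2 by (intro exI[of _ "range (\<lambda>n. {..<real n})"]) auto
  qed (use assms in auto)
  also have "{{f \<in> (\<Pi>\<^sub>E i\<in>I. UNIV). \<forall>i\<in>j. f i \<in> A i} | A j. j \<in> {I} \<and> A \<in> Pi j (\<lambda>_. range (lessThan :: real \<Rightarrow> _))} =
      range (\<lambda>t. \<Pi>\<^sub>E i\<in>I. {..<t i})"
  proof safe
    fix A :: "'a \<Rightarrow> real set" assume "A \<in> Pi I (\<lambda>_. range lessThan)"
    then have "\<forall>i\<in>I. \<exists>t. A i = {..<t}" by auto
    then obtain t where "\<And>i. i \<in> I \<Longrightarrow> A i = {..<t i}" by metis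
    then have "{f \<in> (\<Pi>\<^sub>E i\<in>I. UNIV). \<forall>i\<in>I. f i \<in> A i} = (\<Pi>\<^sub>E i\<in>I. {..<t i})"
      by (auto simp: PiE_iff extensional_def)
    then show "{f \<in> (\<Pi>\<^sub>E i\<in>I. UNIV). \<forall>i\<in>I. f i \<in> A i} \<in> range (\<lambda>t. \<Pi>\<^sub>E i\<in>I. {..<t i})"
      by blast
  next
    fix t :: "'a \<Rightarrow> real"
    show "\<exists>A j. (\<Pi>\<^sub>E i\<in>I. {..<t i}) = {f \<in> (\<Pi>\<^sub>E i\<in>I. UNIV). \<forall>i\<in>j. f i \<in> A i} \<and> j \<in> {I} \<and> A \<in> Pi j (\<lambda>_. range lessThan)"
      by (intro exI[of _ "\<lambda>i. {..<t i}"] exI[of _ I]) (auto simp: PiE_iff extensional_def)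
  qed
  finally show ?thesis by (simp add: sets_measure_of_conv) blast
qed

section \<open>Factorisation across a fixed sphere\<close>

context marked_poisson begin

lemma tendsto_total:
  assumes inc: "\<And>x b. incseq (\<lambda>n. F n x b)"
    and lim: "\<And>x b. (\<lambda>n. F n x b) \<longlonglongrightarrow> \<phi> x b"
  shows "(\<lambda>n. total (F n) \<omega>) \<longlonglongrightarrow> total \<phi> \<omega>"
  unfolding total_eq_nn_integral
  using inc lim by (intro nn_integral_LIMSEQ) (auto simp: incseq_def le_fun_def)

text \<open>\<open>1 - nexp\<close> is increasing, so monotone convergence applies whether or not
  the limit is finite.\<close>

lemma tendsto_laplace_exponent:
  assumes inc: "\<And>x b. incseq (\<lambda>n. F n x b)"
    and lim: "\<And>x b. (\<lambda>n. F n x b) \<longlonglongrightarrow> \<phi> x b"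
    and [measurable]: "\<And>n b. (\<lambda>x. F n x b) \<in> borel_measurable borel"
  shows "(\<lambda>n. laplace_exponent (F n)) \<longlonglongrightarrow> laplace_exponent \<phi>"
  unfolding laplace_exponent_def
proof (intro tendsto_sum nn_integral_LIMSEQ)
  show "incseq (\<lambda>n x. 1 - nexp (F n x b))" for b
    using inc by (auto simp: incseq_def le_fun_def intro!: ennreal_minus_mono nexp_antimono)
  show "(\<lambda>n. 1 - nexp (F n x b)) \<longlonglongrightarrow> 1 - nexp (\<phi> x b)" for x b
    by (intro tendsto_diff_ennreal tendsto_const tendsto_nexp lim) auto
qed measurable

lemma tendsto_nn_integral_nexp:
  assumes [measurable]: "S \<in> sets P" "\<And>n. f n \<in> borel_measurable P" "g \<in> borel_measurable P"
    and lim: "\<And>\<omega>. \<omega> \<in> space P \<Longrightarrow> (\<lambda>n. f n \<omega>) \<longlonglongrightarrow> g \<omega>"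
  shows "(\<lambda>n. \<integral>\<^sup>+ \<omega>. indicator S \<omega> * nexp (f n \<omega>) \<partial>P) \<longlonglongrightarrow> (\<integral>\<^sup>+ \<omega>. indicator S \<omega> * nexp (g \<omega>) \<partial>P)"
proof (rule nn_integral_dominated_convergence[where w = "\<lambda>_. 1"])
  show "AE \<omega> in P. (\<lambda>n. indicator S \<omega> * nexp (f n \<omega>)) \<longlonglongrightarrow> indicator S \<omega> * nexp (g \<omega>)"
    using lim by (intro AE_I2 ennreal_tendsto_cmult tendsto_nexp) (auto simp: indicator_def)
qed (auto simp: emeasure_space_1 indicator_def)

text \<open>Both sides are expressed through the counts of finitely many disjoint cells: \<open>Inl S\<close> indexes the
  points inside the ball of radius \<open>d\<close> that satisfy exactly the bounds \<open>t j\<close> with \<open>j \<in> S\<close>, and \<open>Inr v\<close>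
  the points outside it at which \<open>f b\<close> takes the value \<open>v\<close>.\<close>

lemma factor_box_simple:
  assumes f: "\<And>b. simple_function borel (f b)"
    and zero: "\<And>b x. norm x < d \<Longrightarrow> f b x = 0"
    and t: "\<And>j. j < K \<Longrightarrow> t j \<le> d"
  defines "E \<equiv> {\<omega> \<in> space P. \<forall>j<K. norm (X j \<omega>) < t j}"
  shows "(\<integral>\<^sup>+ \<omega>. indicator E \<omega> * nexp (total (\<lambda>x b. f b x) \<omega>) \<partial>P) =
    (\<integral>\<^sup>+ \<omega>. indicator E \<omega> \<partial>P) * nexp (laplace_exponent (\<lambda>x b. f b x))"
proof -
  have f_meas [measurable]: "f b \<in> borel_measurable borel" for b
    using f by (rule borel_measurable_simple_function)
  define V where "V = range (f True) \<union> range (f False)"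
  have V: "finite V" "f b x \<in> V" for b x
    using f[THEN simple_functionD(1)] by (auto simp: V_def) (cases b; simp)
  define J1 where "J1 = (Inl ` Pow {..<K} :: (nat set + ennreal) set)"
  define J2 where "J2 = (Inr ` V :: (nat set + ennreal) set)"
  define C where "C b = case_sum
    (\<lambda>S. {x. norm x < d \<and> {j. j < K \<and> norm x < t j} = S})
    (\<lambda>v. {x. d \<le> norm x \<and> f b x = v})" for b
  define c :: "bool \<Rightarrow> nat set + ennreal \<Rightarrow> ennreal" where "c b = case_sum (\<lambda>_. 0) id" for b
  \<comment> \<open>Since \<open>t j \<le> d\<close>, the cells whose label contains
    \<open>j\<close> partition the ball of radius \<open>t j\<close>; the sum of their counts
    decides whether \<open>norm (X j \<omega>) < t j\<close>.\<close>
  define I where "I j = (UNIV :: bool set) \<times> (Inl ` {S \<in> Pow {..<K}. j \<in> S} :: (nat set + ennreal) set)" for j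
  define h :: "(bool \<times> (nat set + ennreal) \<Rightarrow> ennreal) \<Rightarrow> ennreal" where
    "h m = (if \<forall>j<K. of_nat (Suc j) \<le> (\<Sum>i\<in>I j. m i) then 1 else 0)" for m
  have C_sets: "C b j \<in> sets borel" for b j
    unfolding C_def set_eq_iff by (cases j) simp_all
  have sum_C2: "(\<Sum>j\<in>J2. g (c b j) * indicator (C b j) x) = (if d \<le> norm x then g (f b x) else 0)" for g :: "ennreal \<Rightarrow> ennreal" and b x
  proof -
    have "(\<Sum>j\<in>J2. g (c b j) * indicator (C b j) x) = (\<Sum>v\<in>V. if v = f b x then (if d \<le> norm x then g (f b x) else 0) else 0)"
      unfolding J2_def by (subst sum.reindex) (auto simp: c_def C_def indicator_def intro!: sum.cong)
    then show ?thesis using V by (simp add: sum.delta)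
  qed
  \<comment> \<open>The outer cells alone recover the total because \<open>f\<close> vanishes inside
    the ball.\<close>
  have total_f: "(\<Sum>(b, j)\<in>UNIV \<times> J2. c b j * cnt b (C b j) \<omega>) = total (\<lambda>x b. f b x) \<omega>" for \<omega>
  proof -
    have "(\<lambda>x b. \<Sum>j\<in>J2. c b j * indicator (C b j) x) = (\<lambda>x b. f b x)"
      using sum_C2[of "\<lambda>v. v"] zero by (auto simp: fun_eq_iff not_le)
    with sum_cnt_eq_total[of J2 c C \<omega>] V show ?thesis by (simp add: J2_def)
  qed
  have h_eq: "h (\<lambda>(b, j)\<in>UNIV \<times> J1. cnt b (C b j) \<omega>) = indicator E \<omega>" if \<omega>: "\<omega> \<in> space P" for \<omega>
  proof -
    have "(\<Sum>i\<in>I j. (\<lambda>(b, j)\<in>UNIV \<times> J1. cnt b (C b j) \<omega>) i) =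
        total (\<lambda>x b. indicator {x. norm x < t j} x) \<omega>" if j: "j < K" for j
    proof -
      have "(\<Sum>i\<in>I j. (\<lambda>(b, j)\<in>UNIV \<times> J1. cnt b (C b j) \<omega>) i) =
          (\<Sum>(b, j)\<in>I j. 1 * cnt b (C b j) \<omega>)"
        by (intro sum.cong) (auto simp: I_def J1_def)
      also have "\<dots> = total (\<lambda>x b. \<Sum>j\<in>Inl ` {S \<in> Pow {..<K}. j \<in> S}. 1 * indicator (C b j) x) \<omega>"
        unfolding I_def by (subst sum_cnt_eq_total) auto
      also have "(\<lambda>x b. \<Sum>j\<in>Inl ` {S \<in> Pow {..<K}. j \<in> S}. 1 * indicator (C b j) x) =
          (\<lambda>x b. indicator {x. norm x < t j} x :: ennreal)"
      proof (intro ext)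
        fix x :: 'a and b
        have "(\<Sum>j\<in>Inl ` {S \<in> Pow {..<K}. j \<in> S}. 1 * indicator (C b j) x :: ennreal) =
          (\<Sum>S\<in>{S \<in> Pow {..<K}. j \<in> S}. if S = {j. j < K \<and> norm x < t j} then (if norm x < d then 1 else 0) else 0)"
          by (subst sum.reindex) (auto simp: C_def indicator_def intro!: sum.cong)
        also have "\<dots> = indicator {x. norm x < t j} x"
          using j t[OF j] by (subst sum.delta) (auto simp: indicator_def)
        finally show "(\<Sum>j\<in>Inl ` {S \<in> Pow {..<K}. j \<in> S}. 1 * indicator (C b j) x :: ennreal) =
          indicator {x. norm x < t j} x" .
      qed
      finally show ?thesis .
    qed
    then show ?thesis
      using \<omega> by (auto simp: h_def E_def norm_X_less_iff[OF \<omega>] indicator_def)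
  qed
  have exponent: "(\<Sum>(b, j)\<in>UNIV \<times> J2. emeasure (L b) (C b j) * (1 - nexp (c b j))) =
      laplace_exponent (\<lambda>x b. f b x)"
  proof -
    have "(\<Sum>(b, j)\<in>UNIV \<times> J2. emeasure (L b) (C b j) * (1 - nexp (c b j))) =
        (\<Sum>b\<in>UNIV. \<Sum>j\<in>J2. \<integral>\<^sup>+ x. (1 - nexp (c b j)) * indicator (C b j) x \<partial>L b)"
      unfolding sum.cartesian_product[symmetric] using C_sets
      by (intro sum.cong) (simp_all add: nn_integral_cmult_indicator mult.commute[of "emeasure _ _"])
    also have "\<dots> = (\<Sum>b\<in>UNIV. \<integral>\<^sup>+ x. (\<Sum>j\<in>J2. (1 - nexp (c b j)) * indicator (C b j) x) \<partial>L b)"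
      using C_sets by (intro sum.cong refl nn_integral_sum[symmetric]) auto
    also have "\<dots> = laplace_exponent (\<lambda>x b. f b x)"
      unfolding laplace_exponent_def using zero
      by (intro sum.cong refl nn_integral_cong) (auto simp: sum_C2[of "\<lambda>v. 1 - nexp v"])
    finally show ?thesis .
  qed
  have "(\<integral>\<^sup>+ \<omega>. h (\<lambda>(b, j)\<in>UNIV \<times> J1. cnt b (C b j) \<omega>) *
        nexp (\<Sum>(b, j)\<in>UNIV \<times> J2. c b j * cnt b (C b j) \<omega>) \<partial>P) =
      (\<integral>\<^sup>+ \<omega>. h (\<lambda>(b, j)\<in>UNIV \<times> J1. cnt b (C b j) \<omega>) \<partial>P) *
      nexp (\<Sum>(b, j)\<in>UNIV \<times> J2. emeasure (L b) (C b j) * (1 - nexp (c b j)))"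
  proof (rule nn_integral_cnt_factor)
    show "disjoint_family_on (C b) (J1 \<union> J2)" for b
      by (auto simp: disjoint_family_on_def C_def J1_def J2_def)
    have [measurable]: "(\<lambda>m. m i) \<in> borel_measurable (\<Pi>\<^sub>M i\<in>UNIV \<times> J1. borel :: ennreal measure)" if "i \<in> I j" for i j
      using that by (intro measurable_component_singleton) (auto simp: I_def J1_def)
    show "h \<in> borel_measurable (\<Pi>\<^sub>M i\<in>UNIV \<times> J1. borel)"
      unfolding h_def by measurable
  qed (use V C_sets in \<open>auto simp: J1_def J2_def\<close>)
  then show ?thesis
    by (simp add: total_f exponent h_eq cong: nn_integral_cong)
qed

text \<open>Increasing simple approximations of \<phi> lie below it and therefore vanish inside the
  ball as well. The left side converges by domination, the exponent on the right by monotone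
  convergence.\<close>

lemma factor_box:
  assumes [measurable]: "\<And>b. (\<lambda>x. \<phi> x b) \<in> borel_measurable borel"
    and zero: "\<And>b x. norm x < d \<Longrightarrow> \<phi> x b = 0"
    and t: "\<And>j. j < K \<Longrightarrow> t j \<le> d"
  defines "E \<equiv> {\<omega> \<in> space P. \<forall>j<K. norm (X j \<omega>) < t j}"
  shows "(\<integral>\<^sup>+ \<omega>. indicator E \<omega> * nexp (total \<phi> \<omega>) \<partial>P) =
    (\<integral>\<^sup>+ \<omega>. indicator E \<omega> \<partial>P) * nexp (laplace_exponent \<phi>)"
proof -
  have [measurable]: "E \<in> sets P" unfolding E_def by measurable
  have "\<exists>F. (\<forall>n. simple_function borel (F n)) \<and> incseq F \<and> (\<forall>x. (SUP n. F n x) = \<phi> x b)" for b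
    by (rule borel_measurable_implies_simple_function_sequence'[of "\<lambda>x. \<phi> x b" borel]) auto
  then obtain F where F: "\<And>b n. simple_function borel (F b n)" "\<And>b. incseq (F b)"
      "\<And>b x. (SUP n. F b n x) = \<phi> x b"
    by metis
  have F_meas [measurable]: "F b n \<in> borel_measurable borel" for b n
    using F(1) by (rule borel_measurable_simple_function)
  have inc: "incseq (\<lambda>n. F b n x)" for b x
    using F(2)[of b] by (auto simp: incseq_def le_fun_def)
  have lim: "(\<lambda>n. F b n x) \<longlonglongrightarrow> \<phi> x b" for b x
    using LIMSEQ_SUP[OF inc] F(3) by metis
  have le: "F b n x \<le> \<phi> x b" for b n x
    using SUP_upper[of n UNIV "\<lambda>n. F b n x"] F(3) by simp
  have eq: "(\<integral>\<^sup>+ \<omega>. indicator E \<omega> * nexp (total (\<lambda>x b. F b n x) \<omega>) \<partial>P) =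
      (\<integral>\<^sup>+ \<omega>. indicator E \<omega> \<partial>P) * nexp (laplace_exponent (\<lambda>x b. F b n x))" for n
    unfolding E_def
  proof (rule factor_box_simple[where d = d])
    show "F b n x = 0" if "norm x < d" for b x
      using le[of b n x] zero[OF that] by simp
  qed (use F t in auto)
  have "(\<lambda>n. \<integral>\<^sup>+ \<omega>. indicator E \<omega> * nexp (total (\<lambda>x b. F b n x) \<omega>) \<partial>P) \<longlonglongrightarrow>
      (\<integral>\<^sup>+ \<omega>. indicator E \<omega> * nexp (total \<phi> \<omega>) \<partial>P)"
    by (intro tendsto_nn_integral_nexp tendsto_total inc lim) measurable
  moreover have "(\<lambda>n. (\<integral>\<^sup>+ \<omega>. indicator E \<omega> \<partial>P) * nexp (laplace_exponent (\<lambda>x b. F b n x))) \<longlonglongrightarrow>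
      (\<integral>\<^sup>+ \<omega>. indicator E \<omega> \<partial>P) * nexp (laplace_exponent \<phi>)"
    by (intro ennreal_tendsto_cmult tendsto_nexp tendsto_laplace_exponent inc lim) (simp_all add: less_top[symmetric])
  ultimately show ?thesis
    unfolding eq using LIMSEQ_unique by blast
qed

text \<open>The choice \<open>K = 0\<close> gives the Laplace functional of the marked process.\<close>

lemma laplace_functional:
  assumes "\<And>b. (\<lambda>x. \<phi> x b) \<in> borel_measurable borel"
  shows "(\<integral>\<^sup>+ \<omega>. nexp (total \<phi> \<omega>) \<partial>P) = nexp (laplace_exponent \<phi>)"
proof -
  have "(\<integral>\<^sup>+ \<omega>. indicator {\<omega> \<in> space P. \<forall>j<0. norm (X j \<omega>) < 0} \<omega> * nexp (total \<phi> \<omega>) \<partial>P) =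
      (\<integral>\<^sup>+ \<omega>. indicator {\<omega> \<in> space P. \<forall>j<0. norm (X j \<omega>) < 0} \<omega> \<partial>P) * nexp (laplace_exponent \<phi>)"
    using assms by (intro factor_box[where d = 0]) auto
  then show ?thesis by (simp add: emeasure_space_1 cong: nn_integral_cong)
qed

text \<open>The value 0 for \<open>K = 0\<close> makes the first distance the successor of a
  fictitious distance 0, so the induction on the number of distances can start from the empty
  vector.\<close>

definition last_norm :: "nat \<Rightarrow> 'w \<Rightarrow> real" where
  "last_norm K \<omega> = (if K = 0 then 0 else norm (X (K - 1) \<omega>))"

lemma last_norm_measurable [measurable]: "last_norm K \<in> borel_measurable P"
  unfolding last_norm_def by measurable

lemma last_norm_nonneg: "0 \<le> last_norm K \<omega>"
  by (simp add: last_norm_def)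

text \<open>Both sides, as functions of \<open>A\<close>, are finite measures: the law of the
  distance vector on the event \<open>last_norm K \<omega> < d\<close>, weighted once by the random
  total and once by the constant exponent. They agree on lower boxes by
  \<open>factor_box\<close>.\<close>

lemma factor_dists:
  assumes [measurable]: "\<And>b. (\<lambda>x. \<phi> x b) \<in> borel_measurable borel"
    and zero: "\<And>b x. norm x < d \<Longrightarrow> \<phi> x b = 0" and d: "0 < d"
    and A [measurable]: "A \<in> sets (\<Pi>\<^sub>M k\<in>{..<K}. borel)"
  defines "E \<equiv> {\<omega> \<in> space P. dists K \<omega> \<in> A \<and> last_norm K \<omega> < d}"
  shows "(\<integral>\<^sup>+ \<omega>. indicator E \<omega> * nexp (total \<phi> \<omega>) \<partial>P) =
    (\<integral>\<^sup>+ \<omega>. indicator E \<omega> \<partial>P) * nexp (laplace_exponent \<phi>)"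
proof -
  let ?R = "\<Pi>\<^sub>M k\<in>{..<K}. borel :: real measure"
  define D where "D = {\<omega> \<in> space P. last_norm K \<omega> < d}"
  have [measurable]: "D \<in> sets P" unfolding D_def by measurable
  define \<mu> where "\<mu> f = distr (density P (\<lambda>\<omega>. indicator D \<omega> * nexp (f \<omega>))) ?R (dists K)" for f
  have \<mu>: "emeasure (\<mu> f) B = (\<integral>\<^sup>+ \<omega>. indicator {\<omega> \<in> space P. dists K \<omega> \<in> B \<and> last_norm K \<omega> < d} \<omega> * nexp (f \<omega>) \<partial>P)"
    if [measurable]: "f \<in> borel_measurable P" "B \<in> sets ?R" for f B
  proof -
    have "emeasure (\<mu> f) B = (\<integral>\<^sup>+ \<omega>. indicator D \<omega> * nexp (f \<omega>) * indicator (dists K -` B \<inter> space P) \<omega> \<partial>P)"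
      unfolding \<mu>_def by (subst emeasure_distr, simp, simp, subst emeasure_density) auto
    also have "\<dots> = (\<integral>\<^sup>+ \<omega>. indicator {\<omega> \<in> space P. dists K \<omega> \<in> B \<and> last_norm K \<omega> < d} \<omega> * nexp (f \<omega>) \<partial>P)"
      by (intro nn_integral_cong) (auto simp: D_def indicator_def)
    finally show ?thesis .
  qed
  have "\<mu> (total \<phi>) = \<mu> (\<lambda>_. laplace_exponent \<phi>)"
  proof (rule measure_eqI_generator_eq)
    let ?G = "range (\<lambda>t. \<Pi>\<^sub>E i\<in>{..<K}. {..<t i :: real})"
    have box_sets: "(\<Pi>\<^sub>E i\<in>{..<K}. {..<t i}) \<in> sets ?R" for t :: "nat \<Rightarrow> real"
      by (intro sets_PiM_I_finite) auto
    show "Int_stable ?G"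
    proof (rule Int_stableI)
      fix a b assume "a \<in> ?G" "b \<in> ?G"
      then obtain s t where "a = (\<Pi>\<^sub>E i\<in>{..<K}. {..<s i})" "b = (\<Pi>\<^sub>E i\<in>{..<K}. {..<t i})" by auto
      moreover have "{..<x} \<inter> {..<y} = {..<min x y}" for x y :: real by auto
      ultimately have "a \<inter> b = (\<Pi>\<^sub>E i\<in>{..<K}. {..<min (s i) (t i)})" by (simp add: PiE_Int)
      then show "a \<inter> b \<in> ?G" by (rule range_eqI[where x = "\<lambda>i. min (s i) (t i)"])
    qed
    show "sets (\<mu> (total \<phi>)) = sigma_sets (\<Pi>\<^sub>E i\<in>{..<K}. UNIV) ?G"
      "sets (\<mu> (\<lambda>_. laplace_exponent \<phi>)) = sigma_sets (\<Pi>\<^sub>E i\<in>{..<K}. UNIV) ?G"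
      by (simp_all add: \<mu>_def sets_PiM_borel_lessThan)
    show "emeasure (\<mu> (total \<phi>)) B = emeasure (\<mu> (\<lambda>_. laplace_exponent \<phi>)) B" if "B \<in> ?G" for B
    proof -
      from that obtain t where B: "B = (\<Pi>\<^sub>E i\<in>{..<K}. {..<t i})" by auto
      \<comment> \<open>The last norm dominates the earlier ones, so bounding it by \<open>d\<close>
        truncates every side of the box to \<open>min (t j) d\<close>, as \<open>factor_box\<close>
        requires. For \<open>K = 0\<close> positivity of \<open>d\<close> makes the bound
        hold.\<close>
      have E: "{\<omega> \<in> space P. dists K \<omega> \<in> B \<and> last_norm K \<omega> < d} =
          {\<omega> \<in> space P. \<forall>j<K. norm (X j \<omega>) < min (t j) d}"
      proof (cases "K = 0")
        case False
        have "norm (X j \<omega>) < d" if "\<omega> \<in> space P" "norm (X (K - 1) \<omega>) < d" "j < K" for \<omega> j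
          using le_less_trans[OF norm_X_mono[of \<omega> j "K - 1"]] that by simp
        with False show ?thesis
          by (auto simp: B dists_def last_norm_def)
      qed (use d in \<open>auto simp: B dists_def last_norm_def\<close>)
      have "(\<integral>\<^sup>+ \<omega>. indicator {\<omega> \<in> space P. \<forall>j<K. norm (X j \<omega>) < min (t j) d} \<omega> * nexp (total \<phi> \<omega>) \<partial>P) =
        (\<integral>\<^sup>+ \<omega>. indicator {\<omega> \<in> space P. \<forall>j<K. norm (X j \<omega>) < min (t j) d} \<omega> \<partial>P) * nexp (laplace_exponent \<phi>)"
        using zero by (intro factor_box[where d = d]) auto
      moreover have "B \<in> sets ?R" unfolding B by (rule box_sets)
      ultimately show ?thesis
        by (simp add: \<mu> E nn_integral_multc)
    qed
    show "range (\<lambda>n. \<Pi>\<^sub>E i\<in>{..<K}. {..<real n}) \<subseteq> ?G" by auto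
    show "(\<Union>n. \<Pi>\<^sub>E i\<in>{..<K}. {..<real n}) = (\<Pi>\<^sub>E i\<in>{..<K}. UNIV)"
    proof (intro equalityI subsetI)
      fix r :: "nat \<Rightarrow> real" assume r: "r \<in> (\<Pi>\<^sub>E i\<in>{..<K}. UNIV)"
      obtain n where n: "real n > Max (insert 0 (r ` {..<K}))" using reals_Archimedean2 by blast
      then have "r i < real n" if "i < K" for i using that by (simp add: Max_less_iff)
      with r show "r \<in> (\<Union>n. \<Pi>\<^sub>E i\<in>{..<K}. {..<real n})" by (auto simp: PiE_iff)
    qed (auto simp: PiE_iff)
    show "emeasure (\<mu> (total \<phi>)) (\<Pi>\<^sub>E i\<in>{..<K}. {..<real n}) \<noteq> \<infinity>" for n
    proof -
      have "emeasure (\<mu> (total \<phi>)) (\<Pi>\<^sub>E i\<in>{..<K}. {..<real n}) \<le> (\<integral>\<^sup>+ \<omega>. 1 \<partial>P)"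
        unfolding \<mu>[OF total_measurable[OF assms(1)] box_sets]
        by (rule nn_integral_mono) (simp add: indicator_def)
      then show ?thesis by (auto simp: emeasure_space_1 top_unique)
    qed
  qed (auto simp: PiE_iff)
  then have "emeasure (\<mu> (total \<phi>)) A = emeasure (\<mu> (\<lambda>_. laplace_exponent \<phi>)) A" by simp
  then show ?thesis
    by (simp add: \<mu> E_def nn_integral_multc)
qed

end

section \<open>Spatial Markov property\<close>

text \<open>The strict inequality removes the points at distance exactly \<open>d\<close>, in
  particular the last serving point when \<open>d\<close> is its norm.\<close>

definition cutoff :: "real \<Rightarrow> ('a::real_normed_vector \<Rightarrow> bool \<Rightarrow> ennreal) \<Rightarrow> 'a \<Rightarrow> bool \<Rightarrow> ennreal" where
  "cutoff d \<phi> x b = (if d < norm x then \<phi> x b else 0)"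

definition final :: "nat \<Rightarrow> (nat \<Rightarrow> real) \<Rightarrow> real" where
  "final K r = (if K = 0 then 0 else r (K - 1))"

text \<open>Floor plus one rather than ceiling makes the approximation strictly larger than
  \<open>x\<close>; \<open>factor_dists\<close> demands that the last norm be strictly below the
  radius.\<close>

definition dyadic_above :: "nat \<Rightarrow> real \<Rightarrow> real" where
  "dyadic_above n x = (real_of_int \<lfloor>2 ^ n * x\<rfloor> + 1) / 2 ^ n"

lemma measurable_dyadic_above [measurable]: "dyadic_above n \<in> borel_measurable borel"
  unfolding dyadic_above_def by measurable

lemma dyadic_above_greater: "x < dyadic_above n x"
  unfolding dyadic_above_def by (simp add: pos_less_divide_eq mult.commute)

lemma dyadic_above_le: "dyadic_above n x \<le> x + (1 / 2) ^ n"
proof -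
  have "dyadic_above n x \<le> (2 ^ n * x + 1) / 2 ^ n"
    unfolding dyadic_above_def by (intro divide_right_mono) auto
  then show ?thesis by (simp add: field_simps power_one_over)
qed

lemma decseq_dyadic_above: "decseq (\<lambda>n. dyadic_above n x)"
proof (rule decseq_SucI)
  fix n
  \<comment> \<open>The integer on the right exceeds \<open>2 ^ Suc n * x\<close> strictly, hence is
    at least the floor of that number plus one.\<close>
  have "2 * (2 ^ n * x) < real_of_int (2 * (\<lfloor>2 ^ n * x\<rfloor> + 1))"
    unfolding of_int_mult of_int_add of_int_numeral of_int_1
    by (intro mult_strict_left_mono real_of_int_floor_add_one_gt) simp
  then have "\<lfloor>2 * (2 ^ n * x)\<rfloor> + 1 \<le> 2 * (\<lfloor>2 ^ n * x\<rfloor> + 1)"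
    by (simp only: floor_less_iff[symmetric] zless_imp_add1_zle)
  then have "real_of_int (\<lfloor>2 * (2 ^ n * x)\<rfloor> + 1) \<le> real_of_int (2 * (\<lfloor>2 ^ n * x\<rfloor> + 1))"
    by (simp only: of_int_le_iff)
  then have "real_of_int (\<lfloor>2 * (2 ^ n * x)\<rfloor> + 1) / (2 * 2 ^ n) \<le>
      real_of_int (2 * (\<lfloor>2 ^ n * x\<rfloor> + 1)) / (2 * 2 ^ n)"
    by (rule divide_right_mono) simp
  also have "\<dots> = real_of_int (\<lfloor>2 ^ n * x\<rfloor> + 1) / 2 ^ n"
    unfolding of_int_mult of_int_numeral by (rule mult_divide_mult_cancel_left) simp
  finally show "dyadic_above (Suc n) x \<le> dyadic_above n x"
    by (simp add: dyadic_above_def mult.assoc)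
qed

lemma tendsto_dyadic_above: "(\<lambda>n. dyadic_above n x) \<longlonglongrightarrow> x"
proof (rule tendsto_sandwich[where f = "\<lambda>_. x" and h = "\<lambda>n. x + (1 / 2) ^ n"])
  show "(\<lambda>n. x + (1 / 2) ^ n) \<longlonglongrightarrow> x"
    using tendsto_add[OF tendsto_const LIMSEQ_power_zero[of "1 / 2 :: real"], of x] by simp
qed (auto intro!: always_eventually dyadic_above_le less_imp_le[OF dyadic_above_greater])

lemma dyadic_above_eq_iff:
  assumes "0 \<le> x"
  shows "dyadic_above n x = (real k + 1) / 2 ^ n \<longleftrightarrow> real k / 2 ^ n \<le> x \<and> x < (real k + 1) / 2 ^ n"
proof -
  have "dyadic_above n x = (real k + 1) / 2 ^ n \<longleftrightarrow> \<lfloor>2 ^ n * x\<rfloor> = int k"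
    using of_int_eq_iff[of "\<lfloor>2 ^ n * x\<rfloor>" "int k", where ?'a = real] by (simp add: dyadic_above_def)
  also have "\<dots> \<longleftrightarrow> real k / 2 ^ n \<le> x \<and> x < (real k + 1) / 2 ^ n"
    by (auto simp: floor_eq_iff field_simps)
  finally show ?thesis .
qed

lemma dyadic_above_cases:
  assumes "0 \<le> x"
  obtains k :: nat where "dyadic_above n x = (real k + 1) / 2 ^ n"
proof -
  have "0 \<le> \<lfloor>2 ^ n * x\<rfloor>" using assms by simp
  then obtain k where "\<lfloor>2 ^ n * x\<rfloor> = int k" by (metis nonneg_int_cases)
  then show ?thesis using that[of k] by (simp add: dyadic_above_def)
qed

text \<open>Outside \<open>I\<close> the coordinate is constantly \<open>undefined\<close> on the
  product space. Covering all indices suits \<open>ordered_domain\<close>, whose quantifiers range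
  over all naturals.\<close>

lemma measurable_PiM_component:
  "(\<lambda>r. r k) \<in> borel_measurable (\<Pi>\<^sub>M k\<in>I. borel :: real measure)"
proof (cases "k \<in> I")
  case False
  then have "(\<lambda>r. r k) \<in> borel_measurable (\<Pi>\<^sub>M k\<in>I. borel :: real measure) \<longleftrightarrow>
      (\<lambda>r. undefined :: real) \<in> borel_measurable (\<Pi>\<^sub>M k\<in>I. borel :: real measure)"
    by (intro measurable_cong) (auto simp: space_PiM PiE_iff extensional_def)
  then show ?thesis by simp
qed (rule measurable_component_singleton)

lemma measurable_final [measurable]: "final K \<in> borel_measurable (\<Pi>\<^sub>M k\<in>I. borel)"
  unfolding final_def by (cases "K = 0") (simp_all add: measurable_PiM_component)

context marked_poisson begin

lemma last_norm_eq_final: "last_norm K \<omega> = final K (dists K \<omega>)"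
  by (simp add: last_norm_def final_def dists_def)

lemma cutoff_measurable [measurable]:
  assumes [measurable]: "(\<lambda>x. \<phi> x b) \<in> borel_measurable borel"
  shows "(\<lambda>x. cutoff d \<phi> x b) \<in> borel_measurable borel"
  unfolding cutoff_def by measurable

lemma total_cutoff_measurable [measurable]:
  assumes [measurable]: "\<And>b. (\<lambda>x. \<phi> x b) \<in> borel_measurable borel" "d \<in> borel_measurable P"
  shows "(\<lambda>\<omega>. total (cutoff (d \<omega>) \<phi>) \<omega>) \<in> borel_measurable P"
proof -
  have "(\<lambda>\<omega>. cutoff (d \<omega>) \<phi> (X i \<omega>) (los i \<omega>)) =
      (\<lambda>\<omega>. if d \<omega> < norm (X i \<omega>) then if los i \<omega> then \<phi> (X i \<omega>) True else \<phi> (X i \<omega>) False else 0)" for i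
    by (auto simp: cutoff_def)
  then have "(\<lambda>\<omega>. cutoff (d \<omega>) \<phi> (X i \<omega>) (los i \<omega>)) \<in> borel_measurable P" for i
    by simp
  then show ?thesis unfolding total_def by (rule borel_measurable_suminf_order)
qed

lemma laplace_exponent_cutoff_measurable [measurable]:
  assumes [measurable]: "\<And>b. (\<lambda>x. \<phi> x b) \<in> borel_measurable borel"
  shows "(\<lambda>d. laplace_exponent (cutoff d \<phi>)) \<in> borel_measurable borel"
  unfolding laplace_exponent_def cutoff_def
  by (intro borel_measurable_sum sigma_finite_measure.borel_measurable_nn_integral[OF sigma_finite_L]) measurable

text \<open>As the radii decrease to \<open>a\<close>, the regions beyond them increase to the
  region beyond \<open>a\<close>, and each point is eventually classified correctly.\<close>

lemma
  assumes "decseq d" "d \<longlonglongrightarrow> a" "\<And>n. a < d n"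
  shows incseq_cutoff: "incseq (\<lambda>n. cutoff (d n) \<phi> x b)"
    and tendsto_cutoff: "(\<lambda>n. cutoff (d n) \<phi> x b) \<longlonglongrightarrow> cutoff a \<phi> x b"
proof -
  show "incseq (\<lambda>n. cutoff (d n) \<phi> x b)"
    using assms(1) by (auto simp: cutoff_def incseq_def decseq_def intro: le_less_trans)
  show "(\<lambda>n. cutoff (d n) \<phi> x b) \<longlonglongrightarrow> cutoff a \<phi> x b"
  proof (rule tendsto_eventually, cases "a < norm x")
    case True
    then have "eventually (\<lambda>n. d n < norm x) sequentially"
      using assms(2) by (simp add: order_tendstoD)
    then show "eventually (\<lambda>n. cutoff (d n) \<phi> x b = cutoff a \<phi> x b) sequentially"
      by eventually_elim (use True in \<open>simp add: cutoff_def\<close>)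
  next
    case False
    then have "\<not> d n < norm x" for n using assms(3)[of n] by linarith
    with False show "eventually (\<lambda>n. cutoff (d n) \<phi> x b = cutoff a \<phi> x b) sequentially"
      by (simp add: cutoff_def)
  qed
qed

text \<open>Spatial Markov property at the random radius \<open>last_norm K\<close>: it is approximated from above by
  dyadic radii, which take countably many values, so that independence of the point
  configurations inside and outside a fixed ball applies on each level set.\<close>

lemma spatial_markov:
  assumes [measurable]: "\<And>b. (\<lambda>x. \<phi> x b) \<in> borel_measurable borel"
    and A [measurable]: "A \<in> sets (\<Pi>\<^sub>M k\<in>{..<K}. borel)"
  defines "E \<equiv> {\<omega> \<in> space P. dists K \<omega> \<in> A}"
  shows "(\<integral>\<^sup>+ \<omega>. indicator E \<omega> * nexp (total (cutoff (last_norm K \<omega>) \<phi>) \<omega>) \<partial>P) =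
    (\<integral>\<^sup>+ \<omega>. indicator E \<omega> * nexp (laplace_exponent (cutoff (last_norm K \<omega>) \<phi>)) \<partial>P)"
proof -
  have E [measurable]: "E \<in> sets P" unfolding E_def by measurable
  define D where "D n \<omega> = dyadic_above n (last_norm K \<omega>)" for n \<omega>
  have [measurable]: "D n \<in> borel_measurable P" for n
    unfolding D_def by measurable
  have eq: "(\<integral>\<^sup>+ \<omega>. indicator E \<omega> * nexp (total (cutoff (D n \<omega>) \<phi>) \<omega>) \<partial>P) =
      (\<integral>\<^sup>+ \<omega>. indicator E \<omega> * nexp (laplace_exponent (cutoff (D n \<omega>) \<phi>)) \<partial>P)" for n
  proof -
    define d where "d k = (real k + 1) / 2 ^ n" for k
    define S where "S k = {\<omega> \<in> E. D n \<omega> = d k}" for k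
    have S [measurable]: "S k \<in> sets P" for k unfolding S_def by measurable
    have inj: "d j = d k \<longleftrightarrow> j = k" for j k by (simp add: d_def)
    \<comment> \<open>Each sample lies in at most one \<open>S k\<close>, and each sample of
      \<open>E\<close> in exactly one, so an integral with random radius becomes a countable sum of
      integrals with fixed radii.\<close>
    have split: "(\<integral>\<^sup>+ \<omega>. indicator E \<omega> * g (D n \<omega>) \<omega> \<partial>P) = (\<Sum>k. \<integral>\<^sup>+ \<omega>. indicator (S k) \<omega> * g (d k) \<omega> \<partial>P)"
      if [measurable]: "\<And>k. g (d k) \<in> borel_measurable P" for g :: "real \<Rightarrow> 'w \<Rightarrow> ennreal"
    proof -
      have "indicator E \<omega> * g (D n \<omega>) \<omega> = (\<Sum>k. indicator (S k) \<omega> * g (d k) \<omega>)" for \<omega>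
      proof -
        obtain k where k: "D n \<omega> = d k"
          using dyadic_above_cases[OF last_norm_nonneg[of K \<omega>], where n = n] by (auto simp: D_def d_def)
        have "(\<Sum>j. indicator (S j) \<omega> * g (d j) \<omega>) = (\<Sum>j. if j = k then indicator E \<omega> * g (d j) \<omega> else 0)"
          using k inj by (intro suminf_cong) (auto simp: S_def indicator_def)
        also have "\<dots> = indicator E \<omega> * g (d k) \<omega>"
          by (rule sums_unique[symmetric]) (rule sums_single)
        finally show ?thesis using k by simp
      qed
      then show ?thesis by (subst nn_integral_suminf[symmetric]) auto
    qed
    have "(\<integral>\<^sup>+ \<omega>. indicator (S k) \<omega> * nexp (total (cutoff (d k) \<phi>) \<omega>) \<partial>P) =
        (\<integral>\<^sup>+ \<omega>. indicator (S k) \<omega> * nexp (laplace_exponent (cutoff (d k) \<phi>)) \<partial>P)" for k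
    proof -
      \<comment> \<open>On a level set the lower bound for the last norm is a condition on the
        distance vector and goes into \<open>B\<close>; the upper bound is the condition
        \<open>last_norm K \<omega> < d k\<close> of \<open>factor_dists\<close>.\<close>
      define B where "B = A \<inter> {r \<in> space (\<Pi>\<^sub>M k\<in>{..<K}. borel). real k / 2 ^ n \<le> final K r}"
      have B: "B \<in> sets (\<Pi>\<^sub>M k\<in>{..<K}. borel)" unfolding B_def by measurable
      have "S k = {\<omega> \<in> space P. dists K \<omega> \<in> B \<and> last_norm K \<omega> < d k}"
        using measurable_space[OF dists_measurable]
        by (auto simp: S_def E_def B_def D_def d_def dyadic_above_eq_iff[OF last_norm_nonneg] last_norm_eq_final[symmetric])
      moreover have "0 < d k" by (simp add: d_def)
      ultimately have "(\<integral>\<^sup>+ \<omega>. indicator (S k) \<omega> * nexp (total (cutoff (d k) \<phi>) \<omega>) \<partial>P) =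
          (\<integral>\<^sup>+ \<omega>. indicator (S k) \<omega> \<partial>P) * nexp (laplace_exponent (cutoff (d k) \<phi>))"
        using factor_dists[OF _ _ _ B, of "cutoff (d k) \<phi>" "d k"] by (simp add: cutoff_def)
      then show ?thesis by (simp add: nn_integral_multc)
    qed
    then show ?thesis
      by (subst (1 2) split) simp_all
  qed
  note dyadic = decseq_dyadic_above tendsto_dyadic_above dyadic_above_greater
  have "(\<lambda>n. \<integral>\<^sup>+ \<omega>. indicator E \<omega> * nexp (total (cutoff (D n \<omega>) \<phi>) \<omega>) \<partial>P) \<longlonglongrightarrow>
      (\<integral>\<^sup>+ \<omega>. indicator E \<omega> * nexp (total (cutoff (last_norm K \<omega>) \<phi>) \<omega>) \<partial>P)"
    by (rule tendsto_nn_integral_nexp)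
      (auto simp: D_def intro!: tendsto_total incseq_cutoff tendsto_cutoff dyadic)
  moreover have "(\<lambda>n. \<integral>\<^sup>+ \<omega>. indicator E \<omega> * nexp (laplace_exponent (cutoff (D n \<omega>) \<phi>)) \<partial>P) \<longlonglongrightarrow>
      (\<integral>\<^sup>+ \<omega>. indicator E \<omega> * nexp (laplace_exponent (cutoff (last_norm K \<omega>) \<phi>)) \<partial>P)"
    by (rule tendsto_nn_integral_nexp)
      (auto simp: D_def intro!: tendsto_laplace_exponent incseq_cutoff tendsto_cutoff dyadic)
  ultimately show ?thesis
    unfolding eq using LIMSEQ_unique by blast
qed

end

section \<open>Joint density of the nearest distances\<close>

lemma nn_integral_rayleigh_tail:
  assumes c: "0 < c" and a: "0 \<le> a"
  shows "(\<integral>\<^sup>+ x. ennreal (2 * c * x * exp (- c * (x\<^sup>2 - b\<^sup>2))) * indicator {a..} x \<partial>lborel) =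
    ennreal (exp (- c * (a\<^sup>2 - b\<^sup>2)))"
proof -
  have "(\<integral>\<^sup>+ x. ennreal (2 * c * x * exp (- c * (x\<^sup>2 - b\<^sup>2))) * indicator {a..} x \<partial>lborel) =
      ennreal (0 - (- exp (- c * (a\<^sup>2 - b\<^sup>2))))"
  proof (rule nn_integral_FTC_atLeast)
    show "((\<lambda>x. - exp (- c * (x\<^sup>2 - b\<^sup>2))) \<longlongrightarrow> 0) at_top"
      using c by real_asymp
  qed (use c a in \<open>auto intro!: derivative_eq_intros\<close>)
  then show ?thesis by simp
qed

definition ordered_domain :: "nat \<Rightarrow> (nat \<Rightarrow> real) set" where
  "ordered_domain K = {r \<in> extensional {..<K}. (\<forall>k<K. 0 < r k) \<and> (\<forall>j k. j \<le> k \<longrightarrow> k < K \<longrightarrow> r j \<le> r k)}"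

definition dists_density :: "real \<Rightarrow> nat \<Rightarrow> (nat \<Rightarrow> real) \<Rightarrow> ennreal" where
  "dists_density c K r = ennreal ((2 * c) ^ K * (\<Prod>k<K. r k) * exp (- c * (final K r)\<^sup>2)) * indicator (ordered_domain K) r"

text \<open>For \<open>c = pi * lam\<close> this is minus the derivative in \<open>x\<close> of the
  probability \<open>exp (- c * (x\<^sup>2 - a\<^sup>2))\<close> that the annulus between
  \<open>a\<close> and \<open>x\<close> is void. The indicator of the positive half-line matches the
  positivity in \<open>ordered_domain\<close>.\<close>

definition next_density :: "real \<Rightarrow> real \<Rightarrow> real \<Rightarrow> ennreal" where
  "next_density c a x = ennreal (2 * c * x * exp (- c * (x\<^sup>2 - a\<^sup>2))) * indicator {a..} x * indicator {0<..} x"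

lemma ordered_domain_sets [measurable]: "ordered_domain K \<in> sets (\<Pi>\<^sub>M k\<in>{..<K}. borel)"
proof -
  have "ordered_domain K = {r \<in> space (\<Pi>\<^sub>M k\<in>{..<K}. borel).
      (\<forall>k. k < K \<longrightarrow> 0 < r k) \<and> (\<forall>j k. j \<le> k \<longrightarrow> k < K \<longrightarrow> r j \<le> r k)}"
    by (auto simp: ordered_domain_def space_PiM PiE_def)
  also have "\<dots> \<in> sets (\<Pi>\<^sub>M k\<in>{..<K}. borel)"
    by (intro sets.sets_Collect_conj sets.sets_Collect_countable_All sets.sets_Collect_imp
        sets.sets_Collect_const borel_measurable_less borel_measurable_le
        measurable_PiM_component borel_measurable_const)
  finally show ?thesis .
qed

lemma dists_density_measurable [measurable]:
  "dists_density c K \<in> borel_measurable (\<Pi>\<^sub>M k\<in>{..<K}. borel)"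
proof -
  have [measurable]: "(\<lambda>r. \<Prod>k<K. r k) \<in> borel_measurable (\<Pi>\<^sub>M k\<in>{..<K}. borel :: real measure)"
    by (intro borel_measurable_prod measurable_PiM_component)
  show ?thesis unfolding dists_density_def by measurable
qed

lemma next_density_measurable [measurable]:
  "(\<lambda>(a, x). next_density c a x) \<in> borel_measurable (borel \<Otimes>\<^sub>M borel)"
proof -
  have "(\<lambda>(a, x). next_density c a x) = (\<lambda>(a, x). if a \<le> x \<and> 0 < x then ennreal (2 * c * x * exp (- c * (x\<^sup>2 - a\<^sup>2))) else 0)"
    by (auto simp: next_density_def fun_eq_iff)
  then show ?thesis by simp
qed

lemma ordered_domain_Suc:
  assumes "r \<in> extensional {..<K}"
  shows "r(K := x) \<in> ordered_domain (Suc K) \<longleftrightarrow> r \<in> ordered_domain K \<and> final K r \<le> x \<and> 0 < x"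
proof (cases K)
  case 0
  then show ?thesis using assms by (auto simp: ordered_domain_def final_def extensional_def)
next
  case (Suc n)
  have ext: "r(K := x) \<in> extensional {..<Suc K}" using assms by (auto simp: extensional_def)
  show ?thesis
  proof
    assume *: "r(K := x) \<in> ordered_domain (Suc K)"
    then have pos: "0 < (r(K := x)) k" if "k < Suc K" for k
      using that by (simp only: ordered_domain_def mem_Collect_eq)
    from * have mono: "(r(K := x)) j \<le> (r(K := x)) k" if "j \<le> k" "k < Suc K" for j k
      using that by (simp only: ordered_domain_def mem_Collect_eq)
    have "0 < r k" if "k < K" for k using pos[of k] that by simp
    moreover have "r j \<le> r k" if "j \<le> k" "k < K" for j k
      using mono[of j k] that by simp
    moreover have "r n \<le> x" "0 < x"
      using mono[of n K] pos[of K] Suc by auto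
    ultimately show "r \<in> ordered_domain K \<and> final K r \<le> x \<and> 0 < x"
      using assms Suc by (auto simp: ordered_domain_def final_def)
  next
    assume *: "r \<in> ordered_domain K \<and> final K r \<le> x \<and> 0 < x"
    then have "r k \<le> x" if "k < K" for k
    proof -
      have "r k \<le> r n"
        using conjunct1[OF *] that Suc by (simp add: ordered_domain_def)
      also have "r n \<le> x" using * Suc by (simp add: final_def)
      finally show ?thesis .
    qed
    with * ext show "r(K := x) \<in> ordered_domain (Suc K)"
      by (auto simp: ordered_domain_def less_Suc_eq)
  qed
qed

text \<open>The exponentials telescope: the factor for the disc up to the old last distance times
  the factor for the new annulus is the factor for the disc up to \<open>x\<close>.\<close>

lemma dists_density_Suc:
  assumes "0 < c" "r \<in> extensional {..<K}"
  shows "dists_density c (Suc K) (r(K := x)) = dists_density c K r * next_density c (final K r) x"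
proof (cases "r(K := x) \<in> ordered_domain (Suc K)")
  case True
  then have *: "r \<in> ordered_domain K" "final K r \<le> x" "0 < x"
    using ordered_domain_Suc[OF assms(2)] by auto
  have "0 \<le> (\<Prod>k<K. r k)" using *(1) by (intro prod_nonneg) (auto simp: ordered_domain_def less_imp_le)
  moreover have "(\<Prod>k<Suc K. (r(K := x)) k) = (\<Prod>k<K. r k) * x"
    by simp
  moreover have "exp (- c * (final (Suc K) (r(K := x)))\<^sup>2) = exp (- c * (final K r)\<^sup>2) * exp (- c * (x\<^sup>2 - (final K r)\<^sup>2))"
    by (simp add: final_def[of "Suc K"] algebra_simps flip: exp_add)
  ultimately show ?thesis
    using True * assms(1) unfolding dists_density_def next_density_def
    by (simp add: mult_ac flip: ennreal_mult)
next
  case False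
  then show ?thesis
    using ordered_domain_Suc[OF assms(2)] by (auto simp: dists_density_def next_density_def)
qed

text \<open>\<open>intensity_sum\<close> makes the two marks together homogeneous, so void
  probabilities depend on areas only; \<open>poisson_all\<close> is the source of the exclusion of
  ties.\<close>

locale planar_poisson = marked_poisson P X los L
  for P :: "'w measure" and X :: "nat \<Rightarrow> 'w \<Rightarrow> real^2" and los L +
  fixes lam :: real
  assumes lam_pos: "0 < lam"
    and intensity_sum: "B \<in> sets borel \<Longrightarrow> (\<Sum>b\<in>UNIV. emeasure (L b) B) = ennreal lam * emeasure lborel B"
    and poisson_all: "poisson_point_process P (density lborel (\<lambda>_. ennreal lam)) (point_count X (\<lambda>_ _. True))"
begin

abbreviation count :: "(real^2) set \<Rightarrow> 'w \<Rightarrow> ennreal" where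
  "count \<equiv> point_count X (\<lambda>_ _. True)"

abbreviation area_rate :: real where "area_rate \<equiv> pi * lam"

lemma area_rate_pos: "0 < area_rate" using lam_pos by simp

lemma count_measurable [measurable]: "B \<in> sets borel \<Longrightarrow> count B \<in> borel_measurable P"
  using poisson_all by (auto simp: poisson_point_process_def)

lemma prob_count_eq:
  assumes B: "B \<in> sets borel" and m: "emeasure lborel B = ennreal m" "0 \<le> m"
  shows "prob {\<omega> \<in> space P. count B \<omega> = of_nat k} = (lam * m) ^ k / fact k * exp (- (lam * m))"
proof -
  have "emeasure (density lborel (\<lambda>_. ennreal lam)) B = ennreal (lam * m)"
    using B m lam_pos by (simp add: emeasure_density_const ennreal_mult)
  moreover from this have "measure (density lborel (\<lambda>_. ennreal lam)) B = lam * m"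
    using m lam_pos by (simp add: measure_def)
  ultimately show ?thesis
    using poisson_all B unfolding poisson_point_process_def by auto
qed

text \<open>The Poisson tail for mean \<open>x\<close> is \<open>1 - exp (- x) * (1 + x)\<close>,
  and \<open>1 - x \<le> exp (- x)\<close> bounds it by the square of \<open>x\<close>. The
  quadratic order is what makes a union bound over many thin annuli vanish.\<close>

lemma prob_count_ge_2_le:
  assumes B [measurable]: "B \<in> sets borel" and m: "emeasure lborel B = ennreal m" "0 \<le> m"
  shows "prob {\<omega> \<in> space P. 2 \<le> count B \<omega>} \<le> (lam * m)\<^sup>2"
proof -
  define S where "S k = {\<omega> \<in> space P. count B \<omega> = of_nat k}" for k
  define T where "T = {\<omega> \<in> space P. 2 \<le> count B \<omega>}"
  have [measurable]: "S k \<in> sets P" "T \<in> sets P" for k unfolding S_def T_def by measurable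
  have "prob T + prob (S 0) + prob (S 1) = prob (T \<union> S 0 \<union> S 1)"
    by (subst finite_measure_Union, simp, simp, force simp: S_def T_def)
      (subst finite_measure_Union, simp, simp, force simp: S_def T_def, simp)
  also have "\<dots> \<le> 1" by simp
  finally have T_le: "prob T \<le> 1 - exp (- (lam * m)) * (1 + lam * m)"
    using prob_count_eq[OF assms, of 0] prob_count_eq[OF assms, of 1] by (simp add: S_def algebra_simps)
  have "(1 - lam * m) * (1 + lam * m) \<le> exp (- (lam * m)) * (1 + lam * m)"
    using m lam_pos exp_ge_add_one_self[of "- (lam * m)"] by (intro mult_right_mono) auto
  then have "1 - exp (- (lam * m)) * (1 + lam * m) \<le> (lam * m)\<^sup>2"
    by (simp add: algebra_simps power2_eq_square)
  with T_le show ?thesis by (simp add: T_def)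
qed

lemma emeasure_annulus:
  assumes "0 \<le> a" "a \<le> b"
  shows "emeasure lborel {x :: real^2. a \<le> norm x \<and> norm x < b} = ennreal (pi * b\<^sup>2 - pi * a\<^sup>2)"
proof -
  have "{x :: real^2. a \<le> norm x \<and> norm x < b} = {x. norm x < b} - {x. norm x < a}" by auto
  also have "emeasure lborel \<dots> = emeasure lborel {x :: real^2. norm x < b} - emeasure lborel {x :: real^2. norm x < a}"
    using assms by (intro emeasure_Diff) (auto simp: emeasure_norm_less_plane)
  also have "\<dots> = ennreal (pi * b\<^sup>2 - pi * a\<^sup>2)"
    using assms by (simp add: emeasure_norm_less_plane ennreal_minus)
  finally show ?thesis .
qed

lemma two_le_count:
  assumes "X i \<omega> \<in> B" "X j \<omega> \<in> B" "i \<noteq> j"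
  shows "2 \<le> count B \<omega>"
proof -
  have "2 = emeasure (count_space UNIV) {i, j}"
    using assms by (simp add: emeasure_count_space)
  also have "\<dots> \<le> count B \<omega>"
    unfolding point_count_def using assms by (intro emeasure_mono) auto
  finally show ?thesis .
qed

text \<open>Two points of equal norm share a dyadic annulus of width \<open>1 / 2 ^ n\<close>. Up to
  radius \<open>T\<close> there are \<open>T * 2 ^ n\<close> of these, each holding two points with
  probability of order \<open>1 / 4 ^ n\<close>, so the union bound is of order
  \<open>1 / 2 ^ n\<close>.\<close>

lemma no_ties_ball:
  "AE \<omega> in P. \<not> (norm (X i \<omega>) = norm (X (Suc i) \<omega>) \<and> norm (X i \<omega>) < real T)"
proof -
  define S where "S = {\<omega> \<in> space P. norm (X i \<omega>) = norm (X (Suc i) \<omega>) \<and> norm (X i \<omega>) < real T}"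
  have [measurable]: "S \<in> sets P" unfolding S_def by measurable
  define B where "B n k = {x :: real^2. real k / 2 ^ n \<le> norm x \<and> norm x < (real k + 1) / 2 ^ n}" for n k
  have [measurable]: "B n k \<in> sets borel" for n k unfolding B_def by measurable
  have bound: "prob S \<le> 4 * real T ^ 3 * area_rate\<^sup>2 * (1 / 2) ^ n" for n
  proof -
    have "S \<subseteq> (\<Union>k<T * 2 ^ n. {\<omega> \<in> space P. 2 \<le> count (B n k) \<omega>})"
    proof
      fix \<omega> assume \<omega>: "\<omega> \<in> S"
      obtain k where "dyadic_above n (norm (X i \<omega>)) = (real k + 1) / 2 ^ n"
        using dyadic_above_cases[of "norm (X i \<omega>)" n] by auto
      then have k: "real k / 2 ^ n \<le> norm (X i \<omega>)" "norm (X i \<omega>) < (real k + 1) / 2 ^ n"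
        by (simp_all add: dyadic_above_eq_iff)
      have "real k / 2 ^ n < real T" using k(1) \<omega> by (auto simp: S_def)
      then have "real k < real (T * 2 ^ n)" by (simp add: field_simps)
      then have "k < T * 2 ^ n" by (simp only: of_nat_less_iff)
      moreover have "2 \<le> count (B n k) \<omega>"
        using k \<omega> by (intro two_le_count[of i \<omega> _ "Suc i"]) (auto simp: B_def S_def)
      ultimately show "\<omega> \<in> (\<Union>k<T * 2 ^ n. {\<omega> \<in> space P. 2 \<le> count (B n k) \<omega>})"
        using \<omega> by (auto simp: S_def)
    qed
    then have "prob S \<le> prob (\<Union>k<T * 2 ^ n. {\<omega> \<in> space P. 2 \<le> count (B n k) \<omega>})"
      by (intro finite_measure_mono) auto
    also have "\<dots> \<le> (\<Sum>k<T * 2 ^ n. prob {\<omega> \<in> space P. 2 \<le> count (B n k) \<omega>})"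
      by (intro finite_measure_subadditive_finite) auto
    also have "\<dots> \<le> (\<Sum>k<T * 2 ^ n. (2 * real T * area_rate * (1 / 2) ^ n)\<^sup>2)"
    proof (intro sum_mono)
      fix k assume "k \<in> {..<T * 2 ^ n}"
      then have "k + 1 \<le> T * 2 ^ n" by simp
      then have "real (k + 1) \<le> real (T * 2 ^ n)" by (simp only: of_nat_le_iff)
      then have k: "real k + 1 \<le> real T * 2 ^ n" by simp
      \<comment> \<open>The area \<open>m\<close> of the annulus is at most
        \<open>2 * pi * T / 2 ^ n\<close>, since its outer radius is at most \<open>T\<close>. This
        is the origin of the constants in the bound.\<close>
      define m where "m = pi * ((real k + 1) / 2 ^ n)\<^sup>2 - pi * (real k / 2 ^ n)\<^sup>2"
      have m_eq: "m = pi * (2 * real k + 1) / (2 ^ n)\<^sup>2"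
        by (simp add: m_def power_divide field_simps power2_eq_square)
      have m: "0 \<le> m" by (simp add: m_eq)
      have cell: "prob {\<omega> \<in> space P. 2 \<le> count (B n k) \<omega>} \<le> (lam * m)\<^sup>2"
        unfolding B_def by (rule prob_count_ge_2_le)
          (use m in \<open>auto simp: emeasure_annulus divide_right_mono m_def\<close>)
      have "m \<le> pi * (2 * (real T * 2 ^ n)) / (2 ^ n)\<^sup>2"
        unfolding m_eq using k by (intro divide_right_mono mult_left_mono) auto
      then have "m \<le> 2 * real T * pi * (1 / 2) ^ n"
        by (simp add: power2_eq_square power_one_over field_simps)
      then have "lam * m \<le> lam * (2 * real T * pi * (1 / 2) ^ n)"
        using lam_pos by (intro mult_left_mono) auto
      then have "(lam * m)\<^sup>2 \<le> (2 * real T * area_rate * (1 / 2) ^ n)\<^sup>2"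
        using m lam_pos by (intro power_mono) (auto simp: mult_ac)
      with cell show "prob {\<omega> \<in> space P. 2 \<le> count (B n k) \<omega>} \<le> (2 * real T * area_rate * (1 / 2) ^ n)\<^sup>2"
        by (rule order_trans)
    qed
    also have "\<dots> = 4 * real T ^ 3 * area_rate\<^sup>2 * (1 / 2) ^ n"
      by (simp add: power_mult_distrib power_one_over power2_eq_square power3_eq_cube field_simps)
    finally show ?thesis .
  qed
  have "(\<lambda>n. 4 * real T ^ 3 * area_rate\<^sup>2 * (1 / 2) ^ n) \<longlonglongrightarrow> 4 * real T ^ 3 * area_rate\<^sup>2 * 0"
    by (intro tendsto_mult_left LIMSEQ_power_zero) simp
  then have "prob S \<le> 0"
    using bound by (intro LIMSEQ_le_const[of _ _ "prob S"]) auto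
  then have "emeasure P S = 0"
    by (simp add: emeasure_eq_measure measure_le_0_iff)
  then show ?thesis
    by (intro AE_I[of _ _ S]) (auto simp: S_def)
qed

text \<open>For \<open>K = 0\<close> the claim is that no point sits at the origin, a set of area 0.
  Otherwise the bounded statements about ties are united over countably many radii.\<close>

lemma AE_last_norm_less: "AE \<omega> in P. last_norm K \<omega> < norm (X K \<omega>)"
proof (cases K)
  case 0
  have "prob {\<omega> \<in> space P. count {0} \<omega> = of_nat 0} = 1"
    using prob_count_eq[of "{0}" 0 0] by simp
  then have "AE \<omega> in P. count {0} \<omega> = 0"
    by (subst (asm) prob_Collect_eq_1) auto
  then show ?thesis
  proof eventually_elim
    case (elim \<omega>)
    then have "X 0 \<omega> \<noteq> 0"
      by (auto simp: point_count_def emeasure_count_space split: if_splits)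
    then show ?case by (simp add: 0 last_norm_def)
  qed
next
  case (Suc i)
  have "AE \<omega> in P. \<forall>T. \<not> (norm (X i \<omega>) = norm (X (Suc i) \<omega>) \<and> norm (X i \<omega>) < real T)"
    unfolding AE_all_countable using no_ties_ball by blast
  moreover have "AE \<omega> in P. \<omega> \<in> space P" by (rule AE_space)
  ultimately show ?thesis
  proof eventually_elim
    case (elim \<omega>)
    obtain T where "norm (X i \<omega>) < real T" using reals_Archimedean2 by blast
    then have "norm (X i \<omega>) \<noteq> norm (X (Suc i) \<omega>)" using elim by blast
    then show ?case using norm_X_le_Suc[of \<omega> i] elim Suc by (simp add: last_norm_def)
  qed
qed

end

section \<open>Conditional law of the next distance\<close>

lemma nn_integral_next_density_tail:
  assumes c: "0 < c" and a: "0 \<le> a"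
  shows "(\<integral>\<^sup>+ x. next_density c a x * indicator {t..} x \<partial>lborel) = ennreal (exp (- c * ((max t a)\<^sup>2 - a\<^sup>2)))"
proof -
  have "(\<integral>\<^sup>+ x. next_density c a x * indicator {t..} x \<partial>lborel) =
      (\<integral>\<^sup>+ x. ennreal (2 * c * x * exp (- c * (x\<^sup>2 - a\<^sup>2))) * indicator {max t a..} x \<partial>lborel)"
    using a by (intro nn_integral_cong_AE AE_I[of _ _ "{0}"])
      (auto simp: next_density_def split: split_indicator)
  then show ?thesis
    using nn_integral_rayleigh_tail[OF c, of "max t a" a] a by simp
qed

lemma emeasure_open_annulus:
  assumes "0 \<le> a"
  shows "emeasure lborel {x :: real^2. a < norm x \<and> norm x < t} = ennreal (pi * ((max t a)\<^sup>2 - a\<^sup>2))"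
proof -
  have "emeasure lborel {x :: real^2. a < norm x \<and> norm x < t} =
      (\<integral>\<^sup>+ (x :: real^2). indicator {x. a < norm x \<and> norm x < t} x \<partial>lborel)"
    by (rule nn_integral_indicator[symmetric]) simp
  also have "\<dots> = (\<integral>\<^sup>+ (x :: real^2). indicator {a<..<t} (norm x) \<partial>lborel)"
    by (intro nn_integral_cong) (auto split: split_indicator)
  also have "\<dots> = (\<integral>\<^sup>+ x. ennreal (2 * pi * x) * indicator {a<..<t} x * indicator {0<..} x \<partial>lborel)"
    by (subst nn_integral_norm_plane) auto
  also have "\<dots> = (\<integral>\<^sup>+ x. ennreal (2 * pi * x) * indicator {a..max t a} x \<partial>lborel)"
    using assms by (intro nn_integral_cong_AE AE_I[of _ _ "{0, a, t}"])
      (auto split: split_indicator simp: emeasure_lborel_countable)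
  also have "\<dots> = ennreal (pi * ((max t a)\<^sup>2 - a\<^sup>2))"
    using assms by (subst nn_integral_linear) (auto simp: right_diff_distrib)
  finally show ?thesis .
qed

text \<open>The weight that turns a Laplace functional into a void probability: \<open>nexp\<close>
  of the total is 1 or 0 according to whether the ball is empty.\<close>

definition void_weight :: "real \<Rightarrow> 'a::real_normed_vector \<Rightarrow> bool \<Rightarrow> ennreal" where
  "void_weight t x b = (if norm x < t then \<infinity> else 0)"

context planar_poisson begin

lemma nexp_laplace_exponent_void:
  assumes "0 \<le> a"
  shows "nexp (laplace_exponent (cutoff a (void_weight t))) =
    ennreal (exp (- area_rate * ((max t a)\<^sup>2 - a\<^sup>2)))"
proof -
  have "laplace_exponent (cutoff a (void_weight t)) =
      (\<Sum>b\<in>UNIV. \<integral>\<^sup>+ x. indicator {x. a < norm x \<and> norm x < t} x \<partial>L b)"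
    unfolding laplace_exponent_def
    by (intro sum.cong nn_integral_cong) (auto simp: cutoff_def void_weight_def indicator_def)
  also have "\<dots> = ennreal lam * emeasure lborel {x :: real^2. a < norm x \<and> norm x < t}"
    by (simp add: intensity_sum)
  also have "\<dots> = ennreal (area_rate * ((max t a)\<^sup>2 - a\<^sup>2))"
    using assms lam_pos by (simp add: emeasure_open_annulus mult_ac flip: ennreal_mult')
  finally show ?thesis
    using assms lam_pos by (simp add: nexp_ennreal)
qed

text \<open>The first \<open>K\<close> points are removed by the cutoff, and the nearest remaining
  one is \<open>X K\<close>. Strictness of \<open>less\<close> ensures that \<open>X K\<close>
  itself survives the cutoff.\<close>

lemma nexp_total_void:
  assumes \<omega>: "\<omega> \<in> space P" and less: "last_norm K \<omega> < norm (X K \<omega>)"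
  shows "nexp (total (cutoff (last_norm K \<omega>) (void_weight t)) \<omega>) = indicator {t..} (norm (X K \<omega>))"
proof (cases "t \<le> norm (X K \<omega>)")
  case True
  have "cutoff (last_norm K \<omega>) (void_weight t) (X i \<omega>) (los i \<omega>) = 0" for i
  proof (cases "i < K")
    case True
    then have "norm (X i \<omega>) \<le> last_norm K \<omega>"
      using norm_X_mono[OF \<omega>, of i "K - 1"] by (auto simp: last_norm_def)
    then show ?thesis by (simp add: cutoff_def)
  next
    case False
    then have "t \<le> norm (X i \<omega>)"
      using norm_X_mono[OF \<omega>, of K i] True by simp
    then show ?thesis by (simp add: cutoff_def void_weight_def)
  qed
  then show ?thesis using True by (simp add: total_def)
next
  case False
  have "\<infinity> = (\<Sum>i\<in>{K}. cutoff (last_norm K \<omega>) (void_weight t) (X i \<omega>) (los i \<omega>))"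
    using False less by (simp add: cutoff_def void_weight_def)
  also have "\<dots> \<le> total (cutoff (last_norm K \<omega>) (void_weight t)) \<omega>"
    unfolding total_def by (rule sum_le_suminf) auto
  finally show ?thesis using False by (simp add: top_unique)
qed

lemma void_weight_measurable [measurable]: "(\<lambda>x. void_weight t x b) \<in> borel_measurable borel"
  unfolding void_weight_def by measurable

text \<open>The spatial Markov property for \<open>void_weight t\<close> gives the conditional tail
  of the next distance as a void probability, which is rewritten as an integral of its
  density.\<close>

lemma emeasure_next_tail:
  assumes A [measurable]: "A \<in> sets (\<Pi>\<^sub>M k\<in>{..<K}. borel)"
  shows "emeasure P {\<omega> \<in> space P. dists K \<omega> \<in> A \<and> norm (X K \<omega>) \<in> {t..}} =
    (\<integral>\<^sup>+ \<omega>. indicator {\<omega> \<in> space P. dists K \<omega> \<in> A} \<omega> *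
      (\<integral>\<^sup>+ x. next_density area_rate (last_norm K \<omega>) x * indicator {t..} x \<partial>lborel) \<partial>P)"
proof -
  let ?E = "{\<omega> \<in> space P. dists K \<omega> \<in> A}"
  have "emeasure P {\<omega> \<in> space P. dists K \<omega> \<in> A \<and> norm (X K \<omega>) \<in> {t..}} =
      (\<integral>\<^sup>+ \<omega>. indicator {\<omega> \<in> space P. dists K \<omega> \<in> A \<and> norm (X K \<omega>) \<in> {t..}} \<omega> \<partial>P)"
    by (rule nn_integral_indicator[symmetric]) measurable
  also have "\<dots> = (\<integral>\<^sup>+ \<omega>. indicator ?E \<omega> * indicator {t..} (norm (X K \<omega>)) \<partial>P)"
    by (intro nn_integral_cong) (auto split: split_indicator)
  also have "\<dots> = (\<integral>\<^sup>+ \<omega>. indicator ?E \<omega> * nexp (total (cutoff (last_norm K \<omega>) (void_weight t)) \<omega>) \<partial>P)"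
    using AE_last_norm_less[of K] AE_space[of P]
    by (intro nn_integral_cong_AE, eventually_elim) (simp add: nexp_total_void)
  also have "\<dots> = (\<integral>\<^sup>+ \<omega>. indicator ?E \<omega> * nexp (laplace_exponent (cutoff (last_norm K \<omega>) (void_weight t))) \<partial>P)"
    by (rule spatial_markov) measurable
  also have "\<dots> = (\<integral>\<^sup>+ \<omega>. indicator ?E \<omega> *
      (\<integral>\<^sup>+ x. next_density area_rate (last_norm K \<omega>) x * indicator {t..} x \<partial>lborel) \<partial>P)"
    by (simp add: nexp_laplace_exponent_void nn_integral_next_density_tail area_rate_pos last_norm_nonneg del: mult_minus_left)
  finally show ?thesis .
qed

lemma emeasure_next:
  assumes A [measurable]: "A \<in> sets (\<Pi>\<^sub>M k\<in>{..<K}. borel)" and B: "B \<in> sets borel"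
  shows "emeasure P {\<omega> \<in> space P. dists K \<omega> \<in> A \<and> norm (X K \<omega>) \<in> B} =
    (\<integral>\<^sup>+ \<omega>. indicator {\<omega> \<in> space P. dists K \<omega> \<in> A} \<omega> *
      (\<integral>\<^sup>+ x. next_density area_rate (last_norm K \<omega>) x * indicator B x \<partial>lborel) \<partial>P)"
proof -
  define E where "E = {\<omega> \<in> space P. dists K \<omega> \<in> A}"
  have E [measurable]: "E \<in> sets P" unfolding E_def by measurable
  interpret pair_sigma_finite P lborel ..
  \<comment> \<open>Averaging the conditional density over the sample shows that the right-hand side
    is a measure in \<open>B\<close>, with density \<open>g\<close>; agreement of the two measures
    on the half-lines \<open>{t..}\<close> then suffices.\<close>
  define g where "g x = (\<integral>\<^sup>+ \<omega>. indicator E \<omega> * next_density area_rate (last_norm K \<omega>) x \<partial>P)" for x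
  have [measurable]: "(\<lambda>(\<omega>, x). next_density area_rate (last_norm K \<omega>) x) \<in> borel_measurable (P \<Otimes>\<^sub>M lborel)"
    using measurable_compose[OF _ next_density_measurable, of "\<lambda>(\<omega>, x). (last_norm K \<omega>, x)" "P \<Otimes>\<^sub>M lborel"]
    by (simp add: split_beta)
  have [measurable]: "(\<lambda>(x, \<omega>). next_density area_rate (last_norm K \<omega>) x) \<in> borel_measurable (lborel \<Otimes>\<^sub>M P)"
    using measurable_compose[OF _ next_density_measurable, of "\<lambda>(x, \<omega>). (last_norm K \<omega>, x)" "lborel \<Otimes>\<^sub>M P"]
    by (simp add: split_beta)
  have g [measurable]: "g \<in> borel_measurable lborel"
    unfolding g_def by measurable
  define M1 where "M1 = distr (density P (indicator E)) borel (\<lambda>\<omega>. norm (X K \<omega>))"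
  define M2 where "M2 = density lborel g"
  have M1: "emeasure M1 S = emeasure P {\<omega> \<in> space P. dists K \<omega> \<in> A \<and> norm (X K \<omega>) \<in> S}"
    if [measurable]: "S \<in> sets borel" for S
  proof -
    have "emeasure M1 S = (\<integral>\<^sup>+ \<omega>. indicator E \<omega> * indicator ((\<lambda>\<omega>. norm (X K \<omega>)) -` S \<inter> space P) \<omega> \<partial>P)"
      unfolding M1_def by (subst emeasure_distr, simp, simp, subst emeasure_density) auto
    also have "\<dots> = (\<integral>\<^sup>+ \<omega>. indicator {\<omega> \<in> space P. dists K \<omega> \<in> A \<and> norm (X K \<omega>) \<in> S} \<omega> \<partial>P)"
      by (intro nn_integral_cong) (auto simp: E_def split: split_indicator)
    finally show ?thesis by (subst (asm) nn_integral_indicator) auto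
  qed
  have M2: "emeasure M2 S = (\<integral>\<^sup>+ \<omega>. indicator E \<omega> *
      (\<integral>\<^sup>+ x. next_density area_rate (last_norm K \<omega>) x * indicator S x \<partial>lborel) \<partial>P)"
    if [measurable]: "S \<in> sets borel" for S
  proof -
    have "emeasure M2 S = (\<integral>\<^sup>+ x. (\<integral>\<^sup>+ \<omega>. indicator E \<omega> * next_density area_rate (last_norm K \<omega>) x * indicator S x \<partial>P) \<partial>lborel)"
      unfolding M2_def by (subst emeasure_density) (auto simp: g_def nn_integral_multc)
    also have "\<dots> = (\<integral>\<^sup>+ \<omega>. (\<integral>\<^sup>+ x. indicator E \<omega> * next_density area_rate (last_norm K \<omega>) x * indicator S x \<partial>lborel) \<partial>P)"
      by (rule Fubini') measurable
    also have "\<dots> = (\<integral>\<^sup>+ \<omega>. indicator E \<omega> *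
      (\<integral>\<^sup>+ x. next_density area_rate (last_norm K \<omega>) x * indicator S x \<partial>lborel) \<partial>P)"
      by (intro nn_integral_cong) (auto split: split_indicator)
    finally show ?thesis .
  qed
  have "M1 = M2"
  proof (rule measure_eqI_generator_eq[where E = "range (\<lambda>t. {t..})" and A = "\<lambda>n. {- real n..}" and \<Omega> = UNIV])
    show "Int_stable (range (\<lambda>t::real. {t..}))"
    proof (rule Int_stableI)
      fix a b :: "real set" assume "a \<in> range (\<lambda>t. {t..})" "b \<in> range (\<lambda>t. {t..})"
      then obtain s t where "a = {s..}" "b = {t..}" by auto
      then have "a \<inter> b = {max s t..}" by auto
      then show "a \<inter> b \<in> range (\<lambda>t. {t..})" by blast
    qed
    show "emeasure M1 S = emeasure M2 S" if "S \<in> range (\<lambda>t. {t..})" for S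
      using that emeasure_next_tail[OF A] by (auto simp: M1 M2 E_def simp del: atLeast_iff)
    show "emeasure M1 {- real n..} \<noteq> \<infinity>" for n by (simp add: M1)
    show "(\<Union>n. {- real n..}) = UNIV"
    proof (intro equalityI subsetI)
      fix x :: real
      obtain n where "- x < real n" using reals_Archimedean2 by blast
      then have "x \<in> {- real n..}" by simp
      then show "x \<in> (\<Union>n. {- real n..})" by blast
    qed simp
  qed (auto simp: M1_def M2_def borel_Ici)
  then show ?thesis using M1[OF B] M2[OF B] by (simp add: E_def)
qed

section \<open>Joint law of the distances\<close>

interpretation lborel_PiM: product_sigma_finite "\<lambda>_ :: nat. lborel :: real measure"
  by standard

lemma distr_dists_eqI:
  assumes N: "sets N = sets (\<Pi>\<^sub>M k\<in>{..<K}. borel)"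
    and eq: "\<And>A. (\<And>i. i < K \<Longrightarrow> A i \<in> sets borel) \<Longrightarrow>
      emeasure (distr P (\<Pi>\<^sub>M k\<in>{..<K}. borel) (dists K)) (Pi\<^sub>E {..<K} A) = emeasure N (Pi\<^sub>E {..<K} A)"
  shows "distr P (\<Pi>\<^sub>M k\<in>{..<K}. borel) (dists K) = N"
proof (rule measure_eqI_PiM_finite[where I = "{..<K}" and M = "\<lambda>_. borel" and A = "\<lambda>_. \<Pi>\<^sub>E k\<in>{..<K}. UNIV"])
  interpret D: prob_space "distr P (\<Pi>\<^sub>M k\<in>{..<K}. borel) (dists K)"
    by (rule prob_space_distr) measurable
  show "emeasure (distr P (\<Pi>\<^sub>M k\<in>{..<K}. borel) (dists K)) (\<Pi>\<^sub>E k\<in>{..<K}. UNIV) \<noteq> \<infinity>"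
    by simp
qed (use N eq in \<open>auto simp: space_PiM intro!: prod_algebraI_finite\<close>)

text \<open>Induction on \<open>K\<close>: on rectangles, \<open>emeasure_next\<close> integrates
  the conditional density of the new distance against the law of the earlier ones, and the product
  of the two densities is the density for \<open>Suc K\<close>.\<close>

lemma distr_dists:
  "distr P (\<Pi>\<^sub>M k\<in>{..<K}. borel) (dists K) = density (\<Pi>\<^sub>M k\<in>{..<K}. lborel) (dists_density area_rate K)"
proof (induction K)
  case 0
  show ?case
  proof (rule distr_dists_eqI)
    fix A :: "nat \<Rightarrow> real set"
    have box: "Pi\<^sub>E {..<0} A \<in> sets (\<Pi>\<^sub>M k\<in>{..<0}. borel)"
      by (intro sets_PiM_I_finite) auto
    have "dists 0 -` Pi\<^sub>E {..<0} A \<inter> space P = space P"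
      by (auto simp: dists_def)
    then have "emeasure (distr P (\<Pi>\<^sub>M k\<in>{..<0}. borel) (dists 0)) (Pi\<^sub>E {..<0} A) = 1"
      using emeasure_distr[OF dists_measurable box] by (simp only: emeasure_space_1)
    moreover have "emeasure (density (\<Pi>\<^sub>M k\<in>{..<0}. lborel) (dists_density area_rate 0)) (Pi\<^sub>E {..<0} A) = 1"
      \<comment> \<open>The empty product is the counting measure on the single vector that is
        \<open>undefined\<close> everywhere, at which the density equals 1.\<close>
      by (simp add: emeasure_density PiM_empty nn_integral_count_space_finite
          dists_density_def ordered_domain_def final_def extensional_def)
    ultimately show "emeasure (distr P (\<Pi>\<^sub>M k\<in>{..<0}. borel) (dists 0)) (Pi\<^sub>E {..<0} A) =
      emeasure (density (\<Pi>\<^sub>M k\<in>{..<0}. lborel) (dists_density area_rate 0)) (Pi\<^sub>E {..<0} A)"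
      by simp
  qed (simp cong: sets_PiM_cong)
next
  case (Suc K)
  show ?case
  proof (rule distr_dists_eqI)
    fix A :: "nat \<Rightarrow> real set"
    assume A: "\<And>i. i < Suc K \<Longrightarrow> A i \<in> sets borel"
    define R where "R = Pi\<^sub>E {..<K} A"
    have R [measurable]: "R \<in> sets (\<Pi>\<^sub>M k\<in>{..<K}. borel)"
      unfolding R_def using A by (intro sets_PiM_I_finite) auto
    have RS [measurable]: "Pi\<^sub>E {..<Suc K} A \<in> sets (\<Pi>\<^sub>M k\<in>{..<Suc K}. borel)"
      using A by (intro sets_PiM_I_finite) auto
    have AK [measurable]: "A K \<in> sets borel" using A by simp
    let ?\<kappa> = "\<lambda>r. \<integral>\<^sup>+ x. next_density area_rate (final K r) x * indicator (A K) x \<partial>lborel"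
    have \<kappa> [measurable]: "?\<kappa> \<in> borel_measurable (\<Pi>\<^sub>M k\<in>{..<K}. borel)"
      by measurable
    have "emeasure (distr P (\<Pi>\<^sub>M k\<in>{..<Suc K}. borel) (dists (Suc K))) (Pi\<^sub>E {..<Suc K} A) =
        emeasure P {\<omega> \<in> space P. dists K \<omega> \<in> R \<and> norm (X K \<omega>) \<in> A K}"
    proof (subst emeasure_distr)
      have "dists (Suc K) \<omega> \<in> Pi\<^sub>E {..<Suc K} A \<longleftrightarrow> dists K \<omega> \<in> R \<and> norm (X K \<omega>) \<in> A K" for \<omega>
        by (auto simp: R_def dists_def restrict_PiE_iff less_Suc_eq)
      then show "emeasure P (dists (Suc K) -` Pi\<^sub>E {..<Suc K} A \<inter> space P) =
          emeasure P {\<omega> \<in> space P. dists K \<omega> \<in> R \<and> norm (X K \<omega>) \<in> A K}"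
        by (intro arg_cong[where f = "emeasure P"]) blast
    qed (rule dists_measurable RS)+
    also have "\<dots> = (\<integral>\<^sup>+ \<omega>. indicator R (dists K \<omega>) * ?\<kappa> (dists K \<omega>) \<partial>P)"
      unfolding emeasure_next[OF R AK] last_norm_eq_final
      by (intro nn_integral_cong) (auto split: split_indicator)
    also have "\<dots> = (\<integral>\<^sup>+ r. indicator R r * ?\<kappa> r \<partial>distr P (\<Pi>\<^sub>M k\<in>{..<K}. borel) (dists K))"
      by (subst nn_integral_distr) auto
    also have "\<dots> = (\<integral>\<^sup>+ r. dists_density area_rate K r * (indicator R r * ?\<kappa> r) \<partial>(\<Pi>\<^sub>M k\<in>{..<K}. lborel))"
      unfolding Suc.IH by (subst nn_integral_density) auto
    \<comment> \<open>Indicator and density both factor at \<open>r(K := x)\<close>; factors in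
      \<open>r\<close> alone move into the inner integral, which prepares Fubini for the last
      coordinate.\<close>
    also have "\<dots> = (\<integral>\<^sup>+ r. (\<integral>\<^sup>+ x. dists_density area_rate (Suc K) (r(K := x)) * indicator (Pi\<^sub>E {..<Suc K} A) (r(K := x)) \<partial>lborel) \<partial>(\<Pi>\<^sub>M k\<in>{..<K}. lborel))"
    proof (rule nn_integral_cong)
      fix r assume "r \<in> space (\<Pi>\<^sub>M k\<in>{..<K}. lborel :: real measure)"
      then have r: "r \<in> extensional {..<K}" by (simp add: space_PiM PiE_def)
      have "r(K := x) \<in> Pi\<^sub>E {..<Suc K} A \<longleftrightarrow> r \<in> R \<and> x \<in> A K" for x
        using r by (auto simp: R_def PiE_iff extensional_def less_Suc_eq)
      then have "dists_density area_rate (Suc K) (r(K := x)) * indicator (Pi\<^sub>E {..<Suc K} A) (r(K := x)) =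
          (dists_density area_rate K r * indicator R r) * (next_density area_rate (final K r) x * indicator (A K) x)" for x
        by (simp add: dists_density_Suc[OF area_rate_pos r] indicator_def)
      then show "dists_density area_rate K r * (indicator R r * ?\<kappa> r) =
          (\<integral>\<^sup>+ x. dists_density area_rate (Suc K) (r(K := x)) * indicator (Pi\<^sub>E {..<Suc K} A) (r(K := x)) \<partial>lborel)"
        by (simp add: nn_integral_cmult mult.assoc)
    qed
    also have "\<dots> = (\<integral>\<^sup>+ r. dists_density area_rate (Suc K) r * indicator (Pi\<^sub>E {..<Suc K} A) r \<partial>(\<Pi>\<^sub>M k\<in>{..<Suc K}. lborel))"
      unfolding lessThan_Suc
      by (rule lborel_PiM.product_nn_integral_insert[symmetric]) (use dists_density_measurable[of area_rate "Suc K"] RS in \<open>auto simp: lessThan_Suc\<close>)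
    also have "\<dots> = emeasure (density (\<Pi>\<^sub>M k\<in>{..<Suc K}. lborel) (dists_density area_rate (Suc K))) (Pi\<^sub>E {..<Suc K} A)"
    proof -
      have "sets (\<Pi>\<^sub>M k\<in>{..<Suc K}. lborel :: real measure) = sets (\<Pi>\<^sub>M k\<in>{..<Suc K}. borel)"
        by (intro sets_PiM_cong) auto
      with RS show ?thesis by (subst emeasure_density) auto
    qed
    finally show "emeasure (distr P (\<Pi>\<^sub>M k\<in>{..<Suc K}. borel) (dists (Suc K))) (Pi\<^sub>E {..<Suc K} A) =
      emeasure (density (\<Pi>\<^sub>M k\<in>{..<Suc K}. lborel) (dists_density area_rate (Suc K))) (Pi\<^sub>E {..<Suc K} A)" .
  qed (simp cong: sets_PiM_cong)
qed

end

section \<open>The mmWave network\<close>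

lemma sum_1_2: "(\<Sum>n=1..2::nat. f n) = f 1 + f 2"
  by (simp add: numeral_2_eq_2)

text \<open>Independence of the generated algebras makes the joint law the product law. The second
  variable \<omega>' acts as an independent sample, over which \<open>Z\<close> is averaged while
  \<open>Y\<close> stays frozen.\<close>

lemma (in prob_space) indep_set_nn_integral_iterated:
  assumes Y [measurable]: "random_variable S Y" and Z [measurable]: "random_variable T Z"
    and ind: "indep_set (sets (vimage_algebra (space M) Y S)) (sets (vimage_algebra (space M) Z T))"
    and f [measurable]: "f \<in> borel_measurable (S \<Otimes>\<^sub>M T)"
  shows "(\<integral>\<^sup>+ \<omega>. f (Y \<omega>, Z \<omega>) \<partial>M) = (\<integral>\<^sup>+ \<omega>. (\<integral>\<^sup>+ \<omega>'. f (Y \<omega>, Z \<omega>') \<partial>M) \<partial>M)"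
proof -
  interpret Y: prob_space "distr M S Y" by (rule prob_space_distr) fact
  interpret Z: prob_space "distr M T Z" by (rule prob_space_distr) fact
  have joint: "distr M S Y \<Otimes>\<^sub>M distr M T Z = distr M (S \<Otimes>\<^sub>M T) (\<lambda>\<omega>. (Y \<omega>, Z \<omega>))"
  proof (rule pair_measure_eqI)
    fix A B assume A: "A \<in> sets (distr M S Y)" and B: "B \<in> sets (distr M T Z)"
    have "emeasure (distr M (S \<Otimes>\<^sub>M T) (\<lambda>\<omega>. (Y \<omega>, Z \<omega>))) (A \<times> B) =
        emeasure M ((\<lambda>\<omega>. (Y \<omega>, Z \<omega>)) -` (A \<times> B) \<inter> space M)"
      using A B by (subst emeasure_distr) auto
    also have "(\<lambda>\<omega>. (Y \<omega>, Z \<omega>)) -` (A \<times> B) \<inter> space M = (Y -` A \<inter> space M) \<inter> (Z -` B \<inter> space M)"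
      by auto
    also have "emeasure M \<dots> = emeasure M (Y -` A \<inter> space M) * emeasure M (Z -` B \<inter> space M)"
      using indep_setD[OF ind in_vimage_algebra in_vimage_algebra, of A B] A B
      by (simp add: emeasure_eq_measure ennreal_mult)
    finally show "emeasure (distr M S Y) A * emeasure (distr M T Z) B =
        emeasure (distr M (S \<Otimes>\<^sub>M T) (\<lambda>\<omega>. (Y \<omega>, Z \<omega>))) (A \<times> B)"
      using A B by (simp add: emeasure_distr)
  qed (simp_all add: Y.sigma_finite_measure_axioms Z.sigma_finite_measure_axioms cong: sets_pair_measure_cong)
  have "(\<integral>\<^sup>+ \<omega>. f (Y \<omega>, Z \<omega>) \<partial>M) = (\<integral>\<^sup>+ p. f p \<partial>distr M (S \<Otimes>\<^sub>M T) (\<lambda>\<omega>. (Y \<omega>, Z \<omega>)))"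
    by (subst nn_integral_distr) auto
  also have "\<dots> = (\<integral>\<^sup>+ p. f p \<partial>(distr M S Y \<Otimes>\<^sub>M distr M T Z))"
    by (simp add: joint)
  also have "\<dots> = (\<integral>\<^sup>+ y. (\<integral>\<^sup>+ z. f (y, z) \<partial>distr M T Z) \<partial>distr M S Y)"
    by (subst Z.nn_integral_fst) auto
  also have "\<dots> = (\<integral>\<^sup>+ \<omega>. (\<integral>\<^sup>+ z. f (Y \<omega>, z) \<partial>distr M T Z) \<partial>M)"
    by (subst nn_integral_distr) auto
  also have "\<dots> = (\<integral>\<^sup>+ \<omega>. (\<integral>\<^sup>+ \<omega>'. f (Y \<omega>, Z \<omega>') \<partial>M) \<partial>M)"
    using measurable_space[OF Y] by (intro nn_integral_cong) (subst nn_integral_distr, auto)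
  finally show ?thesis .
qed

text \<open>The version for events says that two weighted laws of the distance vector coincide;
  hence they integrate every nonnegative \<open>h\<close> alike.\<close>

lemma (in marked_poisson) spatial_markov_fun:
  assumes [measurable]: "\<And>b. (\<lambda>x. \<phi> x b) \<in> borel_measurable borel"
    and h [measurable]: "h \<in> borel_measurable (\<Pi>\<^sub>M k\<in>{..<K}. borel)"
  shows "(\<integral>\<^sup>+ \<omega>. h (dists K \<omega>) * nexp (total (cutoff (last_norm K \<omega>) \<phi>) \<omega>) \<partial>P) =
    (\<integral>\<^sup>+ \<omega>. h (dists K \<omega>) * nexp (laplace_exponent (cutoff (last_norm K \<omega>) \<phi>)) \<partial>P)"
proof -
  let ?R = "\<Pi>\<^sub>M k\<in>{..<K}. borel :: real measure"
  define \<mu> where "\<mu> f = distr (density P (\<lambda>\<omega>. nexp (f \<omega>))) ?R (dists K)" for f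
  have int: "(\<integral>\<^sup>+ r. h r \<partial>\<mu> f) = (\<integral>\<^sup>+ \<omega>. h (dists K \<omega>) * nexp (f \<omega>) \<partial>P)"
    if [measurable]: "f \<in> borel_measurable P" "h \<in> borel_measurable ?R" for f h
    unfolding \<mu>_def
    by (subst nn_integral_distr, simp, simp, subst nn_integral_density) (auto simp: mult.commute)
  have "\<mu> (\<lambda>\<omega>. total (cutoff (last_norm K \<omega>) \<phi>) \<omega>) = \<mu> (\<lambda>\<omega>. laplace_exponent (cutoff (last_norm K \<omega>) \<phi>))"
  proof (rule measure_eqI)
    fix A assume "A \<in> sets (\<mu> (\<lambda>\<omega>. total (cutoff (last_norm K \<omega>) \<phi>) \<omega>))"
    then have A [measurable]: "A \<in> sets ?R" by (simp add: \<mu>_def)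
    have "emeasure (\<mu> f) A = (\<integral>\<^sup>+ \<omega>. indicator {\<omega> \<in> space P. dists K \<omega> \<in> A} \<omega> * nexp (f \<omega>) \<partial>P)"
      if f: "f \<in> borel_measurable P" for f
    proof -
      have "emeasure (\<mu> f) A = (\<integral>\<^sup>+ r. indicator A r \<partial>\<mu> f)"
        by (rule nn_integral_indicator[symmetric]) (simp add: \<mu>_def)
      also have "\<dots> = (\<integral>\<^sup>+ \<omega>. indicator A (dists K \<omega>) * nexp (f \<omega>) \<partial>P)"
        by (rule int[OF f]) simp
      finally show ?thesis
        by (simp add: indicator_def cong: nn_integral_cong)
    qed
    then show "emeasure (\<mu> (\<lambda>\<omega>. total (cutoff (last_norm K \<omega>) \<phi>) \<omega>)) A =
        emeasure (\<mu> (\<lambda>\<omega>. laplace_exponent (cutoff (last_norm K \<omega>) \<phi>))) A"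
      by (simp add: spatial_markov[OF assms(1) A])
  qed (simp add: \<mu>_def)
  then have "(\<integral>\<^sup>+ r. h r \<partial>\<mu> (\<lambda>\<omega>. total (cutoff (last_norm K \<omega>) \<phi>) \<omega>)) =
      (\<integral>\<^sup>+ r. h r \<partial>\<mu> (\<lambda>\<omega>. laplace_exponent (cutoff (last_norm K \<omega>) \<phi>)))"
    by simp
  then show ?thesis by (simp add: int)
qed

section \<open>Network functions treated uniformly in the mark\<close>

definition mark_prob :: "network \<Rightarrow> bool \<Rightarrow> real \<Rightarrow> real" where
  "mark_prob \<N> b x = (if b then los_prob \<N> x else 1 - los_prob \<N> x)"

definition intensity :: "network \<Rightarrow> bool \<Rightarrow> (real^2) measure" where
  "intensity \<N> b = density lborel (\<lambda>x. ennreal (ap_density \<N> * mark_prob \<N> b (norm x)))"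

definition path_gain :: "network \<Rightarrow> bool \<Rightarrow> real \<Rightarrow> real" where
  "path_gain \<N> b x = (if b then intercept_los \<N> * x powr (- ple_los \<N>) else intercept_nlos \<N> * x powr (- ple_nlos \<N>))"

definition gain_laplace :: "network \<Rightarrow> real \<Rightarrow> bool \<Rightarrow> real \<Rightarrow> real" where
  "gain_laplace \<N> s b x = (\<Sum>n=1..2. gain_weight \<N> n * exp (- (s * (gain_value \<N> n * path_gain \<N> b x))))"

text \<open>Averaging the gain of one interferer turns \<open>exp (- s * G * path_gain)\<close> into \<open>gain_laplace\<close>;
  its negative logarithm is the weight of the point in the Laplace functional.\<close>

definition interferer_weight :: "network \<Rightarrow> real \<Rightarrow> real^2 \<Rightarrow> bool \<Rightarrow> ennreal" where
  "interferer_weight \<N> s x b = ennreal (- ln (gain_laplace \<N> s b (norm x)))"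

definition signal :: "network \<Rightarrow> (nat \<Rightarrow> real) \<Rightarrow> real" where
  "signal \<N> r = (\<Sum>k<num_serving \<N>. main_gain \<N> * intercept_los \<N> * r k powr (- ple_los \<N>))"

lemma measurable_los_prob [measurable]: "los_prob \<N> \<in> borel_measurable borel"
  unfolding los_prob_def by measurable

lemma measurable_mark_prob [measurable]: "mark_prob \<N> b \<in> borel_measurable borel"
  unfolding mark_prob_def by measurable

lemma measurable_path_gain [measurable]: "path_gain \<N> b \<in> borel_measurable borel"
  unfolding path_gain_def by measurable

lemma measurable_gain_laplace [measurable]: "gain_laplace \<N> s b \<in> borel_measurable borel"
  unfolding gain_laplace_def by measurable

lemma measurable_interferer_weight [measurable]: "(\<lambda>x. interferer_weight \<N> s x b) \<in> borel_measurable borel"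
  unfolding interferer_weight_def by measurable

lemma measurable_signal [measurable]: "signal \<N> \<in> borel_measurable (\<Pi>\<^sub>M k\<in>{..<num_serving \<N>}. borel)"
  unfolding signal_def
  by (intro borel_measurable_sum borel_measurable_times borel_measurable_const
      powr_real_measurable measurable_PiM_component)

locale mmwave_network =
  fixes \<N> :: network and P :: "'w measure" and X :: "nat \<Rightarrow> 'w \<Rightarrow> real^2"
    and los :: "nat \<Rightarrow> 'w \<Rightarrow> bool" and G :: "nat \<Rightarrow> 'w \<Rightarrow> real"
  assumes valid: "valid_network \<N>" and model: "network_model \<N> P X los G"
begin

lemma params:
  "ap_density \<N> > 0" "num_serving \<N> \<ge> 1" "blockage \<N> > 0" "intercept_los \<N> > 0" "intercept_nlos \<N> > 0"
  "main_gain \<N> > 0" "side_gain \<N> > 0" "noise_power \<N> > 0"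
  using valid by (simp_all add: valid_network_def)

lemma gain_weight_nonneg: "0 \<le> gain_weight \<N> n"
  using valid by (simp add: gain_weight_def valid_network_def divide_simps)

lemma gain_weight_1_pos: "0 < gain_weight \<N> 1"
  using valid by (simp add: gain_weight_def valid_network_def)

lemma gain_weight_sum: "gain_weight \<N> 1 + gain_weight \<N> 2 = 1"
  by (simp add: gain_weight_def)

lemma gain_value_pos: "0 < gain_value \<N> n"
  using params by (simp add: gain_value_def)

lemma path_gain_nonneg: "0 \<le> path_gain \<N> b x"
  using params by (simp add: path_gain_def)

lemma los_prob_bounds: "0 \<le> los_prob \<N> x" "0 \<le> x \<Longrightarrow> los_prob \<N> x \<le> 1"
  using params by (simp_all add: los_prob_def)

lemma mark_prob_nonneg: "0 \<le> x \<Longrightarrow> 0 \<le> mark_prob \<N> b x"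
  using los_prob_bounds[of x] by (simp add: mark_prob_def)

text \<open>Strict positivity, which the logarithm in \<open>interferer_weight\<close> requires,
  comes from the main lobe: its probability is positive, whereas that of the side lobe is 0 for
  beamwidth \<open>2 * pi\<close>.\<close>

lemma gain_laplace_pos: "0 < gain_laplace \<N> s b x"
  unfolding gain_laplace_def sum_1_2
  using gain_weight_1_pos gain_weight_nonneg by (intro add_pos_nonneg) simp_all

lemma one_minus_gain_laplace:
  "1 - gain_laplace \<N> s b x =
    (\<Sum>n=1..2. gain_weight \<N> n * (1 - exp (- (s * (gain_value \<N> n * path_gain \<N> b x)))))"
  using gain_weight_sum unfolding gain_laplace_def sum_1_2 by (simp add: right_diff_distrib)

lemma gain_laplace_le_1:
  assumes "0 \<le> s"
  shows "gain_laplace \<N> s b x \<le> 1"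
proof -
  have "0 \<le> 1 - gain_laplace \<N> s b x"
    unfolding one_minus_gain_laplace
    using assms gain_weight_nonneg path_gain_nonneg less_imp_le[OF gain_value_pos]
    by (intro sum_nonneg mult_nonneg_nonneg) simp_all
  then show ?thesis by simp
qed

lemma nexp_interferer_weight:
  assumes "0 \<le> s"
  shows "nexp (interferer_weight \<N> s x b) = ennreal (gain_laplace \<N> s b (norm x))"
  using gain_laplace_pos gain_laplace_le_1[OF assms]
  by (simp add: interferer_weight_def nexp_ennreal ln_le_zero_iff)

sublocale prob_space P
  using model by (simp add: network_model_def)

sublocale planar_poisson P X los "intensity \<N>" "ap_density \<N>"
proof (intro planar_poisson.intro marked_poisson.intro marked_poisson_axioms.intro planar_poisson_axioms.intro)
  show "prob_space P" by (rule prob_space_axioms)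
  show "X i \<in> borel_measurable P" "los i \<in> measurable P (count_space UNIV)" for i
    using model by (simp_all add: network_model_def)
  show "norm (X i \<omega>) \<le> norm (X (Suc i) \<omega>)" if "\<omega> \<in> space P" for i \<omega>
    using model that by (simp add: network_model_def)
  show "sets (intensity \<N> b) = sets borel" for b
    by (simp add: intensity_def)
  show "sigma_finite_measure (intensity \<N> b)" for b
    unfolding intensity_def
    by (subst sigma_finite_measure.sigma_finite_iff_density_finite[OF sigma_finite_lborel]) auto
  show "poisson_point_process P (intensity \<N> b) (point_count X (\<lambda>i \<omega>. los i \<omega> = b))" for b
    using model by (cases b) (simp_all add: network_model_def intensity_def mark_prob_def)
  show "indep_point_processes P (sets borel) (point_count X (\<lambda>i \<omega>. los i \<omega> = True))
      (point_count X (\<lambda>i \<omega>. los i \<omega> = False))"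
    using model by (simp add: network_model_def)
  show "0 < ap_density \<N>" by (rule params)
  show "poisson_point_process P (density lborel (\<lambda>_. ennreal (ap_density \<N>))) (point_count X (\<lambda>_ _. True))"
    using model by (simp add: network_model_def)
  show "(\<Sum>b\<in>UNIV. emeasure (intensity \<N> b) B) = ennreal (ap_density \<N>) * emeasure lborel B"
    if [measurable]: "B \<in> sets borel" for B
  proof -
    have "(\<Sum>b\<in>UNIV. emeasure (intensity \<N> b) B) =
        (\<integral>\<^sup>+ x. (\<Sum>b\<in>UNIV. ennreal (ap_density \<N> * mark_prob \<N> b (norm x)) * indicator B x) \<partial>lborel)"
      unfolding intensity_def by (subst nn_integral_sum) (auto simp: emeasure_density)
    also have "\<dots> = (\<integral>\<^sup>+ x. ennreal (ap_density \<N>) * indicator B x \<partial>lborel)"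
    proof (intro nn_integral_cong)
      fix x :: "real^2"
      have "ennreal (ap_density \<N> * mark_prob \<N> True (norm x)) + ennreal (ap_density \<N> * mark_prob \<N> False (norm x)) =
          ennreal (ap_density \<N> * mark_prob \<N> True (norm x) + ap_density \<N> * mark_prob \<N> False (norm x))"
        using params mark_prob_nonneg by (intro ennreal_plus[symmetric]) auto
      also have "\<dots> = ennreal (ap_density \<N>)"
        by (simp add: mark_prob_def right_diff_distrib)
      finally show "(\<Sum>b\<in>UNIV. ennreal (ap_density \<N> * mark_prob \<N> b (norm x)) * indicator B x) =
          ennreal (ap_density \<N>) * indicator B x"
        by (simp add: UNIV_bool add.commute split: split_indicator)
    qed
    finally show ?thesis by (simp add: nn_integral_cmult_indicator)
  qed
qed

lemma G_measurable [measurable]: "G i \<in> borel_measurable P"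
  using model by (simp add: network_model_def)

lemma nn_integral_gain:
  fixes f :: "real \<Rightarrow> ennreal"
  assumes [measurable]: "f \<in> borel_measurable borel"
  shows "(\<integral>\<^sup>+ \<omega>. f (G i \<omega>) \<partial>P) = (\<Sum>n=1..2. ennreal (gain_weight \<N> n) * f (gain_value \<N> n))"
proof -
  let ?V = "{gain_value \<N> 1, gain_value \<N> 2}"
  have law: "prob {\<omega> \<in> space P. G i \<omega> \<in> A} = (\<Sum>n=1..2. gain_weight \<N> n * indicator A (gain_value \<N> n))"
    if "A \<in> sets borel" for A
    using model that by (simp add: network_model_def)
  have "prob {\<omega> \<in> space P. G i \<omega> \<in> ?V} = 1"
    using gain_weight_sum by (subst law, simp, unfold sum_1_2) simp
  then have "AE \<omega> in P. G i \<omega> \<in> ?V"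
    by (subst (asm) prob_Collect_eq_1) simp_all
  then have "(\<integral>\<^sup>+ \<omega>. f (G i \<omega>) \<partial>P) = (\<integral>\<^sup>+ \<omega>. (\<Sum>v\<in>?V. f v * indicator {\<omega> \<in> space P. G i \<omega> \<in> {v}} \<omega>) \<partial>P)"
    using AE_space[of P] by (intro nn_integral_cong_AE, eventually_elim) (auto simp: indicator_def)
  also have "\<dots> = (\<Sum>v\<in>?V. f v * emeasure P {\<omega> \<in> space P. G i \<omega> \<in> {v}})"
    by (subst nn_integral_sum, measurable, intro sum.cong refl nn_integral_cmult_indicator) measurable
  also have "\<dots> = (\<Sum>v\<in>?V. f v * ennreal (\<Sum>n=1..2. gain_weight \<N> n * indicator {v} (gain_value \<N> n)))"
    unfolding emeasure_eq_measure by (subst law) auto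
  \<comment> \<open>If the two gains coincide, \<open>?V\<close> is a singleton that carries both
    probabilities.\<close>
  also have "\<dots> = (\<Sum>n=1..2. ennreal (gain_weight \<N> n) * f (gain_value \<N> n))"
  proof (cases "gain_value \<N> 1 = gain_value \<N> 2")
    case True
    have "ennreal (gain_weight \<N> 1) * f (gain_value \<N> 2) + ennreal (gain_weight \<N> 2) * f (gain_value \<N> 2) = f (gain_value \<N> 2)"
      using gain_weight_nonneg gain_weight_sum by (simp flip: distrib_right ennreal_plus)
    then show ?thesis using True gain_weight_sum unfolding sum_1_2 by (simp add: mult.commute)
  next
    case False
    then show ?thesis unfolding sum_1_2 by (simp add: mult.commute)
  qed
  finally show ?thesis .
qed

lemma nn_integral_nexp_gain:
  assumes "0 \<le> s"
  shows "(\<integral>\<^sup>+ \<omega>. nexp (ennreal (s * (G i \<omega> * path_gain \<N> b (norm x)))) \<partial>P) = nexp (interferer_weight \<N> s x b)"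
proof -
  have "(\<integral>\<^sup>+ \<omega>. nexp (ennreal (s * (G i \<omega> * path_gain \<N> b (norm x)))) \<partial>P) =
      (\<Sum>n=1..2. ennreal (gain_weight \<N> n) * nexp (ennreal (s * (gain_value \<N> n * path_gain \<N> b (norm x)))))"
    by (rule nn_integral_gain) measurable
  also have "\<dots> = ennreal (gain_laplace \<N> s b (norm x))"
    using assms gain_weight_nonneg less_imp_le[OF gain_value_pos] path_gain_nonneg
    by (simp add: sum_1_2 gain_laplace_def nexp_ennreal flip: ennreal_mult ennreal_plus)
  finally show ?thesis by (simp add: nexp_interferer_weight assms)
qed

abbreviation marks_space :: "(nat \<Rightarrow> (real^2) \<times> bool) measure" where
  "marks_space \<equiv> \<Pi>\<^sub>M i\<in>UNIV. borel \<Otimes>\<^sub>M count_space UNIV"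

definition marks :: "'w \<Rightarrow> nat \<Rightarrow> (real^2) \<times> bool" where
  "marks \<omega> = (\<lambda>i. (X i \<omega>, los i \<omega>))"

lemma marks_measurable [measurable]: "marks \<in> measurable P marks_space"
  unfolding marks_def[abs_def]
  by (intro measurable_PiM_single') (auto simp: space_pair_measure)

lemma gains_measurable: "(\<lambda>\<omega> i. G i \<omega>) \<in> measurable P (\<Pi>\<^sub>M i\<in>UNIV. borel)"
  by (intro measurable_PiM_single') simp_all

lemma indep_marks_gains:
  "indep_set (sets (vimage_algebra (space P) marks marks_space))
    (sets (vimage_algebra (space P) (\<lambda>\<omega> i. G i \<omega>) (\<Pi>\<^sub>M i\<in>UNIV. borel)))"
  using model by (simp add: network_model_def marks_def[abs_def])

lemma indep_gains: "indep_vars (\<lambda>_. borel) G UNIV"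
  using model by (simp add: network_model_def)

text \<open>With the configuration frozen, the gains are independent and each averages to the weight
  of its point. The radius \<open>D\<close> and the factor \<open>h\<close> may depend on the
  configuration but not on the gains, so one statement serves both fixed and random serving
  distances.\<close>

lemma nn_integral_average_gains:
  assumes h [measurable]: "h \<in> borel_measurable marks_space" and D [measurable]: "D \<in> borel_measurable marks_space"
    and s: "0 \<le> s"
  shows "(\<integral>\<^sup>+ \<omega>. h (marks \<omega>) * nexp (total (cutoff (D (marks \<omega>)) (interferer_weight \<N> s)) \<omega>) \<partial>P) =
    (\<integral>\<^sup>+ \<omega>. h (marks \<omega>) * nexp (\<Sum>i. if D (marks \<omega>) < norm (X i \<omega>)
      then ennreal (s * (G i \<omega> * path_gain \<N> (los i \<omega>) (norm (X i \<omega>)))) else 0) \<partial>P)"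
proof -
  define t where "t m g i = (if D m < norm (fst (m i)) then ennreal (s * (g * path_gain \<N> (snd (m i)) (norm (fst (m i))))) else 0)"
    for m :: "nat \<Rightarrow> (real^2) \<times> bool" and g :: real and i :: nat
  let ?MG = "marks_space \<Otimes>\<^sub>M (\<Pi>\<^sub>M i\<in>UNIV. borel :: real measure)"
  have comp: "(\<lambda>p. fst p i) \<in> measurable ?MG (borel \<Otimes>\<^sub>M count_space UNIV)" "(\<lambda>p. snd p i) \<in> borel_measurable ?MG" for i
    by (rule measurable_compose[OF measurable_fst measurable_component_singleton], simp)
      (rule measurable_compose[OF measurable_snd measurable_component_singleton], simp)
  have [measurable]: "(\<lambda>p. fst (fst p i)) \<in> borel_measurable ?MG"
      "(\<lambda>p. snd (fst p i)) \<in> measurable ?MG (count_space UNIV)" "(\<lambda>p. snd p i) \<in> borel_measurable ?MG" for i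
    using measurable_compose[OF comp(1) measurable_fst] measurable_compose[OF comp(1) measurable_snd] comp(2)
    by auto
  \<comment> \<open>Splitting on the mark writes the term through two measurable functions of the
    location and the gain.\<close>
  have t_eq: "t m g i = (if D m < norm (fst (m i)) then
      if snd (m i) then ennreal (s * (g * path_gain \<N> True (norm (fst (m i)))))
      else ennreal (s * (g * path_gain \<N> False (norm (fst (m i))))) else 0)" for m g i
    by (simp add: t_def)
  have "(\<lambda>p. t (fst p) (snd p i) i) \<in> borel_measurable ?MG" for i
    unfolding t_eq by measurable
  note borel_measurable_suminf_order[OF this, measurable]
  have meas: "(\<lambda>p. h (fst p) * nexp (\<Sum>i. t (fst p) (snd p i) i)) \<in> borel_measurable ?MG"
    by measurable
  have inner: "(\<integral>\<^sup>+ \<omega>'. nexp (\<Sum>i. t (marks \<omega>) (G i \<omega>') i) \<partial>P) =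
      nexp (total (cutoff (D (marks \<omega>)) (interferer_weight \<N> s)) \<omega>)" for \<omega>
  proof -
    let ?m = "marks \<omega>"
    have [measurable]: "(\<lambda>g. t ?m g i) \<in> borel_measurable borel" for i
      unfolding t_def by measurable
    have ind: "indep_vars (\<lambda>_. borel) (\<lambda>i \<omega>'. nexp (t ?m (G i \<omega>') i)) {..<n}" for n
    proof -
      have "indep_vars (\<lambda>_. borel) G {..<n}"
        using indep_gains by (rule indep_vars_subset) simp
      from indep_vars_compose2[OF this, of "\<lambda>i g. nexp (t ?m g i)"] show ?thesis by simp
    qed
    have single: "(\<integral>\<^sup>+ \<omega>'. nexp (t ?m (G i \<omega>') i) \<partial>P) =
        nexp (cutoff (D ?m) (interferer_weight \<N> s) (X i \<omega>) (los i \<omega>))" for i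
      using nn_integral_nexp_gain[OF s, of i "los i \<omega>" "X i \<omega>"]
      by (simp add: t_def cutoff_def marks_def emeasure_space_1)
    \<comment> \<open>Partial products are bounded by 1, so the expectation of the infinite product
      is the limit of the factored finite ones.\<close>
    have "(\<lambda>n. \<integral>\<^sup>+ \<omega>'. (\<Prod>i<n. nexp (t ?m (G i \<omega>') i)) \<partial>P) \<longlonglongrightarrow> (\<integral>\<^sup>+ \<omega>'. nexp (\<Sum>i. t ?m (G i \<omega>') i) \<partial>P)"
    proof (rule nn_integral_dominated_convergence[where w = "\<lambda>_. 1"])
      show "AE \<omega>' in P. (\<Prod>i<n. nexp (t ?m (G i \<omega>') i)) \<le> 1" for n
        by (auto simp flip: nexp_sum)
      show "AE \<omega>' in P. (\<lambda>n. \<Prod>i<n. nexp (t ?m (G i \<omega>') i)) \<longlonglongrightarrow> nexp (\<Sum>i. t ?m (G i \<omega>') i)"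
        by (simp add: tendsto_prod_nexp)
    qed (auto simp: emeasure_space_1)
    moreover have "(\<integral>\<^sup>+ \<omega>'. (\<Prod>i<n. nexp (t ?m (G i \<omega>') i)) \<partial>P) =
        (\<Prod>i<n. nexp (cutoff (D ?m) (interferer_weight \<N> s) (X i \<omega>) (los i \<omega>)))" for n
      by (subst indep_vars_nn_integral[OF _ ind]) (simp_all add: single)
    ultimately show ?thesis
      using tendsto_prod_nexp[of "\<lambda>i. cutoff (D ?m) (interferer_weight \<N> s) (X i \<omega>) (los i \<omega>)"]
      unfolding total_def using LIMSEQ_unique by simp
  qed
  have "(\<integral>\<^sup>+ \<omega>. h (marks \<omega>) * nexp (\<Sum>i. t (marks \<omega>) (G i \<omega>) i) \<partial>P) =
      (\<integral>\<^sup>+ \<omega>. (\<integral>\<^sup>+ \<omega>'. h (marks \<omega>) * nexp (\<Sum>i. t (marks \<omega>) (G i \<omega>') i) \<partial>P) \<partial>P)"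
    using indep_set_nn_integral_iterated[OF marks_measurable gains_measurable indep_marks_gains meas]
    by simp
  also have "\<dots> = (\<integral>\<^sup>+ \<omega>. h (marks \<omega>) * nexp (total (cutoff (D (marks \<omega>)) (interferer_weight \<N> s)) \<omega>) \<partial>P)"
  proof (intro nn_integral_cong)
    fix \<omega>
    have "(\<lambda>\<omega>'. nexp (\<Sum>i. t (marks \<omega>) (G i \<omega>') i)) \<in> borel_measurable P"
      unfolding t_def by measurable
    then show "(\<integral>\<^sup>+ \<omega>'. h (marks \<omega>) * nexp (\<Sum>i. t (marks \<omega>) (G i \<omega>') i) \<partial>P) =
        h (marks \<omega>) * nexp (total (cutoff (D (marks \<omega>)) (interferer_weight \<N> s)) \<omega>)"
      by (simp add: nn_integral_cmult inner)
  qed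
  finally show ?thesis unfolding t_def marks_def fst_conv snd_conv by (rule sym)
qed

end

definition W_mark :: "network \<Rightarrow> bool \<Rightarrow> real \<Rightarrow> real \<Rightarrow> ennreal" where
  "W_mark \<N> b d s = ennreal (2 * pi * ap_density \<N>) *
     (\<Sum>n=1..2. ennreal (gain_weight \<N> n) *
        (\<integral>\<^sup>+ x. (if d < x then ennreal ((1 - exp (- (s * (gain_value \<N> n * path_gain \<N> b x)))) * mark_prob \<N> b x * x) else 0) \<partial>lborel))"

lemma W_los_eq: "W_los \<N> d s = W_mark \<N> True d s"
  unfolding W_los_def W_mark_def path_gain_def mark_prob_def
  by (intro arg_cong2[where f = "(*)"] refl sum.cong nn_integral_cong) (auto simp: mult.assoc split: split_indicator)

lemma W_nlos_eq: "W_nlos \<N> d s = W_mark \<N> False d s"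
  unfolding W_nlos_def W_mark_def path_gain_def mark_prob_def
  by (intro arg_cong2[where f = "(*)"] refl sum.cong nn_integral_cong) (auto simp: mult.assoc split: split_indicator)

lemma measurable_W_mark [measurable]:
  "(\<lambda>(d, s). W_mark \<N> b d s) \<in> borel_measurable (borel \<Otimes>\<^sub>M borel)"
  unfolding W_mark_def split_beta by measurable

definition capacity_kernel :: "network \<Rightarrow> (nat \<Rightarrow> real) \<Rightarrow> real \<Rightarrow> ennreal" where
  "capacity_kernel \<N> r s = ennreal (exp (- s * noise_power \<N>) / s * (1 - exp (- s * signal \<N> r)))"

lemma measurable_capacity_kernel [measurable]:
  "(\<lambda>(r, s). capacity_kernel \<N> r s) \<in> borel_measurable ((\<Pi>\<^sub>M k\<in>{..<num_serving \<N>}. borel) \<Otimes>\<^sub>M borel)"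
  unfolding capacity_kernel_def split_beta by measurable

section \<open>Interference and capacity\<close>

context mmwave_network begin

abbreviation K :: nat where "K \<equiv> num_serving \<N>"

abbreviation TI :: "real \<Rightarrow> 'w \<Rightarrow> ennreal" where "TI \<equiv> total_interference \<N> X los G"

definition exponent :: "real \<Rightarrow> real \<Rightarrow> ennreal" where
  "exponent d s = W_los \<N> d s + W_nlos \<N> d s"

lemma measurable_exponent [measurable]:
  "(\<lambda>(d, s). exponent d s) \<in> borel_measurable (borel \<Otimes>\<^sub>M borel)"
  unfolding exponent_def W_los_eq W_nlos_eq by measurable

lemma signal_nonneg: "0 \<le> signal \<N> r"
  unfolding signal_def using params by (intro sum_nonneg mult_nonneg_nonneg) auto

lemma last_dist_eq_final: "last_dist \<N> r = final K r"
  using params by (simp add: last_dist_def final_def)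

lemma serving_dists_eq: "serving_dists \<N> X = dists K"
  by (simp add: serving_dists_def dists_def fun_eq_iff)

text \<open>Polar coordinates supply the factor \<open>2 * pi * x\<close>, and since the gain
  weights add up to 1, \<open>1 - gain_laplace\<close> splits into the two terms of the integrand of
  \<open>W_mark\<close>.\<close>

lemma laplace_exponent_mark:
  assumes d: "0 \<le> d" and s: "0 \<le> s"
  shows "(\<integral>\<^sup>+ x. 1 - nexp (cutoff d (interferer_weight \<N> s) x b) \<partial>intensity \<N> b) = W_mark \<N> b d s"
proof -
  define J where "J n x = (1 - exp (- (s * (gain_value \<N> n * path_gain \<N> b x)))) * mark_prob \<N> b x * x" for n x
  have [measurable]: "J n \<in> borel_measurable borel" for n unfolding J_def by measurable
  have J_nonneg: "0 \<le> J n x" if "0 \<le> x" for n x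
    unfolding J_def using that s mark_prob_nonneg[OF that] less_imp_le[OF gain_value_pos] path_gain_nonneg
    by (intro mult_nonneg_nonneg) auto
  have "(\<integral>\<^sup>+ x. 1 - nexp (cutoff d (interferer_weight \<N> s) x b) \<partial>intensity \<N> b) =
      (\<integral>\<^sup>+ (x::real^2). ennreal (ap_density \<N> * mark_prob \<N> b (norm x)) *
        (if d < norm x then ennreal (1 - gain_laplace \<N> s b (norm x)) else 0) \<partial>lborel)"
  proof -
    have "1 - nexp (cutoff d (interferer_weight \<N> s) x b) =
        (if d < norm x then ennreal (1 - gain_laplace \<N> s b (norm x)) else 0)" for x
      using less_imp_le[OF gain_laplace_pos[of s b "norm x"]]
      by (simp add: cutoff_def nexp_interferer_weight[OF s] ennreal_minus flip: ennreal_1)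
    then show ?thesis
      unfolding intensity_def by (subst nn_integral_density) auto
  qed
  also have "\<dots> = (\<integral>\<^sup>+ x\<in>{0<..}. ennreal (2 * pi * x) * (ennreal (ap_density \<N> * mark_prob \<N> b x) *
        (if d < x then ennreal (1 - gain_laplace \<N> s b x) else 0)) \<partial>lborel)"
    by (rule nn_integral_norm_plane) measurable
  also have "\<dots> = (\<integral>\<^sup>+ x. ennreal (2 * pi * ap_density \<N>) *
      (\<Sum>n=1..2. ennreal (gain_weight \<N> n) * (if d < x then ennreal (J n x) else 0)) \<partial>lborel)"
  proof (intro nn_integral_cong)
    fix x :: real
    show "ennreal (2 * pi * x) * (ennreal (ap_density \<N> * mark_prob \<N> b x) *
        (if d < x then ennreal (1 - gain_laplace \<N> s b x) else 0)) * indicator {0<..} x =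
      ennreal (2 * pi * ap_density \<N>) *
      (\<Sum>n=1..2. ennreal (gain_weight \<N> n) * (if d < x then ennreal (J n x) else 0))"
    proof (cases "d < x")
      case True
      then have x: "0 < x" using d by simp
      have "ennreal (2 * pi * x) * (ennreal (ap_density \<N> * mark_prob \<N> b x) * ennreal (1 - gain_laplace \<N> s b x)) =
          ennreal (2 * pi * x * (ap_density \<N> * mark_prob \<N> b x * (1 - gain_laplace \<N> s b x)))"
        using x params mark_prob_nonneg[of x b] by (simp add: ennreal_mult'[symmetric])
      also have "2 * pi * x * (ap_density \<N> * mark_prob \<N> b x * (1 - gain_laplace \<N> s b x)) =
          2 * pi * ap_density \<N> * (gain_weight \<N> 1 * J 1 x + gain_weight \<N> 2 * J 2 x)"
        unfolding one_minus_gain_laplace sum_1_2 J_def by (simp add: algebra_simps)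
      also have "ennreal \<dots> = ennreal (2 * pi * ap_density \<N>) *
          (ennreal (gain_weight \<N> 1) * ennreal (J 1 x) + ennreal (gain_weight \<N> 2) * ennreal (J 2 x))"
        using x params gain_weight_nonneg J_nonneg
        by (simp add: ennreal_mult ennreal_plus)
      finally show ?thesis using True x unfolding sum_1_2 by simp
    qed simp
  qed
  also have "\<dots> = W_mark \<N> b d s"
    unfolding W_mark_def J_def[symmetric]
    by (subst nn_integral_cmult, measurable, subst nn_integral_sum, measurable)
      (simp add: nn_integral_cmult)
  finally show ?thesis .
qed

lemma laplace_exponent_interferers:
  assumes "0 \<le> d" "0 \<le> s"
  shows "laplace_exponent (cutoff d (interferer_weight \<N> s)) = exponent d s"
  unfolding laplace_exponent_def exponent_def W_los_eq W_nlos_eq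
  by (simp add: UNIV_bool laplace_exponent_mark[OF assms] add.commute)

text \<open>Each point contributes to exactly one of the two interference sums, the one selected by
  its mark.\<close>

lemma total_interference_eq:
  "TI d \<omega> = (\<Sum>i. if d < norm (X i \<omega>) then ennreal (G i \<omega> * path_gain \<N> (los i \<omega>) (norm (X i \<omega>))) else 0)"
  unfolding total_interference_def interference_def
  by (subst suminf_add) (auto intro!: summableI suminf_cong simp: path_gain_def mult.assoc)

lemma nexp_total_interference:
  assumes "0 \<le> s"
  shows "nexp (ennreal s * TI d \<omega>) = nexp (\<Sum>i. if d < norm (X i \<omega>)
    then ennreal (s * (G i \<omega> * path_gain \<N> (los i \<omega>) (norm (X i \<omega>)))) else 0)"
  unfolding total_interference_eq ennreal_suminf_cmult[symmetric]
  using assms by (intro arg_cong[where f = nexp] suminf_cong) (simp add: ennreal_mult')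

lemma total_interference_measurable [measurable]:
  assumes [measurable]: "d \<in> borel_measurable P"
  shows "(\<lambda>\<omega>. TI (d \<omega>) \<omega>) \<in> borel_measurable P"
proof -
  have "(\<lambda>\<omega>. if d \<omega> < norm (X i \<omega>) then ennreal (G i \<omega> * path_gain \<N> (los i \<omega>) (norm (X i \<omega>))) else 0) =
    (\<lambda>\<omega>. if d \<omega> < norm (X i \<omega>) then
      if los i \<omega> then ennreal (G i \<omega> * path_gain \<N> True (norm (X i \<omega>)))
      else ennreal (G i \<omega> * path_gain \<N> False (norm (X i \<omega>))) else 0)" for i
    by (auto simp: fun_eq_iff)
  then have "(\<lambda>\<omega>. if d \<omega> < norm (X i \<omega>) then ennreal (G i \<omega> * path_gain \<N> (los i \<omega>) (norm (X i \<omega>))) else 0)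
      \<in> borel_measurable P" for i
    by simp
  then show ?thesis unfolding total_interference_eq by (rule borel_measurable_suminf_order)
qed

lemma nn_integral_interference_fixed:
  assumes "0 \<le> d" "0 \<le> s"
  shows "(\<integral>\<^sup>+ \<omega>. nexp (ennreal s * TI d \<omega>) \<partial>P) = nexp (exponent d s)"
  using nn_integral_average_gains[of "\<lambda>_. 1" "\<lambda>_. d" s] assms
    laplace_functional[of "cutoff d (interferer_weight \<N> s)"]
  by (simp add: nexp_total_interference laplace_exponent_interferers)

text \<open>The last serving distance is a function of the configuration alone, so the gains are
  averaged first; the spatial Markov property then replaces the remaining total by its
  exponent.\<close>

lemma nn_integral_interference_random:
  assumes h [measurable]: "h \<in> borel_measurable (\<Pi>\<^sub>M k\<in>{..<K}. borel)" and s: "0 \<le> s"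
  shows "(\<integral>\<^sup>+ \<omega>. h (dists K \<omega>) * nexp (ennreal s * TI (last_norm K \<omega>) \<omega>) \<partial>P) =
    (\<integral>\<^sup>+ \<omega>. h (dists K \<omega>) * nexp (exponent (last_norm K \<omega>) s) \<partial>P)"
proof -
  define q where "q m = (\<lambda>k\<in>{..<K}. norm (fst (m k)))" for m :: "nat \<Rightarrow> (real^2) \<times> bool"
  have q_marks: "q (marks \<omega>) = dists K \<omega>" for \<omega>
    by (simp add: q_def marks_def dists_def)
  have comp: "(\<lambda>m. m i) \<in> measurable marks_space (borel \<Otimes>\<^sub>M count_space UNIV)" for i
    by (rule measurable_component_singleton) simp
  have [measurable]: "q \<in> measurable marks_space (\<Pi>\<^sub>M k\<in>{..<K}. borel)"
    unfolding q_def
    by (intro measurable_restrict measurable_compose[OF measurable_compose[OF comp measurable_fst] borel_measurable_norm])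
  have "(\<integral>\<^sup>+ \<omega>. h (dists K \<omega>) * nexp (ennreal s * TI (last_norm K \<omega>) \<omega>) \<partial>P) =
      (\<integral>\<^sup>+ \<omega>. h (dists K \<omega>) * nexp (total (cutoff (last_norm K \<omega>) (interferer_weight \<N> s)) \<omega>) \<partial>P)"
    using nn_integral_average_gains[of "\<lambda>m. h (q m)" "\<lambda>m. final K (q m)" s] s
    by (simp add: q_marks nexp_total_interference last_norm_eq_final)
  also have "\<dots> = (\<integral>\<^sup>+ \<omega>. h (dists K \<omega>) * nexp (laplace_exponent (cutoff (last_norm K \<omega>) (interferer_weight \<N> s))) \<partial>P)"
    by (rule spatial_markov_fun) measurable
  finally show ?thesis by (simp add: laplace_exponent_interferers last_norm_nonneg s)
qed

lemma capacity_integral_eq: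
  "capacity_integral \<N> r = (\<integral>\<^sup>+ s\<in>{0<..}. capacity_kernel \<N> r s * nexp (exponent (final K r) s) \<partial>lborel)"
proof -
  have "(\<Prod>k<K. exp (- s * main_gain \<N> * intercept_los \<N> * r k powr (- ple_los \<N>))) = exp (- s * signal \<N> r)" for s
    by (simp add: signal_def exp_sum[symmetric] sum_distrib_left sum_negf mult.assoc)
  moreover have "ennreal (exp (- s * noise_power \<N>) / s * exp_minus w * (1 - exp (- s * signal \<N> r))) =
      capacity_kernel \<N> r s * nexp w" for s w
  proof -
    have "0 \<le> exp_minus w" by (simp add: exp_minus_def)
    then show ?thesis
      unfolding capacity_kernel_def nexp_def by (subst ennreal_mult''[symmetric]) (simp_all add: mult_ac)
  qed
  ultimately show ?thesis
    unfolding capacity_integral_def exponent_def last_dist_eq_final by simp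
qed

lemma measurable_capacity_integral [measurable]:
  "capacity_integral \<N> \<in> borel_measurable (\<Pi>\<^sub>M k\<in>{..<K}. borel)"
proof -
  have [measurable]: "(\<lambda>(r, s). exponent (final K r) s) \<in> borel_measurable ((\<Pi>\<^sub>M k\<in>{..<K}. borel) \<Otimes>\<^sub>M lborel)"
    by measurable
  show ?thesis
    unfolding capacity_integral_eq by measurable
qed

text \<open>The logarithm integral for interference plus noise, with the noise absorbed in the
  kernel. If the interference is infinite, both sides vanish: the SINR is 0 by convention, and
  \<open>nexp\<close> is 0 for every \<open>s > 0\<close>.\<close>

lemma log_sinr_eq:
  "ennreal (log 2 (1 + sinr \<N> X los G r \<omega>)) = ennreal (1 / ln 2) *
    (\<integral>\<^sup>+ s\<in>{0<..}. capacity_kernel \<N> r s * nexp (ennreal s * TI (final K r) \<omega>) \<partial>lborel)"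
proof (cases "TI (final K r) \<omega>")
  case (real a)
  have "(\<integral>\<^sup>+ s\<in>{0<..}. capacity_kernel \<N> r s * nexp (ennreal s * TI (final K r) \<omega>) \<partial>lborel) =
      (\<integral>\<^sup>+ s\<in>{0<..}. ennreal (exp (- s * (a + noise_power \<N>)) / s * (1 - exp (- s * signal \<N> r))) \<partial>lborel)"
  proof (intro nn_integral_cong)
    fix s :: real
    have "capacity_kernel \<N> r s * nexp (ennreal s * ennreal a) =
        ennreal (exp (- s * (a + noise_power \<N>)) / s * (1 - exp (- s * signal \<N> r)))" if "s > 0"
    proof -
      have "exp (- s * (a + noise_power \<N>)) = exp (- s * noise_power \<N>) * exp (- (s * a))"
        by (simp add: algebra_simps flip: exp_add)
      then show ?thesis
        using that real(1) unfolding capacity_kernel_def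
        by (simp add: nexp_ennreal mult_ac flip: ennreal_mult' ennreal_mult'')
    qed
    then show "capacity_kernel \<N> r s * nexp (ennreal s * TI (final K r) \<omega>) * indicator {0<..} s =
        ennreal (exp (- s * (a + noise_power \<N>)) / s * (1 - exp (- s * signal \<N> r))) * indicator {0<..} s"
      unfolding real(2) by (auto split: split_indicator)
  qed
  also have "\<dots> = ennreal (ln (1 + signal \<N> r / (a + noise_power \<N>)))"
    using real(1) params signal_nonneg by (intro nn_integral_frullani_ln) auto
  also have "ennreal (1 / ln 2) * \<dots> = ennreal (log 2 (1 + signal \<N> r / (a + noise_power \<N>)))"
    by (simp add: log_def ennreal_mult'[symmetric])
  finally show ?thesis
    using real by (simp add: sinr_def last_dist_eq_final signal_def)
next
  case top
  then have "(\<integral>\<^sup>+ s\<in>{0<..}. capacity_kernel \<N> r s * nexp (ennreal s * TI (final K r) \<omega>) \<partial>lborel) = (\<integral>\<^sup>+ s. 0 \<partial>(lborel :: real measure))"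
    by (intro nn_integral_cong) (auto simp: ennreal_mult_top split: split_indicator)
  with top show ?thesis by (simp add: sinr_def last_dist_eq_final)
qed

text \<open>Nonnegativity allows the expectation to be moved inside the integral over
  \<open>s\<close>, where only the Laplace transform of the interference remains.\<close>

lemma cond_capacity_eq:
  assumes "r \<in> dist_domain \<N>"
  shows "cond_capacity \<N> P X los G r = ennreal (1 / ln 2) * capacity_integral \<N> r"
proof -
  interpret pair_sigma_finite P lborel ..
  have d: "0 \<le> final K r"
    using assms params by (auto simp: dist_domain_def final_def less_imp_le)
  have r: "r \<in> space (\<Pi>\<^sub>M k\<in>{..<K}. borel)"
    using assms by (auto simp: dist_domain_def space_PiM PiE_def)
  have [measurable]: "capacity_kernel \<N> r \<in> borel_measurable borel"
    unfolding capacity_kernel_def by measurable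
  have "cond_capacity \<N> P X los G r = ennreal (1 / ln 2) *
      (\<integral>\<^sup>+ \<omega>. (\<integral>\<^sup>+ s. capacity_kernel \<N> r s * nexp (ennreal s * TI (final K r) \<omega>) * indicator {0<..} s \<partial>lborel) \<partial>P)"
    unfolding cond_capacity_def log_sinr_eq by (rule nn_integral_cmult) measurable
  also have "(\<integral>\<^sup>+ \<omega>. (\<integral>\<^sup>+ s. capacity_kernel \<N> r s * nexp (ennreal s * TI (final K r) \<omega>) * indicator {0<..} s \<partial>lborel) \<partial>P) =
      (\<integral>\<^sup>+ s. (\<integral>\<^sup>+ \<omega>. capacity_kernel \<N> r s * nexp (ennreal s * TI (final K r) \<omega>) * indicator {0<..} s \<partial>P) \<partial>lborel)"
    by (rule Fubini'[symmetric]) measurable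
  also have "\<dots> = capacity_integral \<N> r"
    unfolding capacity_integral_eq
  proof (intro nn_integral_cong)
    fix s :: real
    show "(\<integral>\<^sup>+ \<omega>. capacity_kernel \<N> r s * nexp (ennreal s * TI (final K r) \<omega>) * indicator {0<..} s \<partial>P) =
        capacity_kernel \<N> r s * nexp (exponent (final K r) s) * indicator {0<..} s"
      using nn_integral_interference_fixed[OF d, of s]
      by (cases "s > 0") (simp_all add: nn_integral_cmult)
  qed
  finally show ?thesis .
qed

lemma rate_eq: "rate \<N> X los G \<omega> = ennreal (1 / ln 2) *
    (\<integral>\<^sup>+ s\<in>{0<..}. capacity_kernel \<N> (dists K \<omega>) s * nexp (ennreal s * TI (last_norm K \<omega>) \<omega>) \<partial>lborel)"
  unfolding rate_def serving_dists_eq log_sinr_eq last_norm_eq_final ..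

lemma capacity_kernel_dists_measurable [measurable]:
  "(\<lambda>(\<omega>, s). capacity_kernel \<N> (dists K \<omega>) s) \<in> borel_measurable (P \<Otimes>\<^sub>M borel)"
  "(\<lambda>\<omega>. capacity_kernel \<N> (dists K \<omega>) s) \<in> borel_measurable P"
  "(\<lambda>r. capacity_kernel \<N> r s) \<in> borel_measurable (\<Pi>\<^sub>M k\<in>{..<K}. borel)"
  unfolding capacity_kernel_def by measurable

lemma rate_measurable [measurable]: "rate \<N> X los G \<in> borel_measurable P"
  unfolding rate_eq by measurable

text \<open>The test function \<open>h\<close> yields both remaining claims: indicators characterise
  the conditional expectation, and the constant 1 gives the ergodic capacity.\<close>

lemma nn_integral_rate:
  assumes h [measurable]: "h \<in> borel_measurable (\<Pi>\<^sub>M k\<in>{..<K}. borel)"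
  shows "(\<integral>\<^sup>+ \<omega>. h (dists K \<omega>) * rate \<N> X los G \<omega> \<partial>P) =
    (\<integral>\<^sup>+ \<omega>. h (dists K \<omega>) * (ennreal (1 / ln 2) * capacity_integral \<N> (dists K \<omega>)) \<partial>P)"
proof -
  interpret pair_sigma_finite P lborel ..
  \<comment> \<open>For fixed \<open>s\<close>, \<open>g s\<close> collects every factor that
    depends only on the distance vector, so that it can take the place of \<open>h\<close> in
    \<open>nn_integral_interference_random\<close>.\<close>
  define g where "g s r = ennreal (1 / ln 2) * h r * capacity_kernel \<N> r s * indicator {0<..} s" for s r
  have g_meas: "g s \<in> borel_measurable (\<Pi>\<^sub>M k\<in>{..<K}. borel)" for s
    unfolding g_def by measurable
  have [measurable]: "(\<lambda>(\<omega>, s). g s (dists K \<omega>)) \<in> borel_measurable (P \<Otimes>\<^sub>M lborel)"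
    unfolding g_def by measurable
  have [measurable]: "(\<lambda>(\<omega>, s). exponent (last_norm K \<omega>) s) \<in> borel_measurable (P \<Otimes>\<^sub>M lborel)"
    by measurable
  have "(\<integral>\<^sup>+ \<omega>. h (dists K \<omega>) * rate \<N> X los G \<omega> \<partial>P) =
      (\<integral>\<^sup>+ \<omega>. (\<integral>\<^sup>+ s. g s (dists K \<omega>) * nexp (ennreal s * TI (last_norm K \<omega>) \<omega>) \<partial>lborel) \<partial>P)"
    unfolding rate_eq g_def
    by (intro nn_integral_cong) (simp add: nn_integral_cmult[symmetric] mult_ac)
  also have "\<dots> = (\<integral>\<^sup>+ s. (\<integral>\<^sup>+ \<omega>. g s (dists K \<omega>) * nexp (ennreal s * TI (last_norm K \<omega>) \<omega>) \<partial>P) \<partial>lborel)"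
    by (rule Fubini'[symmetric]) measurable
  also have "\<dots> = (\<integral>\<^sup>+ s. (\<integral>\<^sup>+ \<omega>. g s (dists K \<omega>) * nexp (exponent (last_norm K \<omega>) s) \<partial>P) \<partial>lborel)"
  proof (rule nn_integral_cong)
    fix s :: real
    show "(\<integral>\<^sup>+ \<omega>. g s (dists K \<omega>) * nexp (ennreal s * TI (last_norm K \<omega>) \<omega>) \<partial>P) =
        (\<integral>\<^sup>+ \<omega>. g s (dists K \<omega>) * nexp (exponent (last_norm K \<omega>) s) \<partial>P)"
      using nn_integral_interference_random[OF g_meas[of s], of s]
      by (cases "s > 0") (simp_all add: g_def)
  qed
  also have "\<dots> = (\<integral>\<^sup>+ \<omega>. (\<integral>\<^sup>+ s. g s (dists K \<omega>) * nexp (exponent (last_norm K \<omega>) s) \<partial>lborel) \<partial>P)"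
    by (rule Fubini') measurable
  also have "\<dots> = (\<integral>\<^sup>+ \<omega>. h (dists K \<omega>) * (ennreal (1 / ln 2) * capacity_integral \<N> (dists K \<omega>)) \<partial>P)"
    unfolding capacity_integral_eq g_def last_norm_eq_final
    by (intro nn_integral_cong) (simp add: nn_integral_cmult[symmetric] mult_ac)
  finally show ?thesis .
qed

text \<open>Sets of the generated algebra are preimages under the distance vector, so their
  indicators are functions of it. This identifies the formula for fixed distances with the genuine
  conditional expectation.\<close>

lemma cond_exp_rate:
  "AE \<omega> in P. nn_cond_exp P (serving_dists_algebra \<N> P X) (rate \<N> X los G) \<omega> =
    ennreal (1 / ln 2) * capacity_integral \<N> (serving_dists \<N> X \<omega>)"
proof -
  let ?R = "\<Pi>\<^sub>M k\<in>{..<K}. borel :: real measure"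
  define F where "F = vimage_algebra (space P) (dists K) ?R"
  have dF: "dists K \<in> space P \<rightarrow> space ?R"
    using measurable_space[OF dists_measurable] by auto
  have sets_F: "sets F = {dists K -` A \<inter> space P | A. A \<in> sets ?R}"
    unfolding F_def by (rule sets_vimage_algebra2[OF dF])
  have "subalgebra P F"
    unfolding subalgebra_def sets_F by (auto simp: F_def intro: measurable_sets[OF dists_measurable])
  then interpret finite_measure_subalgebra P F by unfold_locales
  have "AE \<omega> in P. ennreal (1 / ln 2) * capacity_integral \<N> (dists K \<omega>) = nn_cond_exp P F (rate \<N> X los G) \<omega>"
  proof (rule nn_cond_exp_charact)
    fix A assume "A \<in> sets F"
    then obtain B where B: "B \<in> sets ?R" "A = dists K -` B \<inter> space P" by (auto simp: sets_F)
    have ind: "indicator A \<omega> = (indicator B (dists K \<omega>) :: ennreal)" if "\<omega> \<in> space P" for \<omega>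
      using that by (auto simp: B(2) indicator_def)
    have "(\<integral>\<^sup>+ \<omega>\<in>A. rate \<N> X los G \<omega> \<partial>P) = (\<integral>\<^sup>+ \<omega>. indicator B (dists K \<omega>) * rate \<N> X los G \<omega> \<partial>P)"
      by (intro nn_integral_cong) (simp add: ind mult.commute)
    also have "\<dots> = (\<integral>\<^sup>+ \<omega>. indicator B (dists K \<omega>) * (ennreal (1 / ln 2) * capacity_integral \<N> (dists K \<omega>)) \<partial>P)"
      using B(1) by (intro nn_integral_rate) simp
    also have "\<dots> = (\<integral>\<^sup>+ \<omega>\<in>A. (ennreal (1 / ln 2) * capacity_integral \<N> (dists K \<omega>)) \<partial>P)"
      by (intro nn_integral_cong) (simp add: ind mult.commute)
    finally show "(\<integral>\<^sup>+ \<omega>\<in>A. rate \<N> X los G \<omega> \<partial>P) =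
        (\<integral>\<^sup>+ \<omega>\<in>A. (ennreal (1 / ln 2) * capacity_integral \<N> (dists K \<omega>)) \<partial>P)" .
  next
    have [measurable]: "dists K \<in> measurable F ?R"
      unfolding F_def by (rule measurable_vimage_algebra1[OF dF])
    show "(\<lambda>\<omega>. ennreal (1 / ln 2) * capacity_integral \<N> (dists K \<omega>)) \<in> borel_measurable F"
      by measurable
  qed measurable
  moreover have "serving_dists_algebra \<N> P X = F"
    by (simp add: serving_dists_algebra_def F_def serving_dists_eq)
  ultimately show ?thesis
    by (simp add: serving_dists_eq eq_commute)
qed

text \<open>The expectation of a function of the serving distances is transported to their joint
  law, whose density is known.\<close>

lemma ergodic_capacity_eq:
  "ergodic_capacity \<N> P X los G = ennreal (1 / ln 2) *
    (\<integral>\<^sup>+ r\<in>dist_domain \<N>.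
      ennreal ((2 * pi * ap_density \<N>) ^ K * (\<Prod>k<K. r k) * exp (- pi * ap_density \<N> * (last_dist \<N> r)\<^sup>2))
      * capacity_integral \<N> r \<partial>(\<Pi>\<^sub>M k\<in>{..<K}. lborel))"
proof -
  have sets_eq: "sets (\<Pi>\<^sub>M k\<in>{..<K}. lborel :: real measure) = sets (\<Pi>\<^sub>M k\<in>{..<K}. borel)"
    by (intro sets_PiM_cong) auto
  have [measurable]: "capacity_integral \<N> \<in> borel_measurable (\<Pi>\<^sub>M k\<in>{..<K}. lborel)"
      "dists_density area_rate K \<in> borel_measurable (\<Pi>\<^sub>M k\<in>{..<K}. lborel)"
    using measurable_capacity_integral dists_density_measurable
    by (simp_all cong: measurable_cong_sets add: sets_eq)
  have "ergodic_capacity \<N> P X los G =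
      (\<integral>\<^sup>+ \<omega>. ennreal (1 / ln 2) * capacity_integral \<N> (dists K \<omega>) \<partial>P)"
    using nn_integral_rate[of "\<lambda>_. 1"] by (simp add: ergodic_capacity_def)
  also have "\<dots> = (\<integral>\<^sup>+ r. ennreal (1 / ln 2) * capacity_integral \<N> r \<partial>distr P (\<Pi>\<^sub>M k\<in>{..<K}. borel) (dists K))"
    by (subst nn_integral_distr) auto
  also have "\<dots> = (\<integral>\<^sup>+ r. dists_density area_rate K r * (ennreal (1 / ln 2) * capacity_integral \<N> r) \<partial>(\<Pi>\<^sub>M k\<in>{..<K}. lborel))"
    unfolding distr_dists by (subst nn_integral_density) auto
  also have "\<dots> = (\<integral>\<^sup>+ r. ennreal (1 / ln 2) * (dists_density area_rate K r * capacity_integral \<N> r) \<partial>(\<Pi>\<^sub>M k\<in>{..<K}. lborel))"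
    by (simp add: mult_ac)
  also have "\<dots> = ennreal (1 / ln 2) * (\<integral>\<^sup>+ r. dists_density area_rate K r * capacity_integral \<N> r \<partial>(\<Pi>\<^sub>M k\<in>{..<K}. lborel))"
    by (rule nn_integral_cmult) measurable
  also have "(\<integral>\<^sup>+ r. dists_density area_rate K r * capacity_integral \<N> r \<partial>(\<Pi>\<^sub>M k\<in>{..<K}. lborel)) =
    (\<integral>\<^sup>+ r\<in>dist_domain \<N>.
      ennreal ((2 * pi * ap_density \<N>) ^ K * (\<Prod>k<K. r k) * exp (- pi * ap_density \<N> * (last_dist \<N> r)\<^sup>2))
      * capacity_integral \<N> r \<partial>(\<Pi>\<^sub>M k\<in>{..<K}. lborel))"
    by (intro nn_integral_cong)
      (simp add: dists_density_def ordered_domain_def dist_domain_def last_dist_eq_final mult_ac)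
  finally show ?thesis .
qed

end

theorem theorem3:
  fixes \<N> :: network
    and P :: "'w measure"
    and X :: "nat \<Rightarrow> 'w \<Rightarrow> real^2"
    and los :: "nat \<Rightarrow> 'w \<Rightarrow> bool"
    and G :: "nat \<Rightarrow> 'w \<Rightarrow> real"
  assumes "valid_network \<N>"
    and "network_model \<N> P X los G"
  shows "(\<forall>r\<in>dist_domain \<N>.
            cond_capacity \<N> P X los G r = ennreal (1 / ln 2) * capacity_integral \<N> r)
    \<and> (AE \<omega> in P. nn_cond_exp P (serving_dists_algebra \<N> P X) (rate \<N> X los G) \<omega> =
            ennreal (1 / ln 2) * capacity_integral \<N> (serving_dists \<N> X \<omega>))
    \<and> ergodic_capacity \<N> P X los G =
         ennreal (1 / ln 2) *
         (\<integral>\<^sup>+ r\<in>dist_domain \<N>.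
            ennreal ((2 * pi * ap_density \<N>) ^ num_serving \<N> * (\<Prod>k<num_serving \<N>. r k)
              * exp (- pi * ap_density \<N> * (last_dist \<N> r)\<^sup>2))
            * capacity_integral \<N> r \<partial>(\<Pi>\<^sub>M k\<in>{..<num_serving \<N>}. lborel))"
proof -
  interpret mmwave_network \<N> P X los G
    using assms by unfold_locales
  show ?thesis
    using cond_capacity_eq cond_exp_rate ergodic_capacity_eq by blast
qed

end
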